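(* Consider the system $$\begin{aligned} \dot\eta&=f_0(\eta,\xi_{1,\ell_1},\xi_{2,\ell_2},\dots,\xi_{m,\ell_m}),\\ \dot\xi_{i,j}&=\xi_{i,j+1}+\sum_{l=1}^{i-1}\delta_{i,j,l}(\eta,\xi)v_l,\quad j=1,\dots,q_i-1,\\ \dot\xi_{i,q_i}&=v_i,\qquad y_{{\rm d},i}=\xi_{i,1},\qquad i=1,\dots,m, \end{aligned}$$ where $q_1\le q_2\le\dots\le q_m$, $\xi_i=\mathrm{col}\{\xi_{i,1},\dots,\xi_{i,q_i}\}$ with scalar $\xi_{i,j}$, $\xi=\mathrm{col}\{\xi_1,\dots,\xi_m\}$, $v=\mathrm{col}\{v_1,\dots,v_m\}$ is the input, $\delta_{i,j,l}(\eta,\xi)=0$ for $j<q_l$, $i=1,\dots,m$, and $1\le\ell_1\le q_1+1$, $1\le\ell_i\le q_1$ for $i=2,\dots,m$, with the convention $\xi_{1,q_1+1}\equiv v_1$. Assume that all functions $\delta_{i,j,l}$ and $f_0$ are smooth. Suppose that: 1. the zero dynamics $\dot\eta=f_0(\eta,0,0,\dots,0)$ is globally asymptotically stable at the equilibrium $\eta=0$; 2. there exists an ordered list $\kappa$ containing all variables of $\xi$, whose first $\sum_{s=1}^m(\ell_s-1)$ variables are the $\xi_{s,p}$, $p=1,\dots,\ell_s-1$, $s=1,\dots,m$, such that, for $j=1,\dots,q_i-1$, $l=1,\dots,i-1$, $i=1,\dots,m$: (a) $\xi_{i,j}$ appears earlier than $\xi_{i,j+1}$ in $\kappa$; (b)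 the variables $\xi_l$ (that is, $\xi_{l,1},\dots,\xi_{l,q_l}$) appear earlier than $\xi_{i,j}$ in $\kappa$ if $\delta_{i,j,l}\neq0$; (c) $\delta_{i,j,l}$ depends only on $\eta$, on $\xi_{\ell,1}$, $\ell=1,\dots,m$, and on the variables that appear no later than $\xi_{i,j}$ in $\kappa$. Then the system is semi-globally stabilizable. That is, for any compact set $\mathcal X_0$ of the state space of $(\eta,\xi)$, there exists a state feedback $v$ that locally asymptotically stabilizes the system with $\mathcal X_0$ contained in the domain of attraction.
   Context: $\mathrm{col}\{\cdot\}$ denotes vertical stacking; $\eta$ is a vector in some Euclidean space. $\delta_{i,j,l}\neq0$ means that the function is not identically zero. The system is semi-globally stabilizable by state feedback if, for any compact set of initial conditions $\mathcal X_0$ of the state space, there exists a smooth state feedback $v=\alpha_{\mathcal X_0}(\eta,\xi)$ such that the equilibrium $(\eta,\xi)=(0,0)$ of the closed-loop system is locally asymptotically stable and $\mathcal X_0$ is contained in its domain of attraction. *)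

theory Defs
  imports "HOL-Analysis.Analysis"
begin

text \<open>Differentiability classes of maps between Euclidean spaces, via iterated directional
  derivatives; in finite dimension this is the usual notion of a \<open>C\<^sup>n\<close> map.\<close>

fun C_order :: "nat \<Rightarrow> ('a::euclidean_space \<Rightarrow> 'b::real_normed_vector) \<Rightarrow> bool" where
  "C_order 0 f \<longleftrightarrow> continuous_on UNIV f"
| "C_order (Suc n) f \<longleftrightarrow>
     (\<forall>x. f differentiable (at x)) \<and> (\<forall>h. C_order n (\<lambda>x. frechet_derivative f (at x) h))"

definition smooth :: "('a::euclidean_space \<Rightarrow> 'b::real_normed_vector) \<Rightarrow> bool" where
  "smooth f \<longleftrightarrow> (\<forall>n. C_order n f)"

definition forward_solution :: "('s::euclidean_space \<Rightarrow> 's) \<Rightarrow> 's \<Rightarrow> (real \<Rightarrow> 's) \<Rightarrow> bool" where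
  "forward_solution F x0 \<phi> \<longleftrightarrow>
     \<phi> 0 = x0 \<and> (\<forall>t\<ge>0. (\<phi> has_vector_derivative F (\<phi> t)) (at t within {0..}))"

text \<open>In the next two definitions the solution through \<open>x0\<close> is required to exist for all
  \<open>t \<ge> 0\<close>. They are meant for locally Lipschitz fields, where it is then unique.\<close>

definition stable_at :: "('s::euclidean_space \<Rightarrow> 's) \<Rightarrow> 's \<Rightarrow> bool" where
  "stable_at F e \<longleftrightarrow>
     (\<forall>\<epsilon>>0. \<exists>d>0. \<forall>x0. dist x0 e < d \<longrightarrow>
        (\<exists>\<phi>. forward_solution F x0 \<phi>) \<and>
        (\<forall>\<phi>. forward_solution F x0 \<phi> \<longrightarrow> (\<forall>t\<ge>0. dist (\<phi> t) e < \<epsilon>)))"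

definition domain_of_attraction :: "('s::euclidean_space \<Rightarrow> 's) \<Rightarrow> 's \<Rightarrow> 's set" where
  "domain_of_attraction F e =
     {x0. (\<exists>\<phi>. forward_solution F x0 \<phi>) \<and>
          (\<forall>\<phi>. forward_solution F x0 \<phi> \<longrightarrow> (\<phi> \<longlongrightarrow> e) at_top)}"

definition locally_asymptotically_stable_at :: "('s::euclidean_space \<Rightarrow> 's) \<Rightarrow> 's \<Rightarrow> bool" where
  "locally_asymptotically_stable_at F e \<longleftrightarrow>
     F e = 0 \<and> stable_at F e \<and> (\<exists>r>0. ball e r \<subseteq> domain_of_attraction F e)"

definition globally_asymptotically_stable_at :: "('s::euclidean_space \<Rightarrow> 's) \<Rightarrow> 's \<Rightarrow> bool" where
  "globally_asymptotically_stable_at F e \<longleftrightarrow>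
     F e = 0 \<and> stable_at F e \<and> domain_of_attraction F e = UNIV"

definition semiglobally_stabilizable ::
    "('s::euclidean_space \<Rightarrow> 'u::real_normed_vector \<Rightarrow> 's) \<Rightarrow> bool" where
  "semiglobally_stabilizable G \<longleftrightarrow>
     (\<forall>X0. compact X0 \<longrightarrow>
        (\<exists>\<alpha>. smooth \<alpha> \<and>
             locally_asymptotically_stable_at (\<lambda>x. G x (\<alpha> x)) 0 \<and>
             X0 \<subseteq> domain_of_attraction (\<lambda>x. G x (\<alpha> x)) 0))"

text \<open>The chains \<open>1, \<dots>, m\<close> are indexed by a finite linearly ordered type \<open>'m\<close>, so that
  \<open>m = CARD('m)\<close>. The scalar variables of \<open>\<xi>\<close> have the names \<open>(i, j)\<close> with
  \<open>1 \<le> j \<le> q i\<close>. Since a type cannot depend on \<open>q\<close>, the vector \<open>\<xi>\<close> has type \<open>real ^ 'k\<close>, where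
  a bijection \<open>var\<close> from the set of names onto \<open>'k\<close> gives the coordinate of each variable:
  \<open>\<xi> $ var (i, j)\<close> is \<open>\<xi>\<^sub>i\<^sub>,\<^sub>j\<close>.\<close>

definition first_chain :: "'m::{finite,linorder}" where
  "first_chain = Min UNIV"

definition chain_vars :: "('m \<Rightarrow> nat) \<Rightarrow> ('m \<times> nat) set" where
  "chain_vars q = {(i, j). 1 \<le> j \<and> j \<le> q i}"

text \<open>The last \<open>m\<close> arguments of \<open>f0\<close>. The first case is the convention that the variable of
  index \<open>q i + 1\<close> stands for \<open>v $ i\<close>; the bounds on \<open>ell\<close> allow it only for the first chain.\<close>

definition zero_dynamics_input ::
    "('m \<Rightarrow> nat) \<Rightarrow> ('m \<Rightarrow> nat) \<Rightarrow> ('m \<times> nat \<Rightarrow> 'k) \<Rightarrow> real ^ 'k \<Rightarrow> real ^ 'm \<Rightarrow> real ^ 'm" where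
  "zero_dynamics_input q ell var \<xi> v =
     (\<chi> i. if ell i = q i + 1 then v $ i else \<xi> $ var (i, ell i))"

definition chain_field ::
    "('m::{finite,linorder} \<Rightarrow> nat) \<Rightarrow> ('m \<times> nat \<Rightarrow> 'k) \<Rightarrow>
     ('m \<Rightarrow> nat \<Rightarrow> 'm \<Rightarrow> 'e \<Rightarrow> real ^ 'k \<Rightarrow> real) \<Rightarrow> 'e \<Rightarrow> real ^ 'k \<Rightarrow> (real, 'm) vec \<Rightarrow> real ^ 'k" where
  "chain_field q var \<delta> \<eta> \<xi> v =
     (\<chi> k. case the_inv_into (chain_vars q) var k of (i, j) \<Rightarrow>
        if j < q i then \<xi> $ var (i, j + 1) + (\<Sum>l | l < i. \<delta> i j l \<eta> \<xi> * v $ l)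
        else v $ i)"

definition control_system ::
    "('m::{finite,linorder} \<Rightarrow> nat) \<Rightarrow> ('m \<Rightarrow> nat) \<Rightarrow> ('m \<times> nat \<Rightarrow> 'k) \<Rightarrow>
     ('e \<Rightarrow> (real, 'm) vec \<Rightarrow> 'e) \<Rightarrow> ('m \<Rightarrow> nat \<Rightarrow> 'm \<Rightarrow> 'e \<Rightarrow> real ^ 'k \<Rightarrow> real) \<Rightarrow>
     'e \<times> (real ^ 'k) \<Rightarrow> (real, 'm) vec \<Rightarrow> 'e \<times> (real ^ 'k)" where
  "control_system q ell var f0 \<delta> = (\<lambda>(\<eta>, \<xi>) v.
     (f0 \<eta> (zero_dynamics_input q ell var \<xi> v), chain_field q var \<delta> \<eta> \<xi> v))"

definition earlier_in :: "'b list \<Rightarrow> 'b \<Rightarrow> 'b \<Rightarrow> bool" where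
  "earlier_in \<kappa> a b \<longleftrightarrow> (\<exists>r s. r < s \<and> s < length \<kappa> \<and> \<kappa> ! r = a \<and> \<kappa> ! s = b)"

definition depends_only_on ::
    "('m \<times> nat \<Rightarrow> 'k) \<Rightarrow> ('e \<Rightarrow> real ^ 'k \<Rightarrow> real) \<Rightarrow> ('m \<times> nat) set \<Rightarrow> bool" where
  "depends_only_on var g S \<longleftrightarrow>
     (\<forall>\<eta> \<xi> \<xi>'. (\<forall>p\<in>S. \<xi> $ var p = \<xi>' $ var p) \<longrightarrow> g \<eta> \<xi> = g \<eta> \<xi>')"

end

(* Idea. Every chain gets a linear feedback that does not involve \<eta>. With
   e_{i,1} = \<xi>_{i,1} and e_{i,j+1} = (D + \<gamma>_{i,j}) e_{i,j}, where D shifts \<xi>_{i,j} to \<xi>_{i,j+1},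
   let v_i be such that e_{i,q_i+1} = 0. In these coordinates the closed loop reads
     e_{i,j}' = - \<gamma>_{i,j} e_{i,j} + e_{i,j+1} + (terms \<delta> v_l with variables \<xi>_l earlier in \<kappa>),
   which is triangular with respect to \<kappa> except for the couplings e_{i,j+1} with coefficient 1.
   The gains \<gamma>_{i,j} with j < \<ell>_i are a small constant \<epsilon>; the others are chosen one after the other
   along \<kappa>, each large compared with everything that depends on the preceding ones. A weighted
   sum W of the squares e_{i,j}^2 then decreases, provided that \<eta> stays bounded, and the weights
   can be taken so that the bound on the variables on which \<delta>_{i,j,l} depends involves preceding
   gains only.

   The input of the \<eta>-system is bounded by \<rho> - \<mu> W' with \<rho>, \<mu> small: low gain makes it small,
   up to the e_{i,\<ell>_i}, which are small in mean square by high gain. A perturbation that is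
   small in mean over windows of a fixed length does not destroy boundedness: by Gronwall's
   inequality the perturbed solution follows a solution of the zero dynamics over each window,
   at the end of which it is back in the initial ball. No Lyapunov function for the zero
   dynamics is needed. *)

theory Submission
  imports Defs
begin

section \<open>Lipschitz maps, existence of solutions and Gronwall's inequality\<close>

text \<open>The obstacle is circularity. The gains must dominate bounds on the
  \<open>\<delta>\<close> functions, these bounds hold on a sublevel set of \<open>W\<close>, and
  \<open>W\<close> itself depends on the gains; moreover high gain makes error variables peak. The
  weights break the circle: they are normalised so that \<open>W\<close> is initially at most the
  number of variables, whatever the gains, and so the level is fixed before them. On this level
  \<xi>_{i,1} is bounded by a power of 1/\<epsilon> times a constant, which is why
  \<open>\<delta>\<close> may depend on every \<xi>_{i,1}, wherever it stands in \<kappa>. The first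
  high error e_{i,\<ell>_i} does not peak, because only low gains enter its weight; its square has a
  time integral of order 1/\<open>\<Lambda>\<close>, and the \<eta>-system is disturbed in
  proportion to such integrals. Finally, v_l is bounded by the errors of chain l alone, so that a
  term \<delta> v_l involves only variables preceding the one that it disturbs.\<close>

definition lipschitz_on_bounded :: "('a::real_normed_vector \<Rightarrow> 'b::real_normed_vector) \<Rightarrow> bool" where
  "lipschitz_on_bounded f \<longleftrightarrow> (\<forall>R. \<exists>L. L-lipschitz_on (cball 0 R) f)"

lemma lipschitz_on_bounded_bound:
  assumes "lipschitz_on_bounded f"
  shows "\<exists>B\<ge>0. \<forall>x\<in>cball 0 R. norm (f x) \<le> B"
proof -
  obtain L where L: "L-lipschitz_on (cball 0 R) f"
    using assms unfolding lipschitz_on_bounded_def by blast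
  show ?thesis
  proof (cases "R \<ge> 0")
    case True
    have "norm (f x) \<le> norm (f 0) + L * R" if "x \<in> cball 0 R" for x
    proof -
      have "norm (f x - f 0) \<le> L * norm (x - 0)"
        using lipschitz_on_normD[OF L that, of 0] True by simp
      also have "\<dots> \<le> L * R"
        using that lipschitz_on_nonneg[OF L] by (simp add: mult_left_mono)
      finally show ?thesis
        using norm_triangle_sub[of "f x" "f 0"] by linarith
    qed
    moreover have "0 \<le> norm (f 0) + L * R"
      using lipschitz_on_nonneg[OF L] True by simp
    ultimately show ?thesis by blast
  qed (auto intro!: exI[of _ 0] simp: not_le)
qed

section \<open>Closure properties of maps that are Lipschitz on bounded sets\<close>

lemma lipschitz_on_bounded_const: "lipschitz_on_bounded (\<lambda>x. c)"
  unfolding lipschitz_on_bounded_def using lipschitz_on_constant by blast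

lemma lipschitz_on_bounded_linear:
  assumes "bounded_linear f"
  shows "lipschitz_on_bounded f"
  unfolding lipschitz_on_bounded_def
  using bounded_linear.lipschitz_boundE[OF assms] by metis

lemma lipschitz_on_bounded_add:
  assumes "lipschitz_on_bounded f" "lipschitz_on_bounded g"
  shows "lipschitz_on_bounded (\<lambda>x. f x + g x)"
  using assms unfolding lipschitz_on_bounded_def by (blast intro: lipschitz_on_add)

lemma lipschitz_on_bounded_sum:
  assumes "\<And>i. i \<in> A \<Longrightarrow> lipschitz_on_bounded (f i)"
  shows "lipschitz_on_bounded (\<lambda>x. \<Sum>i\<in>A. f i x)"
  using assms
  by (induction A rule: infinite_finite_induct)
     (auto intro: lipschitz_on_bounded_const lipschitz_on_bounded_add)

lemma lipschitz_on_bounded_Pair: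
  assumes "lipschitz_on_bounded f" "lipschitz_on_bounded g"
  shows "lipschitz_on_bounded (\<lambda>x. (f x, g x))"
  using assms unfolding lipschitz_on_bounded_def by (blast intro: lipschitz_on_Pair)

lemma lipschitz_on_bounded_compose:
  assumes f: "lipschitz_on_bounded f" and g: "lipschitz_on_bounded g"
  shows "lipschitz_on_bounded (\<lambda>x. g (f x))"
  unfolding lipschitz_on_bounded_def
proof
  fix R
  obtain B where "\<forall>x\<in>cball 0 R. norm (f x) \<le> B"
    using lipschitz_on_bounded_bound[OF f] by blast
  then have sub: "f ` cball 0 R \<subseteq> cball 0 B" by auto
  obtain L M where "L-lipschitz_on (cball 0 R) f" "M-lipschitz_on (cball 0 B) g"
    using f g unfolding lipschitz_on_bounded_def by blast
  then show "\<exists>L. L-lipschitz_on (cball 0 R) (\<lambda>x. g (f x))"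
    using lipschitz_on_compose2 lipschitz_on_subset[OF _ sub] by blast
qed

lemma lipschitz_on_bounded_mult:
  fixes f g :: "'b::real_normed_vector \<Rightarrow> real"
  assumes f: "lipschitz_on_bounded f" and g: "lipschitz_on_bounded g"
  shows "lipschitz_on_bounded (\<lambda>x. f x * g x)"
  unfolding lipschitz_on_bounded_def
proof
  fix R
  obtain A B where A: "A \<ge> 0" "\<forall>x\<in>cball 0 R. norm (f x) \<le> A"
    and B: "B \<ge> 0" "\<forall>x\<in>cball 0 R. norm (g x) \<le> B"
    using lipschitz_on_bounded_bound[OF f] lipschitz_on_bounded_bound[OF g] by meson
  obtain L M where L: "L-lipschitz_on (cball 0 R) f" and M: "M-lipschitz_on (cball 0 R) g"
    using f g unfolding lipschitz_on_bounded_def by blast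
  have "(A * M + B * L)-lipschitz_on (cball 0 R) (\<lambda>x. f x * g x)"
  proof (rule lipschitz_onI)
    fix x y :: 'b assume xy: "x \<in> cball 0 R" "y \<in> cball 0 R"
    have "f x * g x - f y * g y = f x * (g x - g y) + g y * (f x - f y)"
      by (simp add: algebra_simps)
    then have "\<bar>f x * g x - f y * g y\<bar> \<le> \<bar>f x\<bar> * \<bar>g x - g y\<bar> + \<bar>g y\<bar> * \<bar>f x - f y\<bar>"
      by (metis abs_mult abs_triangle_ineq)
    also have "\<dots> \<le> A * (M * dist x y) + B * (L * dist x y)"
      using A B xy lipschitz_onD[OF L xy] lipschitz_onD[OF M xy]
      by (intro add_mono mult_mono) (auto simp: dist_real_def)
    finally show "dist (f x * g x) (f y * g y) \<le> (A * M + B * L) * dist x y"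
      by (simp add: dist_real_def algebra_simps)
  qed (use A B lipschitz_on_nonneg[OF L] lipschitz_on_nonneg[OF M] in simp)
  then show "\<exists>L. L-lipschitz_on (cball 0 R) (\<lambda>x. f x * g x)" by blast
qed

lemma lipschitz_on_bounded_componentwise:
  fixes f :: "'a::real_normed_vector \<Rightarrow> real ^ 'n"
  assumes "\<And>i. lipschitz_on_bounded (\<lambda>x. f x $ i)"
  shows "lipschitz_on_bounded f"
proof -
  have 1: "f x = (\<Sum>i\<in>UNIV. (f x $ i) *\<^sub>R axis i 1)" for x
    by (simp add: vec_eq_iff axis_def if_distrib cong: if_cong)
  have "lipschitz_on_bounded (\<lambda>x. (f x $ i) *\<^sub>R (axis i 1 :: real ^ 'n))" for i
    using lipschitz_on_bounded_compose[OF assms[of i]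
        lipschitz_on_bounded_linear[OF bounded_linear_scaleR_left]] .
  then have "lipschitz_on_bounded (\<lambda>x. \<Sum>i\<in>UNIV. (f x $ i) *\<^sub>R (axis i 1 :: real ^ 'n))"
    by (rule lipschitz_on_bounded_sum)
  then show ?thesis
    by (simp flip: 1)
qed

text \<open>Through this lemma the smoothness of \<open>f0\<close> and of the
  \<open>\<delta>\<close> functions enters: balls are compact and convex, so a continuous derivative
  gives a Lipschitz constant there.\<close>

lemma smooth_imp_lipschitz_on_bounded:
  fixes f :: "'a::euclidean_space \<Rightarrow> 'b::real_normed_vector"
  assumes "smooth f"
  shows "lipschitz_on_bounded f"
  unfolding lipschitz_on_bounded_def
proof
  fix R
  have "C_order (Suc 0) f"
    using assms by (simp only: smooth_def)
  then have diff: "\<And>x. f differentiable (at x)"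
    and cont: "\<And>h. continuous_on UNIV (\<lambda>x. frechet_derivative f (at x) h)"
    by auto
  \<comment> \<open>\<open>C_order\<close> gives continuity of the derivative in each fixed
    direction; the bounds on the basis vectors are then added up to bound the operator norm.\<close>
  have "\<exists>B. \<forall>x\<in>cball 0 R. norm (frechet_derivative f (at x) b) \<le> B" for b
  proof -
    have "compact ((\<lambda>x. frechet_derivative f (at x) b) ` cball 0 R)"
      by (intro compact_continuous_image continuous_on_subset[OF cont]) auto
    then have "bounded ((\<lambda>x. frechet_derivative f (at x) b) ` cball 0 R)"
      by (rule compact_imp_bounded)
    then show ?thesis
      by (auto simp: bounded_iff)
  qed
  then obtain B where B: "\<And>b x. x \<in> cball 0 R \<Longrightarrow> norm (frechet_derivative f (at x) b) \<le> B b"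
    by metis
  define C where "C = (\<Sum>b\<in>(Basis::'a set). \<bar>B b\<bar>)"
  have "C-lipschitz_on (cball 0 R) f"
  proof (rule bounded_derivative_imp_lipschitz)
    fix x :: 'a assume x: "x \<in> cball 0 R"
    have D: "(f has_derivative frechet_derivative f (at x)) (at x)"
      using diff frechet_derivative_works by blast
    then show "(f has_derivative frechet_derivative f (at x)) (at x within cball 0 R)"
      by (rule has_derivative_at_withinI)
    interpret bounded_linear "frechet_derivative f (at x)"
      using D by (rule has_derivative_bounded_linear)
    show "onorm (frechet_derivative f (at x)) \<le> C"
    proof (rule onorm_le)
      fix h :: 'a
      have "norm (frechet_derivative f (at x) h)
          = norm (\<Sum>b\<in>Basis. (h \<bullet> b) *\<^sub>R frechet_derivative f (at x) b)"
        by (subst euclidean_representation[of h, symmetric]) (simp only: sum scaleR)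
      also have "\<dots> \<le> (\<Sum>b\<in>Basis. norm h * \<bar>B b\<bar>)"
      proof (rule sum_norm_le)
        fix b :: 'a assume b: "b \<in> Basis"
        show "norm ((h \<bullet> b) *\<^sub>R frechet_derivative f (at x) b) \<le> norm h * \<bar>B b\<bar>"
          using B[OF x, of b] Basis_le_norm[OF b, of h] by (simp add: mult_mono)
      qed
      also have "\<dots> = C * norm h"
        by (simp add: C_def sum_distrib_left mult.commute)
      finally show "norm (frechet_derivative f (at x) h) \<le> C * norm h" .
    qed
  qed (auto simp: C_def sum_nonneg)
  then show "\<exists>L. L-lipschitz_on (cball 0 R) f" by blast
qed

text \<open>The constructed feedback is linear; this supplies the smoothness that
  \<open>semiglobally_stabilizable\<close> demands.\<close>

lemma bounded_linear_imp_smooth: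
  fixes f :: "'a::euclidean_space \<Rightarrow> 'b::real_normed_vector"
  assumes "bounded_linear f"
  shows "smooth f"
proof -
  have const: "C_order n (\<lambda>x::'a. c::'b)" for n c
    by (induction n arbitrary: c) auto
  have D: "(f has_derivative f) (at x)" for x
    using assms by (rule bounded_linear_imp_has_derivative)
  have "frechet_derivative f (at x) = f" for x
    using D frechet_derivative_at by metis
  then have "C_order n f" for n
    using D const by (cases n) (auto simp: linear_continuous_on[OF assms] differentiable_def)
  then show ?thesis
    by (simp add: smooth_def)
qed

text \<open>Picard iteration contracts in the norm weighted by \<open>exp (- K t)\<close>, so that a single application
  of Banach's theorem covers the whole half-line.\<close>

lemma forward_solution_exists_bounded:
  fixes f :: "'a::euclidean_space \<Rightarrow> 'a"
  assumes L: "L-lipschitz_on UNIV f" and M: "\<And>x. norm (f x) \<le> M"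
  shows "\<exists>\<phi>. forward_solution f x0 \<phi>"
proof -
  \<comment> \<open>Any \<open>K > L\<close> makes the contraction factor \<open>L / K\<close> less
    than 1.\<close>
  define K where "K = L + 1"
  have L0: "0 \<le> L" using L by (rule lipschitz_on_nonneg)
  have K: "K > 0" "L < K" using L0 by (auto simp: K_def)
  have M0: "0 \<le> M" using M[of 0] norm_ge_zero order_trans by blast
  have cf: "continuous_on UNIV f" using L by (rule lipschitz_on_continuous_on)
  \<comment> \<open>The unknown is \<open>u\<close>, with the solution recovered as
    \<open>exp (K * t)\<close> times \<open>u t\<close>. Solutions of a bounded field grow at most
    linearly, so \<open>u\<close> is bounded.\<close>
  define I where "I u t = integral {0..t} (\<lambda>s. f (exp (K * s) *\<^sub>R apply_bcontfun u s))"
    for u :: "real \<Rightarrow>\<^sub>C 'a" and t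
  have ci: "continuous_on S (\<lambda>s. f (exp (K * s) *\<^sub>R apply_bcontfun u s))"
    for u :: "real \<Rightarrow>\<^sub>C 'a" and S
    by (rule continuous_on_compose2[OF cf]) (auto intro!: continuous_intros)
  have int: "(\<lambda>s. f (exp (K * s) *\<^sub>R apply_bcontfun u s)) integrable_on {0..t}"
    for u :: "real \<Rightarrow>\<^sub>C 'a" and t
    using ci by (rule integrable_continuous_real)
  \<comment> \<open>Bounded continuous functions live on the whole line; for negative times
    \<open>P u\<close> is frozen at its value at 0.\<close>
  define P where "P u t = exp (- K * max t 0) *\<^sub>R (x0 + I u (max t 0))" for u t
  have "P u \<in> bcontfun" for u
  proof -
    have "continuous_on {0..} (I u)"
    proof -
      have "continuous_on {0..b} (I u)" for b
        unfolding I_def by (rule indefinite_integral_continuous_1[OF int])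
      then have "continuous (at t within {0..}) (I u)" if "t \<ge> 0" for t
        using that at_within_nhd[of t "{..<t+1}" "{0..}" "{0..t+1}"]
        by (force simp: continuous_on_eq_continuous_within)
      then show ?thesis
        by (simp add: continuous_on_eq_continuous_within)
    qed
    then have "continuous_on UNIV (\<lambda>t. I u (max t 0))"
      by (rule continuous_on_compose2) (auto intro!: continuous_intros)
    then have "continuous_on UNIV (P u)"
      unfolding P_def[abs_def] by (intro continuous_intros)
    moreover have "norm (P u t) \<le> norm x0 + M / K" for t
    proof -
      define s where "s = max t 0"
      have s: "s \<ge> 0" by (simp add: s_def)
      have "norm (I u s) \<le> integral {0..s} (\<lambda>_. M)"
        unfolding I_def by (rule integral_norm_bound_integral[OF int]) (auto simp: M)
      then have 1: "norm (I u s) \<le> M * s"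
        using s by (simp add: mult.commute)
      have "exp (- K * s) * s \<le> 1 / K"
      proof -
        have "s * K \<le> exp (s * K)"
          using exp_ge_add_one_self[of "s * K"] by linarith
        then show ?thesis
          using K by (simp add: exp_minus field_simps)
      qed
      then have 2: "M * (exp (- K * s) * s) \<le> M * (1 / K)"
        using M0 by (rule mult_left_mono)
      have "exp (- K * s) * norm (I u s) \<le> exp (- K * s) * (M * s)"
        using 1 by (intro mult_left_mono) auto
      also have "\<dots> = M * (exp (- K * s) * s)"
        by (rule mult.left_commute)
      also note 2
      finally have "exp (- K * s) * norm (I u s) \<le> M / K"
        by simp
      moreover have "norm (P u t) \<le> exp (- K * s) * norm x0 + exp (- K * s) * norm (I u s)"
        unfolding P_def s_def[symmetric]
        by (simp add: norm_triangle_ineq flip: distrib_left)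
      moreover have "exp (- K * s) * norm x0 \<le> norm x0"
        using K s by (simp add: mult_left_le_one_le)
      ultimately show ?thesis by linarith
    qed
    ultimately show ?thesis
      by (auto simp: bcontfun_def intro: boundedI)
  qed
  then have P: "apply_bcontfun (Bcontfun (P u)) = P u" for u
    by (simp add: Bcontfun_inverse)
  have "dist (Bcontfun (P u)) (Bcontfun (P v)) \<le> L / K * dist u v" for u v
  proof (rule dist_bound)
    fix t :: real
    define s where "s = max t 0"
    have s: "s \<ge> 0" by (auto simp: s_def)
    have "I u s - I v s = integral {0..s} (\<lambda>r. f (exp (K * r) *\<^sub>R apply_bcontfun u r)
        - f (exp (K * r) *\<^sub>R apply_bcontfun v r))"
      unfolding I_def by (rule integral_diff[OF int int, symmetric])
    also have "norm \<dots> \<le> integral {0..s} (\<lambda>r. L * dist u v * exp (K * r))"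
    proof (rule integral_norm_bound_integral)
      fix r assume "r \<in> {0..s}"
      have "norm (f (exp (K * r) *\<^sub>R apply_bcontfun u r) - f (exp (K * r) *\<^sub>R apply_bcontfun v r))
          \<le> L * norm (exp (K * r) *\<^sub>R apply_bcontfun u r - exp (K * r) *\<^sub>R apply_bcontfun v r)"
        by (rule lipschitz_on_normD[OF L]) auto
      also have "\<dots> = L * (exp (K * r) * dist (apply_bcontfun u r) (apply_bcontfun v r))"
        by (simp add: dist_norm flip: scaleR_diff_right)
      also have "\<dots> \<le> L * (exp (K * r) * dist u v)"
        using L0 dist_bounded by (intro mult_left_mono) auto
      finally show "norm (f (exp (K * r) *\<^sub>R apply_bcontfun u r)
          - f (exp (K * r) *\<^sub>R apply_bcontfun v r)) \<le> L * dist u v * exp (K * r)"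
        by (simp add: mult_ac)
    qed (auto intro!: integrable_diff int integrable_continuous_real ci continuous_intros)
    \<comment> \<open>Integrating the weight produces the factor \<open>1 / K\<close> that turns
      \<open>L\<close> into \<open>L / K\<close>.\<close>
    also have "\<dots> = L * dist u v * ((exp (K * s) - 1) / K)"
    proof -
      have "((\<lambda>r. exp (K * r)) has_integral (exp (K * s) / K - exp (K * 0) / K)) {0..s}"
        using K s by (intro fundamental_theorem_of_calculus)
          (auto intro!: derivative_eq_intros simp flip: has_real_derivative_iff_has_vector_derivative)
      then have "integral {0..s} (\<lambda>r. exp (K * r)) = (exp (K * s) - 1) / K"
        by (simp add: integral_unique diff_divide_distrib)
      then show ?thesis by simp
    qed
    finally have "norm (I u s - I v s) \<le> L * dist u v * ((exp (K * s) - 1) / K)" .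
    then have "exp (- K * s) * norm (I u s - I v s)
        \<le> exp (- K * s) * (L * dist u v * ((exp (K * s) - 1) / K))"
      by (rule mult_left_mono) simp
    also have "\<dots> = L / K * dist u v * (1 - exp (- K * s))"
      by (simp add: exp_minus field_simps)
    also have "\<dots> \<le> L / K * dist u v"
      using K L0 by (intro mult_left_le) auto
    finally have "exp (- K * s) * norm (I u s - I v s) \<le> L / K * dist u v" .
    moreover have "dist (P u t) (P v t) = exp (- K * s) * norm (I u s - I v s)"
      unfolding P_def s_def[symmetric] dist_norm
      by (simp flip: scaleR_diff_right)
    ultimately show "dist (apply_bcontfun (Bcontfun (P u)) t) (apply_bcontfun (Bcontfun (P v)) t)
        \<le> L / K * dist u v"
      by (simp add: P)
  qed
  then have "\<exists>!u. Bcontfun (P u) = u"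
    using K L0 by (intro banach_fix_type[of "L / K"]) auto
  then obtain u where "Bcontfun (P u) = u" by blast
  then have u: "apply_bcontfun u t = P u t" for t
    using P[of u] by simp
  define \<phi> where "\<phi> t = exp (K * t) *\<^sub>R apply_bcontfun u t" for t
  have \<phi>: "\<phi> t = x0 + integral {0..t} (\<lambda>s. f (\<phi> s))" if "t \<ge> 0" for t
    using that by (simp add: \<phi>_def u[of t] P_def I_def exp_minus)
  have "(\<phi> has_vector_derivative f (\<phi> t)) (at t within {0..})" if "t \<ge> 0" for t
  proof -
    have "((\<lambda>r. integral {0..r} (\<lambda>s. f (\<phi> s))) has_vector_derivative f (\<phi> t)) (at t within {0..t+1})"
      using that ci[of _ u] by (intro integral_has_vector_derivative) (auto simp: \<phi>_def)
    then have "((\<lambda>r. x0 + integral {0..r} (\<lambda>s. f (\<phi> s))) has_vector_derivative f (\<phi> t))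
        (at t within {0..t+1})"
      by (auto intro!: derivative_eq_intros)
    then have "(\<phi> has_vector_derivative f (\<phi> t)) (at t within {0..t+1})"
      by (rule has_vector_derivative_transform[rotated 2]) (use that \<phi> in auto)
    moreover have "at t within {0..t+1} = at t within {0..}"
      using that by (intro at_within_nhd[of t "{..<t+1}"]) auto
    ultimately show ?thesis by simp
  qed
  moreover have "\<phi> 0 = x0" using \<phi>[of 0] by simp
  ultimately show ?thesis
    unfolding forward_solution_def by blast
qed

text \<open>Continuity method: at the first time at which \<open>h\<close> reaches \<open>c\<close>
  the premise of \<open>step\<close> holds, and its conclusion is a contradiction. In this way
  estimates that are valid only inside a region show that the region is not left.\<close>

lemma bootstrap:
  fixes h :: "real \<Rightarrow> real"
  assumes cont: "continuous_on {0..T} h" and "h 0 < c"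
    and step: "\<And>t. 0 \<le> t \<Longrightarrow> t \<le> T \<Longrightarrow> \<forall>s\<in>{0..t}. h s \<le> c \<Longrightarrow> h t < c"
    and t: "0 \<le> t" "t \<le> T"
  shows "h t < c"
proof (rule ccontr)
  assume "\<not> h t < c"
  define S where "S = {s\<in>{0..T}. c \<le> h s}"
  have "closed S"
    unfolding S_def using cont by (intro continuous_on_closed_Collect_le) auto
  moreover have "t \<in> S" using \<open>\<not> h t < c\<close> t by (simp add: S_def)
  moreover have bdd: "bdd_below S" by (auto simp: S_def)
  ultimately have I: "Inf S \<in> S"
    using closed_contains_Inf by blast
  define r where "r = Inf S"
  have r: "0 \<le> r" "r \<le> T" "c \<le> h r" using I by (auto simp: r_def S_def)
  then have "0 < r" using \<open>h 0 < c\<close> by (cases "r = 0") auto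
  have less: "h s < c" if "0 \<le> s" "s < r" for s
  proof (rule ccontr)
    assume "\<not> h s < c"
    then have "s \<in> S" using that r by (auto simp: S_def)
    then have "r \<le> s" unfolding r_def using bdd by (rule cInf_lower)
    then show False using that by simp
  qed
  \<comment> \<open>\<open>step\<close> wants the bound on the closed interval; at \<open>r\<close>
    itself it follows from the left by continuity.\<close>
  have "h r \<le> c"
  proof -
    have "closed {s\<in>{0..T}. h s \<le> c}"
      using cont by (intro continuous_on_closed_Collect_le) auto
    moreover have "{0..<r} \<subseteq> {s\<in>{0..T}. h s \<le> c}"
      using less r by fastforce
    ultimately have "closure {0..<r} \<subseteq> {s\<in>{0..T}. h s \<le> c}"
      by (rule closure_minimal[rotated])
    moreover have "r \<in> closure {0..<r}" using \<open>0 < r\<close> by simp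
    ultimately show ?thesis by blast
  qed
  then have "\<forall>s\<in>{0..r}. h s \<le> c"
    using less by (metis atLeastAtMost_iff le_less)
  then show False using step[of r] r by auto
qed

lemma nonincreasing_of_deriv_nonpos:
  fixes h h' :: "real \<Rightarrow> real"
  assumes "a \<le> b"
    and D: "\<And>t. t \<in> {a..b} \<Longrightarrow> (h has_real_derivative h' t) (at t within {a..b})"
    and "\<And>t. t \<in> {a..b} \<Longrightarrow> h' t \<le> 0"
  shows "h b \<le> h a"
proof (rule DERIV_nonpos_imp_decreasing_open[OF \<open>a \<le> b\<close>])
  show "continuous_on {a..b} h"
    using D DERIV_continuous_on by blast
  fix t assume "a < t" "t < b"
  then have "(h has_real_derivative h' t) (at t)"
    using D[of t] at_within_Icc_at[of a t b] by auto
  then show "\<exists>y. DERIV h t :> y \<and> y \<le> 0"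
    using assms(3)[of t] \<open>a < t\<close> \<open>t < b\<close> by auto
qed

text \<open>The norm is replaced by the differentiable \<open>sqrt (\<parallel>u\<parallel>\<^sup>2 + \<theta>\<^sup>2)\<close>, and \<open>\<theta>\<close> tends to 0 at the end.\<close>

lemma gronwall:
  fixes u u' :: "real \<Rightarrow> 'a::euclidean_space" and \<Gamma> \<Gamma>' :: "real \<Rightarrow> real"
  assumes "a \<le> b" and "0 \<le> L"
    and u: "\<And>t. t \<in> {a..b} \<Longrightarrow> (u has_vector_derivative u' t) (at t within {a..b})"
    and G: "\<And>t. t \<in> {a..b} \<Longrightarrow> (\<Gamma> has_real_derivative \<Gamma>' t) (at t within {a..b})"
    and bound: "\<And>t. t \<in> {a..b} \<Longrightarrow> norm (u' t) \<le> L * norm (u t) + \<Gamma>' t"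
    and nonneg: "\<And>t. t \<in> {a..b} \<Longrightarrow> 0 \<le> \<Gamma>' t"
  shows "norm (u b) \<le> (norm (u a) + (\<Gamma> b - \<Gamma> a)) * exp (L * (b - a))"
proof -
  have main: "norm (u b) \<le> (sqrt (u a \<bullet> u a + \<theta>\<^sup>2) + (\<Gamma> b - \<Gamma> a)) * exp (L * (b - a))"
    if \<theta>: "\<theta> > 0" for \<theta>
  proof -
    have halves: "inverse c / 2 * (2 * y) = y / c" for c y :: real
      by (cases "c = 0") (auto simp: field_simps)
    define s where "s t = sqrt (u t \<bullet> u t + \<theta>\<^sup>2)" for t
    have pos: "0 < u t \<bullet> u t + \<theta>\<^sup>2" for t
      using \<theta> by (simp add: add_nonneg_pos)
    then have spos: "0 < s t" for t by (simp add: s_def)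
    have us: "norm (u t) \<le> s t" for t
      unfolding s_def norm_eq_sqrt_inner by simp
    \<comment> \<open>Integrating factor: the claim for \<open>\<theta>\<close> is
      \<open>z b \<le> z a\<close>. As the factor is at most 1 and \<open>\<Gamma>'\<close> is
      nonnegative, \<open>\<Gamma>\<close> can stand outside it.\<close>
    define z where "z t = exp (- L * (t - a)) * s t - \<Gamma> t" for t
    define z' where "z' t = exp (- L * (t - a)) * ((u t \<bullet> u' t) / s t - L * s t) - \<Gamma>' t" for t
    have "z b \<le> z a"
    proof (rule nonincreasing_of_deriv_nonpos[OF \<open>a \<le> b\<close>])
      fix t assume t: "t \<in> {a..b}"
      have D: "((\<lambda>t. u t \<bullet> u t + \<theta>\<^sup>2) has_real_derivative 2 * (u t \<bullet> u' t)) (at t within {a..b})"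
        using u[OF t] unfolding has_vector_derivative_def has_field_derivative_def
        by (auto intro!: derivative_eq_intros simp: inner_commute mult_commute_abs fun_eq_iff)
      have "(s has_real_derivative inverse (sqrt (u t \<bullet> u t + \<theta>\<^sup>2)) / 2 * (2 * (u t \<bullet> u' t)))
          (at t within {a..b})"
        unfolding s_def[abs_def] using DERIV_real_sqrt[OF pos[of t]] D
        by (rule DERIV_chain2[where f=sqrt and g="\<lambda>t. u t \<bullet> u t + \<theta>\<^sup>2"])
      moreover have "inverse (sqrt (u t \<bullet> u t + \<theta>\<^sup>2)) / 2 * (2 * (u t \<bullet> u' t)) = (u t \<bullet> u' t) / s t"
        unfolding s_def by (rule halves)
      ultimately have Ds: "(s has_real_derivative (u t \<bullet> u' t) / s t) (at t within {a..b})"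
        by (rule DERIV_cong)
      have De: "((\<lambda>t. exp (- L * (t - a))) has_real_derivative exp (- L * (t - a)) * (- L))
          (at t within {a..b})"
        by (auto intro!: derivative_eq_intros)
      show "(z has_real_derivative z' t) (at t within {a..b})"
        unfolding z_def[abs_def] z'_def
        by (rule DERIV_diff[OF DERIV_mult[OF De Ds] G[OF t], THEN DERIV_cong])
           (simp add: right_diff_distrib)
      have "u t \<bullet> u' t \<le> norm (u t) * norm (u' t)"
        by (rule norm_cauchy_schwarz)
      also have "\<dots> \<le> s t * (L * s t + \<Gamma>' t)"
      proof (rule mult_mono)
        have "L * norm (u t) \<le> L * s t"
          using us \<open>0 \<le> L\<close> by (rule mult_left_mono)
        then show "norm (u' t) \<le> L * s t + \<Gamma>' t"
          using bound[OF t] by linarith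
      qed (use us[of t] spos[of t] in auto)
      finally have "(u t \<bullet> u' t) / s t - L * s t \<le> \<Gamma>' t"
        using spos[of t] by (simp add: field_simps)
      then have "exp (- L * (t - a)) * ((u t \<bullet> u' t) / s t - L * s t) \<le> exp (- L * (t - a)) * \<Gamma>' t"
        by simp
      also have "\<dots> \<le> \<Gamma>' t"
        using t nonneg[OF t] \<open>0 \<le> L\<close> by (simp add: mult_left_le_one_le)
      finally show "z' t \<le> 0"
        by (simp add: z'_def)
    qed
    then have "exp (- (L * (b - a))) * s b \<le> s a + (\<Gamma> b - \<Gamma> a)"
      by (simp add: z_def)
    then have "exp (- (L * (b - a))) * s b * exp (L * (b - a)) \<le> (s a + (\<Gamma> b - \<Gamma> a)) * exp (L * (b - a))"
      by (rule mult_right_mono) simp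
    moreover have "exp (- (L * (b - a))) * s b * exp (L * (b - a)) = s b"
      by (simp add: exp_minus)
    ultimately have "s b \<le> (s a + (\<Gamma> b - \<Gamma> a)) * exp (L * (b - a))"
      by simp
    then show ?thesis
      using us[of b] by (simp add: s_def)
  qed
  have "((\<lambda>\<theta>. (sqrt (u a \<bullet> u a + \<theta>\<^sup>2) + (\<Gamma> b - \<Gamma> a)) * exp (L * (b - a)))
      \<longlongrightarrow> (sqrt (u a \<bullet> u a + 0\<^sup>2) + (\<Gamma> b - \<Gamma> a)) * exp (L * (b - a))) (at_right 0)"
    by (intro tendsto_intros)
  then have "norm (u b) \<le> (sqrt (u a \<bullet> u a + 0\<^sup>2) + (\<Gamma> b - \<Gamma> a)) * exp (L * (b - a))"
    by (rule tendsto_lowerbound)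
       (use main in \<open>auto simp: eventually_at_filter intro!: always_eventually\<close>)
  then show ?thesis
    by (simp add: norm_eq_sqrt_inner)
qed

section \<open>Robustness of global asymptotic stability\<close>

lemma forward_solution_shift:
  assumes "forward_solution F x \<phi>" "0 \<le> c"
  shows "forward_solution F (\<phi> c) (\<lambda>t. \<phi> (c + t))"
  unfolding forward_solution_def
proof (intro conjI allI impI)
  fix t :: real assume "0 \<le> t"
  have "(\<phi> has_vector_derivative F (\<phi> (c + t))) (at (c + t) within {0..})"
    using assms \<open>0 \<le> t\<close> by (auto simp: forward_solution_def)
  then have "(\<phi> has_vector_derivative F (\<phi> (c + t))) (at (c + t) within (\<lambda>t. c + t) ` {0..})"
    by (rule has_vector_derivative_within_subset) (use assms(2) in auto)
  then have "((\<phi> \<circ> (\<lambda>t. c + t)) has_vector_derivative 1 *\<^sub>R F (\<phi> (c + t))) (at t within {0..})"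
    by (intro vector_diff_chain_within) (auto intro!: derivative_eq_intros)
  then show "((\<lambda>t. \<phi> (c + t)) has_vector_derivative F (\<phi> (c + t))) (at t within {0..})"
    by (simp add: o_def)
qed simp

lemma forward_solution_deriv:
  assumes "forward_solution F x \<phi>" "0 \<le> t" "S \<subseteq> {0..}"
  shows "(\<phi> has_vector_derivative F (\<phi> t)) (at t within S)"
  using assms has_vector_derivative_within_subset unfolding forward_solution_def by blast

lemma forward_solution_delayed_deriv:
  assumes \<phi>: "forward_solution F x \<phi>" and u: "u \<in> {s..t}"
  shows "((\<lambda>t. \<phi> (t - s)) has_vector_derivative F (\<phi> (u - s))) (at u within {s..t})"
proof -
  have "(\<phi> has_vector_derivative F (\<phi> (u - s))) (at (u - s) within (\<lambda>t. t - s) ` {s..t})"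
    using u by (intro forward_solution_deriv[OF \<phi>]) auto
  then have "((\<phi> \<circ> (\<lambda>t. t - s)) has_vector_derivative 1 *\<^sub>R F (\<phi> (u - s))) (at u within {s..t})"
    by (intro vector_diff_chain_within) (auto intro!: derivative_eq_intros)
  then show ?thesis by (simp add: o_def)
qed

lemma forward_solution_continuous:
  assumes "forward_solution F x \<phi>" "S \<subseteq> {0..}"
  shows "continuous_on S \<phi>"
  using forward_solution_deriv[OF assms(1) _ assms(2)] assms(2)
  by (intro continuous_on_vector_derivative) auto

lemma forward_solution_bound:
  assumes "forward_solution F x \<phi>"
  shows "\<exists>B. \<forall>t\<in>{0..T}. norm (\<phi> t) \<le> B"
proof -
  have "compact (\<phi> ` {0..T})"
    using forward_solution_continuous[OF assms] by (intro compact_continuous_image) auto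
  then have "bounded (\<phi> ` {0..T})"
    by (rule compact_imp_bounded)
  then show ?thesis
    by (auto simp: bounded_iff)
qed

text \<open>Gronwall's inequality for the difference. The perturbation enters through its integral
  rather than its supremum, which tolerates short peaks.\<close>

lemma perturbed_solution_close:
  fixes \<phi> \<psi> :: "real \<Rightarrow> 'a::euclidean_space"
  assumes L: "L-lipschitz_on S f" and "a \<le> b"
    and \<phi>: "\<And>t. t \<in> {a..b} \<Longrightarrow> (\<phi> has_vector_derivative f (\<phi> t)) (at t within {a..b})"
    and \<psi>: "\<And>t. t \<in> {a..b} \<Longrightarrow> (\<psi> has_vector_derivative \<psi>' t) (at t within {a..b})"
    and \<Gamma>: "\<And>t. t \<in> {a..b} \<Longrightarrow> (\<Gamma> has_real_derivative \<Gamma>' t) (at t within {a..b})"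
    and bound: "\<And>t. t \<in> {a..b} \<Longrightarrow> norm (\<psi>' t - f (\<psi> t)) \<le> \<Gamma>' t"
    and S: "\<And>t. t \<in> {a..b} \<Longrightarrow> \<phi> t \<in> S" "\<And>t. t \<in> {a..b} \<Longrightarrow> \<psi> t \<in> S"
  shows "norm (\<psi> b - \<phi> b) \<le> (norm (\<psi> a - \<phi> a) + (\<Gamma> b - \<Gamma> a)) * exp (L * (b - a))"
proof (rule gronwall[OF \<open>a \<le> b\<close> lipschitz_on_nonneg[OF L]])
  fix t assume t: "t \<in> {a..b}"
  show "((\<lambda>t. \<psi> t - \<phi> t) has_vector_derivative \<psi>' t - f (\<phi> t)) (at t within {a..b})"
    using \<phi>[OF t] \<psi>[OF t] by (rule has_vector_derivative_diff[rotated])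
  show "(\<Gamma> has_real_derivative \<Gamma>' t) (at t within {a..b})"
    using t by (rule \<Gamma>)
  show "0 \<le> \<Gamma>' t"
    using bound[OF t] norm_ge_zero order_trans by blast
  have "norm (\<psi>' t - f (\<phi> t)) \<le> norm (f (\<psi> t) - f (\<phi> t)) + norm (\<psi>' t - f (\<psi> t))"
    by (rule order_trans[OF _ norm_triangle_ineq]) simp
  also have "\<dots> \<le> L * norm (\<psi> t - \<phi> t) + \<Gamma>' t"
    using lipschitz_on_normD[OF L S(2)[OF t] S(1)[OF t]] bound[OF t] by linarith
  finally show "norm (\<psi>' t - f (\<phi> t)) \<le> L * norm (\<psi> t - \<phi> t) + \<Gamma>' t" .
qed

text \<open>A Lipschitz constant is at hand only on a ball slightly larger than one containing the
  compact arc of \<open>\<phi>\<close>; \<open>bootstrap\<close> keeps \<open>\<psi>\<close> in it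
  up to time \<open>T\<close>.\<close>

lemma solution_depends_continuously:
  fixes f :: "'a::euclidean_space \<Rightarrow> 'a"
  assumes f: "lipschitz_on_bounded f" and \<phi>: "forward_solution f x \<phi>" and "0 \<le> T" "0 < \<epsilon>"
  shows "\<exists>d>0. \<forall>y \<psi>. dist y x < d \<longrightarrow> forward_solution f y \<psi> \<longrightarrow>
           (\<forall>t\<in>{0..T}. norm (\<psi> t - \<phi> t) < \<epsilon>)"
proof -
  obtain B where B: "\<And>t. t \<in> {0..T} \<Longrightarrow> norm (\<phi> t) \<le> B"
    using forward_solution_bound[OF \<phi>] by blast
  obtain L where L: "L-lipschitz_on (cball 0 (B + \<epsilon>)) f"
    using f unfolding lipschitz_on_bounded_def by blast
  \<comment> \<open>Gronwall's factor over \<open>{0..T}\<close> amplifies this to exactly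
    \<open>\<epsilon>\<close>.\<close>
  define d where "d = \<epsilon> * exp (- L * T)"
  have "norm (\<psi> t - \<phi> t) < \<epsilon>"
    if y: "dist y x < d" and \<psi>: "forward_solution f y \<psi>" and t: "t \<in> {0..T}" for y \<psi> t
  proof (rule bootstrap[where T=T and h="\<lambda>t. norm (\<psi> t - \<phi> t)"])
    show "continuous_on {0..T} (\<lambda>t. norm (\<psi> t - \<phi> t))"
      using forward_solution_continuous[OF \<phi>] forward_solution_continuous[OF \<psi>]
      by (intro continuous_intros) auto
    have yx: "norm (\<psi> 0 - \<phi> 0) < d"
      using y \<phi> \<psi> by (simp add: forward_solution_def dist_norm)
    have "exp (- L * T) \<le> 1"
      using lipschitz_on_nonneg[OF L] \<open>0 \<le> T\<close> by simp
    then have "d \<le> \<epsilon>"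
      unfolding d_def using \<open>0 < \<epsilon>\<close> by (rule_tac mult_left_le) auto
    then show "norm (\<psi> 0 - \<phi> 0) < \<epsilon>"
      using yx by linarith
    fix t assume t: "0 \<le> t" "t \<le> T" and close: "\<forall>s\<in>{0..t}. norm (\<psi> s - \<phi> s) \<le> \<epsilon>"
    have in1: "\<phi> s \<in> cball 0 (B + \<epsilon>)" if "s \<in> {0..t}" for s
      using B[of s] that t \<open>0 < \<epsilon>\<close> by auto
    have in2: "\<psi> s \<in> cball 0 (B + \<epsilon>)" if "s \<in> {0..t}" for s
      using B[of s] close that t norm_triangle_sub[of "\<psi> s" "\<phi> s"] by fastforce
    have "norm (\<psi> t - \<phi> t) \<le> (norm (\<psi> 0 - \<phi> 0) + (0 - 0)) * exp (L * (t - 0))"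
      by (rule perturbed_solution_close[OF L, where \<Gamma>="\<lambda>_. 0" and \<Gamma>'="\<lambda>_. 0"])
         (use t forward_solution_deriv[OF \<phi>] forward_solution_deriv[OF \<psi>] in1 in2 in auto)
    also have "\<dots> \<le> norm (\<psi> 0 - \<phi> 0) * exp (L * T)"
      using t lipschitz_on_nonneg[OF L] by (auto intro!: mult_left_mono)
    also have "\<dots> < d * exp (L * T)"
      using yx by simp
    also have "\<dots> = \<epsilon>"
      by (simp add: d_def exp_minus)
    finally show "norm (\<psi> t - \<phi> t) < \<epsilon>" .
  qed (use t in auto)
  moreover have "d > 0" using \<open>0 < \<epsilon>\<close> by (simp add: d_def)
  ultimately show ?thesis by blast
qed

text \<open>Attraction is assumed pointwise. Near each initial point, solutions follow a given one
  until it is well inside the ball of radius \<open>\<delta>\<close>, from where stability takes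
  over; compactness makes time and bound uniform.\<close>

lemma globally_asymptotically_stable_uniform:
  fixes f :: "'a::euclidean_space \<Rightarrow> 'a"
  assumes f: "lipschitz_on_bounded f" and gas: "globally_asymptotically_stable_at f 0" and "0 < r"
  shows "\<exists>T>0. \<exists>B. \<forall>x \<phi>. norm x \<le> R \<longrightarrow> forward_solution f x \<phi> \<longrightarrow>
           (\<forall>t\<ge>0. norm (\<phi> t) \<le> B) \<and> (\<forall>t\<ge>T. norm (\<phi> t) < r)"
proof -
  obtain \<delta> where \<delta>: "\<delta> > 0"
    "\<And>x \<phi> t. norm x < \<delta> \<Longrightarrow> forward_solution f x \<phi> \<Longrightarrow> t \<ge> 0 \<Longrightarrow> norm (\<phi> t) < r"
    using gas \<open>0 < r\<close> unfolding globally_asymptotically_stable_at_def stable_at_def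
    by (metis dist_0_norm dist_commute)
  have "\<exists>d>0. \<exists>T>0. \<exists>B. \<forall>y \<psi>. dist y x < d \<longrightarrow> forward_solution f y \<psi> \<longrightarrow>
           (\<forall>t\<ge>0. norm (\<psi> t) \<le> B) \<and> (\<forall>t\<ge>T. norm (\<psi> t) < r)" for x
  proof -
    have "x \<in> domain_of_attraction f 0"
      using gas by (simp add: globally_asymptotically_stable_at_def)
    then obtain \<phi> where \<phi>: "forward_solution f x \<phi>" and lim: "(\<phi> \<longlongrightarrow> 0) at_top"
      unfolding domain_of_attraction_def by blast
    from tendstoD[OF lim, of "\<delta> / 2"] \<delta>(1) obtain T0 where T0: "\<And>t. t \<ge> T0 \<Longrightarrow> norm (\<phi> t) < \<delta> / 2"
      unfolding eventually_at_top_linorder by auto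
    define T where "T = max T0 1"
    have T: "T > 0" "norm (\<phi> T) < \<delta> / 2" using T0 by (auto simp: T_def)
    obtain B where B: "\<And>t. t \<in> {0..T} \<Longrightarrow> norm (\<phi> t) \<le> B"
      using forward_solution_bound[OF \<phi>] by blast
    obtain d where d: "d > 0" "\<And>y \<psi> t. dist y x < d \<Longrightarrow> forward_solution f y \<psi> \<Longrightarrow>
        t \<in> {0..T} \<Longrightarrow> norm (\<psi> t - \<phi> t) < \<delta> / 2"
      using solution_depends_continuously[OF f \<phi>, of T "\<delta> / 2"] T \<delta>(1) by auto
    have "norm (\<psi> t) < r" if "dist y x < d" "forward_solution f y \<psi>" "t \<ge> T" for y \<psi> t
    proof -
      have "norm (\<psi> T) < \<delta>"
        using d(2)[OF that(1,2), of T] T norm_triangle_sub[of "\<psi> T" "\<phi> T"] by simp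
      then show ?thesis
        using \<delta>(2)[OF _ forward_solution_shift[OF that(2)], of T "t - T"] T that(3) by simp
    qed
    moreover have "norm (\<psi> t) \<le> max r (B + \<delta>)"
      if "dist y x < d" "forward_solution f y \<psi>" "t \<ge> 0" for y \<psi> t
    proof (cases "t \<ge> T")
      case True
      then show ?thesis using calculation[OF that(1,2)] by (simp add: le_max_iff_disj less_imp_le)
    next
      case False
      then show ?thesis
        using d(2)[OF that(1,2), of t] B[of t] that(3) norm_triangle_sub[of "\<psi> t" "\<phi> t"] \<delta>(1)
        by (auto simp: le_max_iff_disj)
    qed
    ultimately show ?thesis
      using d(1) T(1) by blast
  qed
  then obtain d T B where d: "\<And>x. d x > 0" and T: "\<And>x. T x > (0::real)"
    and B: "\<And>x y \<psi> t. dist y x < d x \<Longrightarrow> forward_solution f y \<psi> \<Longrightarrow> t \<ge> 0 \<Longrightarrow> norm (\<psi> t) \<le> B x"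
    and Tr: "\<And>x y \<psi> t. dist y x < d x \<Longrightarrow> forward_solution f y \<psi> \<Longrightarrow> t \<ge> T x \<Longrightarrow> norm (\<psi> t) < r"
    by metis
  have "cball 0 R \<subseteq> (\<Union>x\<in>UNIV. ball x (d x))"
  proof
    fix x :: 'a assume "x \<in> cball 0 R"
    have "x \<in> ball x (d x)" using d by simp
    then show "x \<in> (\<Union>x\<in>UNIV. ball x (d x))" by blast
  qed
  then obtain X where X: "finite X" "cball 0 R \<subseteq> (\<Union>x\<in>X. ball x (d x))"
    using compactE_image[OF compact_cball, of UNIV "\<lambda>x. ball x (d x)"] by (metis open_ball)
  define T1 where "T1 = Max (insert 1 (T ` X))"
  define B1 where "B1 = Max (insert 1 (B ` X))"
  have "(\<forall>t\<ge>0. norm (\<psi> t) \<le> B1) \<and> (\<forall>t\<ge>T1. norm (\<psi> t) < r)"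
    if y: "norm y \<le> R" and \<psi>: "forward_solution f y \<psi>" for y \<psi>
  proof -
    obtain x where x: "x \<in> X" "dist y x < d x"
      using X(2) y by (force simp: dist_commute)
    have "T x \<le> T1" "B x \<le> B1"
      unfolding T1_def B1_def using X(1) x(1) by (auto intro!: Max_ge)
    then show ?thesis
      using B[OF x(2) \<psi>] Tr[OF x(2) \<psi>] order_trans by blast
  qed
  moreover have "T1 > 0"
    unfolding T1_def using X(1) by (intro less_le_trans[OF zero_less_one Max_ge]) auto
  ultimately show ?thesis by blast
qed

text \<open>The perturbation is measured over windows of length \<open>T\<close>; \<open>\<Gamma>\<close> stands for the integral of a
  bound on its norm.\<close>

definition robustly_confined ::
    "('a::euclidean_space \<Rightarrow> 'a) \<Rightarrow> real \<Rightarrow> real \<Rightarrow> real \<Rightarrow> real \<Rightarrow> bool" where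
  "robustly_confined f R R2 T \<sigma> \<longleftrightarrow>
     (\<forall>\<tau> \<psi> \<psi>' \<Gamma> \<Gamma>'. 0 \<le> \<tau> \<longrightarrow> norm (\<psi> 0) \<le> R \<longrightarrow>
        (\<forall>t\<in>{0..\<tau>}. (\<psi> has_vector_derivative \<psi>' t) (at t within {0..\<tau>}) \<and>
           (\<Gamma> has_real_derivative \<Gamma>' t) (at t within {0..\<tau>}) \<and>
           norm (\<psi>' t - f (\<psi> t)) \<le> \<Gamma>' t \<and> norm (\<psi> t) \<le> R2) \<longrightarrow>
        (\<forall>s t. 0 \<le> s \<longrightarrow> s \<le> t \<longrightarrow> t \<le> \<tau> \<longrightarrow> t \<le> s + T \<longrightarrow> \<Gamma> t - \<Gamma> s \<le> \<sigma>) \<longrightarrow>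
        norm (\<psi> \<tau>) < R2)"

text \<open>After a window of length \<open>T\<close> the unperturbed solution has come close to the origin, and the
  perturbed one has not left it by much, so that it starts the next window within \<open>R\<close> again.\<close>

lemma robustly_confined_exists:
  fixes f :: "'a::euclidean_space \<Rightarrow> 'a"
  assumes f: "lipschitz_on_bounded f" and gas: "globally_asymptotically_stable_at f 0" and "0 < R"
    and R1: "\<And>x \<phi> t. norm x \<le> R \<Longrightarrow> forward_solution f x \<phi> \<Longrightarrow> t \<ge> 0 \<Longrightarrow> norm (\<phi> t) \<le> R1"
  shows "\<exists>T>0. \<exists>\<sigma>>0. robustly_confined f R (R1 + R / 2) T \<sigma>"
proof -
  obtain T where T: "T > 0"
    "\<And>x \<phi> t. norm x \<le> R \<Longrightarrow> forward_solution f x \<phi> \<Longrightarrow> t \<ge> T \<Longrightarrow> norm (\<phi> t) < R / 4"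
    using globally_asymptotically_stable_uniform[OF f gas, of "R / 4" R] \<open>0 < R\<close> by auto
  obtain L where L: "L-lipschitz_on (cball 0 (R1 + R / 2)) f"
    using f unfolding lipschitz_on_bounded_def by blast
  have L0: "L \<ge> 0" using L by (rule lipschitz_on_nonneg)
  \<comment> \<open>Over one window Gronwall's factor turns this into \<open>R / 4\<close>. Hence
    \<open>\<psi>\<close> stays within \<open>R1 + R / 4\<close>, and after a full window, when the
    unperturbed solution is below \<open>R / 4\<close>, it is within \<open>R / 2\<close>.\<close>
  define \<sigma> where "\<sigma> = R / 4 * exp (- L * T)"
  have "norm (\<psi> \<tau>) < R1 + R / 2"
    if "0 \<le> \<tau>" and init: "norm (\<psi> 0) \<le> R"
      and all: "\<And>t. t \<in> {0..\<tau>} \<Longrightarrow> (\<psi> has_vector_derivative \<psi>' t) (at t within {0..\<tau>}) \<and>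
           (\<Gamma> has_real_derivative \<Gamma>' t) (at t within {0..\<tau>}) \<and>
           norm (\<psi>' t - f (\<psi> t)) \<le> \<Gamma>' t \<and> norm (\<psi> t) \<le> R1 + R / 2"
      and win: "\<And>s t. 0 \<le> s \<Longrightarrow> s \<le> t \<Longrightarrow> t \<le> \<tau> \<Longrightarrow> t \<le> s + T \<Longrightarrow> \<Gamma> t - \<Gamma> s \<le> \<sigma>"
    for \<tau> \<psi> \<psi>' \<Gamma> \<Gamma>'
  proof -
    have step: "norm (\<psi> t) \<le> R1 + R / 4 \<and> (t = s + T \<longrightarrow> norm (\<psi> t) \<le> R)"
      if st: "0 \<le> s" "s \<le> t" "t \<le> \<tau>" "t \<le> s + T" and s: "norm (\<psi> s) \<le> R" for s t
    proof -
      obtain \<phi> where \<phi>: "forward_solution f (\<psi> s) \<phi>"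
        using gas by (force simp: globally_asymptotically_stable_at_def domain_of_attraction_def)
      have der: "((\<lambda>t. \<phi> (t - s)) has_vector_derivative f (\<phi> (u - s))) (at u within {s..t})"
        if "u \<in> {s..t}" for u
        using that by (rule forward_solution_delayed_deriv[OF \<phi>])
      have sub: "{s..t} \<subseteq> {0..\<tau>}" using st by auto
      have "norm (\<psi> t - \<phi> (t - s)) \<le> (norm (\<psi> s - \<phi> (s - s)) + (\<Gamma> t - \<Gamma> s)) * exp (L * (t - s))"
      proof (rule perturbed_solution_close[OF L \<open>s \<le> t\<close> der, of \<psi> \<psi>' \<Gamma> \<Gamma>'])
        fix u assume u: "u \<in> {s..t}"
        then have "u \<in> {0..\<tau>}" using sub by blast
        from all[OF this]
        show "(\<psi> has_vector_derivative \<psi>' u) (at u within {s..t})"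
          "(\<Gamma> has_real_derivative \<Gamma>' u) (at u within {s..t})"
          "norm (\<psi>' u - f (\<psi> u)) \<le> \<Gamma>' u" "\<psi> u \<in> cball 0 (R1 + R / 2)"
          by (auto intro: has_vector_derivative_within_subset[OF _ sub] DERIV_subset[OF _ sub])
        show "\<phi> (u - s) \<in> cball 0 (R1 + R / 2)"
          using R1[OF s \<phi>, of "u - s"] u \<open>0 < R\<close> by simp
      qed
      also have "\<dots> \<le> \<sigma> * exp (L * T)"
        using \<phi> win[OF st] L0 st \<open>0 < R\<close>
        by (intro mult_mono) (auto simp: forward_solution_def \<sigma>_def intro!: mult_left_mono)
      also have "\<dots> = R / 4"
        by (simp add: \<sigma>_def exp_minus)
      finally have "norm (\<psi> t) \<le> norm (\<phi> (t - s)) + R / 4"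
        using norm_triangle_sub[of "\<psi> t" "\<phi> (t - s)"] by linarith
      then show ?thesis
        using R1[OF s \<phi>, of "t - s"] T(2)[OF s \<phi>, of "t - s"] st \<open>0 < R\<close> by auto
    qed
    have windows: "norm (\<psi> (real k * T)) \<le> R" if "real k * T \<le> \<tau>" for k
      using that
    proof (induction k)
      case (Suc k)
      have "real k * T \<le> real (Suc k) * T" using T(1) by simp
      then show ?case
        using step[of "real k * T" "real (Suc k) * T"] Suc T(1) by (simp add: algebra_simps)
    qed (simp add: init)
    \<comment> \<open>The number of complete windows; the incomplete one is covered by the first
      half of \<open>step\<close>.\<close>
    define k where "k = nat \<lfloor>\<tau> / T\<rfloor>"
    have k: "real k * T \<le> \<tau>" "\<tau> \<le> real k * T + T"
    proof -
      have "real k = of_int \<lfloor>\<tau> / T\<rfloor>" using \<open>0 \<le> \<tau>\<close> T(1) by (simp add: k_def)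
      then have "real k \<le> \<tau> / T" "\<tau> / T \<le> real k + 1" by linarith+
      then show "real k * T \<le> \<tau>" "\<tau> \<le> real k * T + T"
        using T(1) by (simp_all add: field_simps)
    qed
    then show ?thesis
      using step[of "real k * T" \<tau>] windows[of k] T(1) \<open>0 < R\<close> by auto
  qed
  then have "robustly_confined f R (R1 + R / 2) T \<sigma>"
    unfolding robustly_confined_def by blast
  moreover have "\<sigma> > 0" using \<open>0 < R\<close> by (simp add: \<sigma>_def)
  ultimately show ?thesis using T(1) by blast
qed

text \<open>The comparison is restarted at time \<open>t - T\<close>, with \<open>T\<close> a
  uniform settling time for \<open>r / 2\<close>; for large \<open>t\<close> the deviation
  accumulated since then is at most \<open>r / 2\<close>.\<close>

lemma vanishing_perturbation_convergence:
  fixes f :: "'a::euclidean_space \<Rightarrow> 'a"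
  assumes f: "lipschitz_on_bounded f" and gas: "globally_asymptotically_stable_at f 0"
    and \<psi>: "\<And>t. t \<ge> 0 \<Longrightarrow> (\<psi> has_vector_derivative \<psi>' t) (at t within {0..})"
    and bdd: "\<And>t. t \<ge> 0 \<Longrightarrow> norm (\<psi> t) \<le> R"
    and lim: "((\<lambda>t. \<psi>' t - f (\<psi> t)) \<longlongrightarrow> 0) at_top"
  shows "(\<psi> \<longlongrightarrow> 0) at_top"
proof (rule tendstoI)
  fix r :: real assume "0 < r"
  obtain T B where T: "T > 0"
    "\<And>x \<phi> t. norm x \<le> R \<Longrightarrow> forward_solution f x \<phi> \<Longrightarrow> t \<ge> T \<Longrightarrow> norm (\<phi> t) < r / 2"
    and B: "\<And>x \<phi> t. norm x \<le> R \<Longrightarrow> forward_solution f x \<phi> \<Longrightarrow> t \<ge> 0 \<Longrightarrow> norm (\<phi> t) \<le> B"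
    using globally_asymptotically_stable_uniform[OF f gas, of "r / 2" R] \<open>0 < r\<close>
    by (metis half_gt_zero)
  obtain L where L: "L-lipschitz_on (cball 0 (max R B)) f"
    using f unfolding lipschitz_on_bounded_def by blast
  define \<rho> where "\<rho> = r / (2 * T) * exp (- L * T)"
  have "\<rho> > 0" using \<open>0 < r\<close> T(1) by (simp add: \<rho>_def)
  from tendstoD[OF lim this] obtain t0 where t0: "\<And>t. t \<ge> t0 \<Longrightarrow> norm (\<psi>' t - f (\<psi> t)) \<le> \<rho>"
    unfolding eventually_at_top_linorder dist_0_norm by (auto dest: less_imp_le)
  have "norm (\<psi> t) < r" if t: "t \<ge> max t0 0 + T" for t
  proof -
    define s where "s = t - T"
    have s: "0 \<le> s" "s \<ge> t0" "s \<le> t" using t T(1) by (auto simp: s_def)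
    obtain \<phi> where \<phi>: "forward_solution f (\<psi> s) \<phi>"
      using gas by (force simp: globally_asymptotically_stable_at_def domain_of_attraction_def)
    have der: "((\<lambda>t. \<phi> (t - s)) has_vector_derivative f (\<phi> (u - s))) (at u within {s..t})"
      if "u \<in> {s..t}" for u
      using that by (rule forward_solution_delayed_deriv[OF \<phi>])
    have "norm (\<psi> t - \<phi> (t - s)) \<le> (norm (\<psi> s - \<phi> (s - s)) + (\<rho> * t - \<rho> * s)) * exp (L * (t - s))"
    proof (rule perturbed_solution_close[OF L \<open>s \<le> t\<close> der, of \<psi> \<psi>' "\<lambda>t. \<rho> * t" "\<lambda>_. \<rho>"])
      fix u assume u: "u \<in> {s..t}"
      show "(\<psi> has_vector_derivative \<psi>' u) (at u within {s..t})"
        using \<psi>[of u] u s by (auto intro: has_vector_derivative_within_subset)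
      show "norm (\<psi>' u - f (\<psi> u)) \<le> \<rho>" "\<psi> u \<in> cball 0 (max R B)"
        using t0[of u] bdd[of u] u s by auto
      show "\<phi> (u - s) \<in> cball 0 (max R B)"
        using B[OF bdd[OF s(1)] \<phi>, of "u - s"] u by auto
    qed (auto intro!: derivative_eq_intros)
    also have "\<dots> = \<rho> * T * exp (L * T)"
      using \<phi> by (simp add: forward_solution_def s_def algebra_simps)
    also have "\<dots> = r / 2"
      using T(1) by (simp add: \<rho>_def exp_minus)
    finally show ?thesis
      using T(2)[OF bdd[OF s(1)] \<phi>, of T] norm_triangle_sub[of "\<psi> t" "\<phi> (t - s)"]
      by (simp add: s_def)
  qed
  then show "eventually (\<lambda>t. dist (\<psi> t) 0 < r) at_top"
    unfolding eventually_at_top_linorder by auto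
qed

section \<open>Cascades\<close>

text \<open>Inside the region \<open>W\<close> stays at most \<open>N\<close>, and its decrease pays
  for the perturbation of the first component. That the derivative equals
  \<open>F (\<phi> t)\<close> is asked only while the region has not been left, so that solutions of
  a truncated field qualify too.\<close>

lemma cascade_a_priori:
  fixes F :: "'a::euclidean_space \<times> 'b::euclidean_space \<Rightarrow> 'a \<times> 'b" and W :: "'b \<Rightarrow> real"
  assumes W: "\<And>\<xi>. (W has_derivative W' \<xi>) (at \<xi>)" "\<And>\<xi>. 0 \<le> W \<xi>"
    and confined: "robustly_confined f R R2 T \<sigma>" and "R < R2" "0 < N"
    and decay: "\<And>\<eta> \<xi>. norm \<eta> \<le> R2 \<Longrightarrow> W \<xi> \<le> 2 * N \<Longrightarrow> W' \<xi> (snd (F (\<eta>, \<xi>))) \<le> - c * W \<xi>" and "0 \<le> c"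
    and perturbation: "\<And>\<eta> \<xi>. norm \<eta> \<le> R2 \<Longrightarrow> W \<xi> \<le> 2 * N \<Longrightarrow>
      norm (fst (F (\<eta>, \<xi>)) - f \<eta>) \<le> \<rho> - \<mu> * W' \<xi> (snd (F (\<eta>, \<xi>)))"
    and "0 \<le> \<rho>" "0 \<le> \<mu>" and small: "\<rho> * T + \<mu> * N \<le> \<sigma>"
    and cont: "continuous_on {0..} \<phi>"
    and init: "norm (fst (\<phi> 0)) \<le> R" "W (snd (\<phi> 0)) \<le> N"
    and \<phi>: "\<And>t. 0 \<le> t \<Longrightarrow> \<forall>s\<in>{0..t}. norm (fst (\<phi> s)) \<le> R2 \<and> W (snd (\<phi> s)) \<le> 2 * N \<Longrightarrow>
      (\<phi> has_vector_derivative F (\<phi> t)) (at t within {0..})"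
    and "0 \<le> t"
  shows "norm (fst (\<phi> t)) < R2 \<and> W (snd (\<phi> t)) \<le> W (snd (\<phi> 0)) * exp (- c * t)"
proof -
  define \<eta> where "\<eta> t = fst (\<phi> t)" for t
  define \<xi> where "\<xi> t = snd (\<phi> t)" for t
  have \<phi>_eq: "\<phi> t = (\<eta> t, \<xi> t)" for t by (simp add: \<eta>_def \<xi>_def)
  have step: "norm (\<eta> t) < R2 \<and> W (\<xi> t) \<le> W (\<xi> 0) * exp (- c * t)"
    if "0 \<le> t" and region: "\<And>s. s \<in> {0..t} \<Longrightarrow> norm (\<eta> s) \<le> R2 \<and> W (\<xi> s) \<le> 2 * N" for t
  proof -
    have \<phi>': "(\<phi> has_vector_derivative F (\<phi> s)) (at s within {0..t})" if "s \<in> {0..t}" for s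
      using \<phi>[of s] region that
      by (auto simp: \<phi>_eq intro: has_vector_derivative_within_subset[of _ _ _ "{0..}"])
    have \<eta>': "(\<eta> has_vector_derivative fst (F (\<phi> s))) (at s within {0..t})" if "s \<in> {0..t}" for s
      using bounded_linear.has_vector_derivative[OF bounded_linear_fst \<phi>'[OF that]]
      by (simp add: \<eta>_def[abs_def])
    have \<xi>': "(\<xi> has_vector_derivative snd (F (\<phi> s))) (at s within {0..t})" if "s \<in> {0..t}" for s
      using bounded_linear.has_vector_derivative[OF bounded_linear_snd \<phi>'[OF that]]
      by (simp add: \<xi>_def[abs_def])
    define w where "w s = W' (\<xi> s) (snd (F (\<phi> s)))" for s
    have W': "((\<lambda>s. W (\<xi> s)) has_real_derivative w s) (at s within {0..t})" if "s \<in> {0..t}" for s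
    proof -
      have "((W \<circ> \<xi>) has_vector_derivative w s) (at s within {0..t})"
        unfolding w_def using \<xi>'[OF that] W(1)
        by (intro vector_derivative_diff_chain_within) (auto intro: has_derivative_at_withinI)
      then show ?thesis
        by (simp add: o_def has_real_derivative_iff_has_vector_derivative)
    qed
    have w: "w s \<le> - c * W (\<xi> s)" if "s \<in> {0..t}" for s
      using decay[of "\<eta> s" "\<xi> s"] region[OF that] by (simp add: w_def \<phi>_eq)
    have mono: "W (\<xi> s) * exp (c * s) \<le> W (\<xi> 0)" if "s \<in> {0..t}" for s
    proof -
      have "W (\<xi> s) * exp (c * s) \<le> W (\<xi> 0) * exp (c * 0)"
      proof (rule nonincreasing_of_deriv_nonpos[where h="\<lambda>s. W (\<xi> s) * exp (c * s)"
            and h'="\<lambda>r. (w r + c * W (\<xi> r)) * exp (c * r)"])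
        fix r assume r: "r \<in> {0..s}"
        then have r': "r \<in> {0..t}" using that by auto
        have e: "((\<lambda>s. exp (c * s)) has_real_derivative exp (c * r) * c) (at r within {0..s})"
          by (auto intro!: derivative_eq_intros)
        have "((\<lambda>s. W (\<xi> s)) has_real_derivative w r) (at r within {0..s})"
          using W'[OF r'] that by (auto intro: DERIV_subset)
        from DERIV_mult[OF this e]
        show "((\<lambda>s. W (\<xi> s) * exp (c * s)) has_real_derivative (w r + c * W (\<xi> r)) * exp (c * r))
            (at r within {0..s})"
          by (rule DERIV_cong) (simp add: algebra_simps)
        show "(w r + c * W (\<xi> r)) * exp (c * r) \<le> 0"
          using w[OF r'] by (simp add: mult_nonpos_nonneg)
      qed (use that in auto)
      then show ?thesis by simp
    qed
    have WN: "W (\<xi> s) \<le> N" if "s \<in> {0..t}" for s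
    proof -
      have "1 \<le> exp (c * s)" using that \<open>0 \<le> c\<close> by simp
      then have "W (\<xi> s) * 1 \<le> W (\<xi> s) * exp (c * s)" using W(2) by (rule mult_left_mono)
      then show ?thesis using mono[OF that] init(2) by (simp add: \<xi>_def)
    qed
    \<comment> \<open>The derivative dominates the perturbation, and over a window the increase is
      at most \<open>\<rho> * T + \<mu> * N\<close> because \<open>W\<close> lies between 0 and
      \<open>N\<close>.\<close>
    define \<Gamma> where "\<Gamma> s = \<rho> * s - \<mu> * W (\<xi> s)" for s
    have "norm (\<eta> t) < R2"
    proof (rule confined[unfolded robustly_confined_def, rule_format, where
          \<psi>' = "\<lambda>s. fst (F (\<phi> s))" and \<Gamma> = \<Gamma> and \<Gamma>' = "\<lambda>s. \<rho> - \<mu> * w s"])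
      show "0 \<le> t" "norm (\<eta> 0) \<le> R" using that init by (simp_all add: \<eta>_def)
      fix s assume s: "s \<in> {0..t}"
      have "(\<Gamma> has_real_derivative \<rho> - \<mu> * w s) (at s within {0..t})"
        unfolding \<Gamma>_def[abs_def] using W'[OF s] by (auto intro!: derivative_eq_intros)
      moreover have "norm (fst (F (\<phi> s)) - f (\<eta> s)) \<le> \<rho> - \<mu> * w s"
        using perturbation[of "\<eta> s" "\<xi> s"] region[OF s] by (simp add: w_def \<phi>_eq)
      ultimately show "(\<eta> has_vector_derivative fst (F (\<phi> s))) (at s within {0..t}) \<and>
          (\<Gamma> has_real_derivative \<rho> - \<mu> * w s) (at s within {0..t}) \<and>
          norm (fst (F (\<phi> s)) - f (\<eta> s)) \<le> \<rho> - \<mu> * w s \<and> norm (\<eta> s) \<le> R2"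
        using \<eta>'[OF s] region[OF s] by blast
    next
      fix s r assume sr: "0 \<le> s" "s \<le> r" "r \<le> t" "r \<le> s + T"
      have "\<rho> * (r - s) \<le> \<rho> * T"
        using sr \<open>0 \<le> \<rho>\<close> by (intro mult_left_mono) auto
      moreover have "\<mu> * W (\<xi> s) \<le> \<mu> * N" "0 \<le> \<mu> * W (\<xi> r)"
        using WN[of s] W(2) sr \<open>0 \<le> \<mu>\<close> by (auto intro: mult_left_mono)
      ultimately show "\<Gamma> r - \<Gamma> s \<le> \<sigma>"
        using small by (simp add: \<Gamma>_def algebra_simps)
    qed
    moreover have "W (\<xi> t) \<le> W (\<xi> 0) * exp (- c * t)"
      using mono[of t] \<open>0 \<le> t\<close> by (simp add: exp_minus field_simps)
    ultimately show ?thesis by simp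
  qed
  have decreasing: "W (\<xi> 0) * exp (- c * t) \<le> N" if "0 \<le> t" for t
  proof -
    have "W (\<xi> 0) * exp (- c * t) \<le> W (\<xi> 0)"
      using that \<open>0 \<le> c\<close> W(2) by (intro mult_left_le) auto
    then show ?thesis using init(2) by (simp add: \<xi>_def)
  qed
  \<comment> \<open>Both constraints in one scalar function: \<open>h t \<le> 0\<close> describes
    the closed region and \<open>h t < 0\<close> the strict inequalities, as
    \<open>bootstrap\<close> needs.\<close>
  define h where "h t = max (norm (\<eta> t) - R2) (W (\<xi> t) - 2 * N)" for t
  have h_less: "h t < 0 \<longleftrightarrow> norm (\<eta> t) < R2 \<and> W (\<xi> t) < 2 * N"
    and h_le: "h t \<le> 0 \<longleftrightarrow> norm (\<eta> t) \<le> R2 \<and> W (\<xi> t) \<le> 2 * N" for t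
    unfolding h_def max_less_iff_conj max.bounded_iff by auto
  have h: "h t < 0" if "0 \<le> t" for t
  proof (rule bootstrap[where T=t and h=h])
    have cW: "continuous_on UNIV W"
      by (intro continuous_at_imp_continuous_on ballI has_derivative_continuous[OF W(1)])
    have c: "continuous_on {0..t} \<phi>"
      using cont by (rule continuous_on_subset) auto
    show "continuous_on {0..t} h"
      unfolding h_def[abs_def] \<eta>_def \<xi>_def
      by (intro continuous_intros c continuous_on_compose2[OF cW]) auto
    show "h 0 < 0"
      using init \<open>R < R2\<close> \<open>0 < N\<close> by (simp add: h_less \<eta>_def \<xi>_def)
    fix r assume r: "0 \<le> r" "r \<le> t" "\<forall>s\<in>{0..r}. h s \<le> 0"
    have "norm (\<eta> r) < R2 \<and> W (\<xi> r) \<le> W (\<xi> 0) * exp (- c * r)"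
      using r by (intro step) (simp_all add: h_le)
    then show "h r < 0"
      using decreasing[OF r(1)] \<open>0 < N\<close> unfolding h_less by linarith
  qed (use that in auto)
  have "norm (\<eta> s) \<le> R2 \<and> W (\<xi> s) \<le> 2 * N" if "s \<in> {0..t}" for s
    using h[of s] that by (simp add: h_less less_imp_le)
  then show ?thesis
    using step[OF \<open>0 \<le> t\<close>] by (simp add: \<eta>_def \<xi>_def)
qed

text \<open>Solutions come from a globally Lipschitz truncation that is invisible by the a priori
  bounds. Then \<open>W\<close> drives \<xi> to 0, the perturbation vanishes, and \<eta> follows.
  Stability is the a priori bound once more, with small radii and with 0 for \<mu>.\<close>

theorem cascade_stability:
  fixes F :: "'a::euclidean_space \<times> 'b::euclidean_space \<Rightarrow> 'a \<times> 'b" and W :: "'b \<Rightarrow> real"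
  assumes F: "lipschitz_on_bounded F" "F 0 = 0"
    and f: "lipschitz_on_bounded f" and gas: "globally_asymptotically_stable_at f 0"
    and W: "\<And>\<xi>. (W has_derivative W' \<xi>) (at \<xi>)" "W 0 = 0"
    and coercive: "0 < a" "\<And>\<xi>. a * (norm \<xi>)\<^sup>2 \<le> W \<xi>"
    and confined: "robustly_confined f R R2 T \<sigma>" and "0 < R" "R < R2" "0 < N"
    and decay: "\<And>\<eta> \<xi>. norm \<eta> \<le> R2 \<Longrightarrow> W \<xi> \<le> 2 * N \<Longrightarrow> W' \<xi> (snd (F (\<eta>, \<xi>))) \<le> - c * W \<xi>" and "0 < c"
    and perturbation: "\<And>\<eta> \<xi>. norm \<eta> \<le> R2 \<Longrightarrow> W \<xi> \<le> 2 * N \<Longrightarrow>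
      norm (fst (F (\<eta>, \<xi>)) - f \<eta>) \<le> \<rho> - \<mu> * W' \<xi> (snd (F (\<eta>, \<xi>)))"
    and "0 \<le> \<rho>" "0 \<le> \<mu>" and small: "\<rho> * T + \<mu> * N \<le> \<sigma>"
    and linear_perturbation: "\<And>\<eta> \<xi>. norm \<eta> \<le> R2 \<Longrightarrow> W \<xi> \<le> 2 * N \<Longrightarrow>
      norm (fst (F (\<eta>, \<xi>)) - f \<eta>) \<le> L * norm \<xi>" and "0 \<le> L"
  shows "locally_asymptotically_stable_at F 0"
    and "{(\<eta>, \<xi>). norm \<eta> \<le> R \<and> W \<xi> \<le> N} \<subseteq> domain_of_attraction F 0"
proof -
  have W0: "0 \<le> W \<xi>" for \<xi>
    by (rule order_trans[OF _ coercive(2)]) (use coercive(1) in simp)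
  have norm_le: "norm \<xi> \<le> sqrt (W \<xi> / a)" for \<xi>
  proof (rule real_le_rsqrt)
    show "(norm \<xi>)\<^sup>2 \<le> W \<xi> / a" using coercive(1) coercive(2)[of \<xi>] by (simp add: field_simps)
  qed
  have a_priori: "norm (fst (\<phi> t)) < R2 \<and> W (snd (\<phi> t)) \<le> W (snd (\<phi> 0)) * exp (- c * t)"
    if "continuous_on {0..} \<phi>" "norm (fst (\<phi> 0)) \<le> R" "W (snd (\<phi> 0)) \<le> N"
      "\<And>t. 0 \<le> t \<Longrightarrow> \<forall>s\<in>{0..t}. norm (fst (\<phi> s)) \<le> R2 \<and> W (snd (\<phi> s)) \<le> 2 * N \<Longrightarrow>
        (\<phi> has_vector_derivative F (\<phi> t)) (at t within {0..})" "0 \<le> t" for \<phi> t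
    by (rule cascade_a_priori[OF W(1) W0 confined \<open>R < R2\<close> \<open>0 < N\<close> decay less_imp_le[OF \<open>0 < c\<close>]
          perturbation \<open>0 \<le> \<rho>\<close> \<open>0 \<le> \<mu>\<close> small that(1-3) that(4) that(5)])
  have exists: "\<exists>\<phi>. forward_solution F x \<phi>" if x: "norm (fst x) \<le> R" "W (snd x) \<le> N" for x
  proof -
    define B where "B = R2 + sqrt (2 * N / a)"
    have "0 \<le> B" using \<open>0 < R\<close> \<open>R < R2\<close> \<open>0 < N\<close> coercive(1) by (simp add: B_def)
    have region: "y \<in> cball 0 B" if "norm (fst y) \<le> R2" "W (snd y) \<le> 2 * N" for y
    proof -
      have "sqrt (W (snd y) / a) \<le> sqrt (2 * N / a)"
        using that(2) coercive(1) by (simp add: divide_right_mono)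
      then have "norm (fst y) + norm (snd y) \<le> B"
        using that(1) norm_le[of "snd y"] unfolding B_def by linarith
      then show ?thesis
        using norm_Pair_le[where x="fst y" and y="snd y"] by simp
    qed
    obtain K where K: "K-lipschitz_on (cball 0 B) F"
      using F(1) unfolding lipschitz_on_bounded_def by blast
    obtain M where M: "\<And>y. y \<in> cball 0 B \<Longrightarrow> norm (F y) \<le> M"
      using lipschitz_on_bounded_bound[OF F(1)] by blast
    \<comment> \<open>Projection to the nearest point is nonexpansive: \<open>F\<close> is unchanged
      on the ball and becomes bounded and globally Lipschitz.\<close>
    define G where "G y = F (closest_point (cball 0 B) y)" for y
    have cp: "closest_point (cball 0 B) y \<in> cball 0 B" for y :: "'a \<times> 'b"
      using \<open>0 \<le> B\<close> by (intro closest_point_in_set) auto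
    have "K-lipschitz_on UNIV G"
    proof (rule lipschitz_onI)
      fix y z :: "'a \<times> 'b"
      have "dist (G y) (G z) \<le> K * dist (closest_point (cball 0 B) y) (closest_point (cball 0 B) z)"
        unfolding G_def by (rule lipschitz_onD[OF K cp cp])
      also have "\<dots> \<le> K * dist y z"
        using \<open>0 \<le> B\<close> lipschitz_on_nonneg[OF K]
        by (intro mult_left_mono closest_point_lipschitz) auto
      finally show "dist (G y) (G z) \<le> K * dist y z" .
    qed (rule lipschitz_on_nonneg[OF K])
    moreover have "norm (G y) \<le> M" for y
      unfolding G_def using cp M by blast
    ultimately obtain \<phi> where \<phi>: "forward_solution G x \<phi>"
      using forward_solution_exists_bounded by blast
    have GF: "G y = F y" if "norm (fst y) \<le> R2" "W (snd y) \<le> 2 * N" for y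
      unfolding G_def using region[OF that] by (simp add: closest_point_self)
    have \<phi>': "(\<phi> has_vector_derivative F (\<phi> t)) (at t within {0..})"
      if "0 \<le> t" "\<forall>s\<in>{0..t}. norm (fst (\<phi> s)) \<le> R2 \<and> W (snd (\<phi> s)) \<le> 2 * N" for t
      using forward_solution_deriv[OF \<phi> that(1)] GF[of "\<phi> t"] that by auto
    have \<phi>0: "\<phi> 0 = x" using \<phi> by (simp add: forward_solution_def)
    have "norm (fst (\<phi> t)) \<le> R2 \<and> W (snd (\<phi> t)) \<le> 2 * N" if "0 \<le> t" for t
    proof -
      have "norm (fst (\<phi> t)) < R2 \<and> W (snd (\<phi> t)) \<le> W (snd (\<phi> 0)) * exp (- c * t)"
        using forward_solution_continuous[OF \<phi>] x \<phi>' that by (intro a_priori) (auto simp: \<phi>0)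
      moreover have "W (snd (\<phi> 0)) * exp (- c * t) \<le> W (snd (\<phi> 0))"
        using \<open>0 < c\<close> that W0 by (intro mult_left_le) auto
      ultimately show ?thesis using x(2) \<open>0 < N\<close> by (auto simp: \<phi>0)
    qed
    then have "forward_solution F x \<phi>"
      using \<phi>' \<phi>0 by (auto simp: forward_solution_def)
    then show ?thesis by blast
  qed
  have bounds: "norm (fst (\<phi> t)) < R2 \<and> W (snd (\<phi> t)) \<le> W (snd x) * exp (- c * t)"
    if x: "norm (fst x) \<le> R" "W (snd x) \<le> N" and \<phi>: "forward_solution F x \<phi>" and "0 \<le> t" for x \<phi> t
  proof -
    have "\<phi> 0 = x" using \<phi> by (simp add: forward_solution_def)
    then show ?thesis
      using a_priori[of \<phi> t] forward_solution_continuous[OF \<phi>] forward_solution_deriv[OF \<phi>] x \<open>0 \<le> t\<close>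
      by auto
  qed
  have attracted: "x \<in> domain_of_attraction F 0" if x: "norm (fst x) \<le> R" "W (snd x) \<le> N" for x
  proof -
    have "(\<phi> \<longlongrightarrow> 0) at_top" if \<phi>: "forward_solution F x \<phi>" for \<phi>
    proof -
      have "((\<lambda>t. sqrt (W (snd x) * exp (- c * t) / a)) \<longlongrightarrow> sqrt (W (snd x) * 0 / a)) at_top"
        using \<open>0 < c\<close> coercive(1)
        by (intro tendsto_intros filterlim_compose[OF exp_at_bot]
            filterlim_tendsto_neg_mult_at_bot[OF tendsto_const] filterlim_ident) auto
      then have lim_sqrt: "((\<lambda>t. sqrt (W (snd x) * exp (- c * t) / a)) \<longlongrightarrow> 0) at_top"
        by simp
      have "norm (snd (\<phi> t)) \<le> sqrt (W (snd x) * exp (- c * t) / a)" if "0 \<le> t" for t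
      proof -
        have "sqrt (W (snd (\<phi> t)) / a) \<le> sqrt (W (snd x) * exp (- c * t) / a)"
          using bounds[OF x \<phi> that] coercive(1) by (simp add: divide_right_mono)
        then show ?thesis using norm_le[of "snd (\<phi> t)"] by linarith
      qed
      then have \<xi>: "((\<lambda>t. snd (\<phi> t)) \<longlongrightarrow> 0) at_top"
        by (intro Lim_null_comparison[OF _ lim_sqrt])
           (auto simp: eventually_at_top_linorder intro!: exI[of _ 0])
      have W2N: "W (snd (\<phi> t)) \<le> 2 * N" if "0 \<le> t" for t
      proof -
        have "W (snd x) * exp (- c * t) \<le> W (snd x)"
          using \<open>0 < c\<close> that W0 by (intro mult_left_le) auto
        then show ?thesis using bounds[OF x \<phi> that] x(2) \<open>0 < N\<close> by linarith
      qed
      have "((\<lambda>t. L * norm (snd (\<phi> t))) \<longlongrightarrow> L * norm (0::'b)) at_top"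
        by (intro tendsto_intros \<xi>)
      then have lim: "((\<lambda>t. L * norm (snd (\<phi> t))) \<longlongrightarrow> 0) at_top"
        by simp
      have "norm (fst (F (\<phi> t)) - f (fst (\<phi> t))) \<le> L * norm (snd (\<phi> t))" if "0 \<le> t" for t
        using linear_perturbation[of "fst (\<phi> t)" "snd (\<phi> t)"] bounds[OF x \<phi> that] W2N[OF that] by simp
      then have "((\<lambda>t. fst (F (\<phi> t)) - f (fst (\<phi> t))) \<longlongrightarrow> 0) at_top"
        by (intro Lim_null_comparison[OF _ lim])
           (auto simp: eventually_at_top_linorder intro!: exI[of _ 0])
      then have \<eta>: "((\<lambda>t. fst (\<phi> t)) \<longlongrightarrow> 0) at_top"
      proof (rule vanishing_perturbation_convergence[OF f gas, rotated 2])
        fix t :: real assume t: "0 \<le> t"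
        show "((\<lambda>t. fst (\<phi> t)) has_vector_derivative fst (F (\<phi> t))) (at t within {0..})"
          using bounded_linear.has_vector_derivative[OF bounded_linear_fst
              forward_solution_deriv[OF \<phi> t order_refl]] .
        show "norm (fst (\<phi> t)) \<le> R2"
          using bounds[OF x \<phi> t] by simp
      qed
      from tendsto_Pair[OF \<eta> \<xi>] show ?thesis by (simp add: zero_prod_def)
    qed
    then show ?thesis
      using exists[OF x] by (simp add: domain_of_attraction_def)
  qed
  then show "{(\<eta>, \<xi>). norm \<eta> \<le> R \<and> W \<xi> \<le> N} \<subseteq> domain_of_attraction F 0"
    by auto
  have contW: "isCont W 0"
    by (rule has_derivative_continuous[OF W(1)])
  have W_small: "\<exists>d>0. \<forall>\<xi>. norm \<xi> < d \<longrightarrow> W \<xi> \<le> e" if "0 < e" for e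
    using contW[unfolded continuous_at_eps_delta, rule_format, OF that] W(2)
    by (auto simp: dist_real_def) (metis abs_of_nonneg W0 less_imp_le)
  have near: "norm (fst x) \<le> d" "norm (snd x) < d" if "dist x 0 < d" for x :: "'a \<times> 'b" and d
    using that norm_fst_le[of "fst x" "snd x"] norm_snd_le[of "snd x" "fst x"] by auto
  have "stable_at F 0"
    unfolding stable_at_def
  proof (intro allI impI)
    fix \<epsilon> :: real assume "0 < \<epsilon>"
    \<comment> \<open>Capping at \<open>R2\<close> keeps the small region inside the one where the
      estimates are assumed.\<close>
    define e where "e = min \<epsilon> R2"
    have e: "0 < e" "e \<le> \<epsilon>" "e \<le> R2" using \<open>0 < \<epsilon>\<close> \<open>0 < R\<close> \<open>R < R2\<close> by (auto simp: e_def)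
    obtain \<delta> where \<delta>: "\<delta> > 0"
      "\<And>x \<phi> t. norm x < \<delta> \<Longrightarrow> forward_solution f x \<phi> \<Longrightarrow> t \<ge> 0 \<Longrightarrow> norm (\<phi> t) < e / 4"
      using gas e(1) unfolding globally_asymptotically_stable_at_def stable_at_def
      by (metis dist_0_norm dist_commute zero_less_divide_iff zero_less_numeral)
    define r where "r = Min {\<delta> / 2, e / 8, R}"
    have r: "0 < r" "r < \<delta>" "r < e / 4" "r \<le> R" using \<delta>(1) e(1) \<open>0 < R\<close> by (auto simp: r_def)
    have "norm (\<phi> t) \<le> e / 4" if "norm x \<le> r" "forward_solution f x \<phi>" "t \<ge> 0" for x \<phi> t
      using \<delta>(2)[OF _ that(2,3)] that(1) r(2) by force
    then obtain T1 \<sigma>1 where T1: "T1 > 0" "\<sigma>1 > 0" "robustly_confined f r (e / 4 + r / 2) T1 \<sigma>1"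
      using robustly_confined_exists[OF f gas r(1), of "e / 4"] by meson
    \<comment> \<open>The radius from \<open>robustly_confined_exists\<close>; being at most
      \<open>e / 2\<close>, it leaves the other half for \<xi>.\<close>
    define r2 where "r2 = e / 4 + r / 2"
    have r2: "r < r2" "r2 \<le> e / 2" "r2 \<le> R2" using r e by (auto simp: r2_def)
    \<comment> \<open>While \<xi> has norm at most \<open>s\<close>, the perturbation is at most
      \<open>L * s\<close>, hence its integral over a window at most \<open>\<sigma>1\<close>;
      \<open>L + 1\<close> avoids division by 0.\<close>
    define s where "s = min (\<sigma>1 / (T1 * (L + 1))) (e / 2)"
    have s: "0 < s" "s \<le> e / 2" "L * s * T1 \<le> \<sigma>1"
    proof -
      show "0 < s" using T1 \<open>0 \<le> L\<close> e(1) by (simp add: s_def)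
      show "s \<le> e / 2" unfolding s_def by (rule min.cobounded2)
      have "s \<le> \<sigma>1 / (T1 * (L + 1))" by (simp add: s_def)
      moreover have "0 < T1 * (L + 1)" using T1(1) \<open>0 \<le> L\<close> by simp
      ultimately have "(L + 1) * s * T1 \<le> \<sigma>1" by (simp add: pos_le_divide_eq mult_ac)
      moreover have "L * s * T1 \<le> (L + 1) * s * T1" using T1(1) \<open>0 < s\<close> by simp
      ultimately show "L * s * T1 \<le> \<sigma>1" by simp
    qed
    define n where "n = min N (a * s\<^sup>2 / 2)"
    have n: "0 < n" "n \<le> N" "2 * n \<le> a * s\<^sup>2"
      using \<open>0 < N\<close> coercive(1) s(1) by (auto simp: n_def)
    have n_s: "norm \<xi> \<le> s" if "W \<xi> \<le> 2 * n" for \<xi>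
    proof -
      have "a * (norm \<xi>)\<^sup>2 \<le> a * s\<^sup>2" using coercive(2)[of \<xi>] that n(3) by linarith
      then have "(norm \<xi>)\<^sup>2 \<le> s\<^sup>2" using coercive(1) by simp
      then show ?thesis by (rule power2_le_imp_le) (use s(1) in simp)
    qed
    obtain d0 where d0: "d0 > 0" "\<And>\<xi>. norm \<xi> < d0 \<Longrightarrow> W \<xi> \<le> n"
      using W_small[OF n(1)] by blast
    define d where "d = min d0 r"
    have "(\<exists>\<phi>. forward_solution F x \<phi>) \<and>
        (\<forall>\<phi>. forward_solution F x \<phi> \<longrightarrow> (\<forall>t\<ge>0. dist (\<phi> t) 0 < \<epsilon>))" if "dist x 0 < d" for x
    proof (intro conjI allI impI)
      have x: "norm (fst x) \<le> r" "W (snd x) \<le> n"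
        using near[OF that] d0(2)[of "snd x"] by (auto simp: d_def)
      then show "\<exists>\<phi>. forward_solution F x \<phi>"
        using exists[of x] order_trans[OF _ r(4)] order_trans[OF _ n(2)] by blast
      fix \<phi> and t :: real assume \<phi>: "forward_solution F x \<phi>" and "0 \<le> t"
      have \<phi>0: "\<phi> 0 = x" using \<phi> by (simp add: forward_solution_def)
      have lp: "norm (fst (F (\<eta>, \<xi>)) - f \<eta>) \<le> L * s - 0 * W' \<xi> (snd (F (\<eta>, \<xi>)))"
        if "norm \<eta> \<le> r2" "W \<xi> \<le> 2 * n" for \<eta> \<xi>
      proof -
        have "L * norm \<xi> \<le> L * s" using n_s[OF that(2)] \<open>0 \<le> L\<close> by (rule mult_left_mono)
        then show ?thesis using linear_perturbation[of \<eta> \<xi>] that r2(3) n(2) by simp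
      qed
      have "norm (fst (\<phi> t)) < r2 \<and> W (snd (\<phi> t)) \<le> W (snd (\<phi> 0)) * exp (- c * t)"
      proof (rule cascade_a_priori[OF W(1) W0 T1(3)[folded r2_def] r2(1) n(1) _ _ lp])
        show "W' \<xi> (snd (F (\<eta>, \<xi>))) \<le> - c * W \<xi>" if "norm \<eta> \<le> r2" "W \<xi> \<le> 2 * n" for \<eta> \<xi>
          using decay[of \<eta> \<xi>] that r2(3) n(2) by simp
        show "L * s * T1 + 0 * n \<le> \<sigma>1" using s(3) by simp
        show "norm (fst (\<phi> 0)) \<le> r" "W (snd (\<phi> 0)) \<le> n" using x by (simp_all add: \<phi>0)
        show "continuous_on {0..} \<phi>" by (rule forward_solution_continuous[OF \<phi>]) simp
      qed (use \<open>0 < c\<close> \<open>0 \<le> L\<close> s(1) \<open>0 \<le> t\<close> forward_solution_deriv[OF \<phi>] in auto)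
      moreover have "W (snd (\<phi> 0)) * exp (- c * t) \<le> W (snd (\<phi> 0))"
        using \<open>0 < c\<close> \<open>0 \<le> t\<close> W0 by (intro mult_left_le) auto
      ultimately have "norm (fst (\<phi> t)) < r2" "norm (snd (\<phi> t)) \<le> s"
        using n_s[of "snd (\<phi> t)"] x(2) n(1) by (auto simp: \<phi>0)
      then show "dist (\<phi> t) 0 < \<epsilon>"
        using norm_Pair_le[where x="fst (\<phi> t)" and y="snd (\<phi> t)"] r2(2) s(2) e(2) by simp
    qed
    moreover have "d > 0" using d0(1) r(1) by (simp add: d_def)
    ultimately show "\<exists>d>0. \<forall>x0. dist x0 0 < d \<longrightarrow> (\<exists>\<phi>. forward_solution F x0 \<phi>) \<and>
        (\<forall>\<phi>. forward_solution F x0 \<phi> \<longrightarrow> (\<forall>t\<ge>0. dist (\<phi> t) 0 < \<epsilon>))"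
      by blast
  qed
  moreover have "\<exists>d>0. ball 0 d \<subseteq> domain_of_attraction F 0"
  proof -
    obtain d0 where d0: "d0 > 0" "\<And>\<xi>. norm \<xi> < d0 \<Longrightarrow> W \<xi> \<le> N"
      using W_small[OF \<open>0 < N\<close>] by blast
    have "x \<in> domain_of_attraction F 0" if "x \<in> ball 0 (min d0 R)" for x
      using near[of x "min d0 R"] that d0(2)[of "snd x"] by (intro attracted) (auto simp: dist_commute)
    then show ?thesis using d0(1) \<open>0 < R\<close> by (intro exI[of _ "min d0 R"]) auto
  qed
  ultimately show "locally_asymptotically_stable_at F 0"
    using F(2) by (simp add: locally_asymptotically_stable_at_def)
qed

section \<open>Chains of filters\<close>

text \<open>Up to the index shift, \<open>filt g j x\<close> is \<open>(D + g 0) \<cdots> (D + g (j - 1)) x\<close> for the shift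
  operator \<open>D\<close>, evaluated at the head of the sequence \<open>x\<close>.\<close>

primrec filt :: "(nat \<Rightarrow> real) \<Rightarrow> nat \<Rightarrow> (nat \<Rightarrow> real) \<Rightarrow> real" where
  "filt g 0 x = x 0"
| "filt g (Suc j) x = filt g j (\<lambda>r. x (Suc r)) + g j * filt g j x"

lemma filt_add: "filt g j (\<lambda>r. x r + y r) = filt g j x + filt g j y"
  by (induction j arbitrary: x y) (auto simp: algebra_simps)

lemma filt_scale: "filt g j (\<lambda>r. c * x r) = c * filt g j x"
  by (induction j arbitrary: x) (auto simp: algebra_simps)

text \<open>Ensures that an error variable is known before its own gain is chosen: that gain has
  index \<open>j\<close>, and the filter reads only smaller ones.\<close>

lemma filt_cong:
  assumes "\<And>r. r < j \<Longrightarrow> g r = h r" "\<And>r. r \<le> j \<Longrightarrow> x r = y r"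
  shows "filt g j x = filt h j y"
  using assms
proof (induction j arbitrary: x y)
  case (Suc j)
  have "filt g j (\<lambda>r. x (Suc r)) = filt h j (\<lambda>r. y (Suc r))" "filt g j x = filt h j y"
    using Suc.prems by (auto intro!: Suc.IH)
  then show ?case using Suc.prems(1)[of j] by simp
qed simp

text \<open>The entry of highest index has coefficient 1 and can be solved for; in this way the
  input annihilates the last filtered value.\<close>

lemma filt_last: "filt g j (x(j := c)) = c + filt g j (x(j := 0))"
proof (induction j arbitrary: x)
  case (Suc j)
  have 1: "(\<lambda>r. (x(Suc j := c)) (Suc r)) = (\<lambda>r. x (Suc r))(j := c)" for c
    by auto
  have "filt g j (x(Suc j := c)) = filt g j (x(Suc j := 0))"
    by (rule filt_cong) auto
  then show ?case
    by (simp only: filt.simps 1 Suc.IH[of "\<lambda>r. x (Suc r)"] add.assoc)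
qed simp

text \<open>Each factor \<open>D + g r\<close> costs at most \<open>1 + g r\<close>. The product
  reappears as the normalisation in \<open>weight\<close>.\<close>

lemma filt_bound:
  assumes "\<And>r. r < j \<Longrightarrow> 0 \<le> g r" "\<And>r. r \<le> j \<Longrightarrow> \<bar>x r\<bar> \<le> c"
  shows "\<bar>filt g j x\<bar> \<le> c * (\<Prod>r<j. 1 + g r)"
  using assms
proof (induction j arbitrary: x)
  case (Suc j)
  define P where "P = (\<Prod>r<j. 1 + g r)"
  have "\<bar>filt g j (\<lambda>r. x (Suc r))\<bar> \<le> c * P" and 2: "\<bar>filt g j x\<bar> \<le> c * P"
    unfolding P_def using Suc.prems by (auto intro!: Suc.IH)
  moreover have "g j * \<bar>filt g j x\<bar> \<le> g j * (c * P)"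
    using 2 Suc.prems(1)[of j] by (intro mult_left_mono) auto
  moreover have "\<bar>g j * filt g j x\<bar> = g j * \<bar>filt g j x\<bar>"
    using Suc.prems(1)[of j] by (simp add: abs_mult)
  ultimately have "\<bar>filt g (Suc j) x\<bar> \<le> c * P + g j * (c * P)"
    unfolding filt.simps by linarith
  then show ?case by (simp add: P_def algebra_simps)
qed simp

lemma filt_shift_Suc:
  "filt g j (\<lambda>r. x (r + Suc k)) = filt g (Suc j) (\<lambda>r. x (r + k)) - g j * filt g j (\<lambda>r. x (r + k))"
  by simp

text \<open>Inverts the filters through \<open>D = (D + g j) - g j\<close>, which trades a shift for
  one more filter order and a multiple of the present one. Hence the induction over the shift
  \<open>i\<close> for all orders \<open>j\<close>.\<close>

lemma filt_inverse_bound: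
  assumes "0 \<le> G" "\<And>m. m < k \<Longrightarrow> \<bar>g m\<bar> \<le> G"
  shows "\<bar>x k\<bar> \<le> (1 + G) ^ k * (\<Sum>m\<le>k. \<bar>filt g m x\<bar>)"
proof -
  define S where "S n = (\<Sum>m\<le>n. \<bar>filt g m x\<bar>)" for n
  have mono: "S m \<le> S n" if "m \<le> n" for m n
    unfolding S_def using that by (intro sum_mono2) auto
  have S0: "0 \<le> S n" for n by (simp add: S_def sum_nonneg)
  have "\<bar>filt g j (\<lambda>r. x (r + i))\<bar> \<le> (1 + G) ^ i * S (j + i)" if "j + i \<le> k" for j i
    using that
  proof (induction i arbitrary: j)
    case 0
    have "\<bar>filt g j x\<bar> \<le> S j" unfolding S_def by (rule member_le_sum) auto
    then show ?case by simp
  next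
    case (Suc i)
    have 1: "\<bar>filt g (Suc j) (\<lambda>r. x (r + i))\<bar> \<le> (1 + G) ^ i * S (j + Suc i)"
      using Suc.IH[of "Suc j"] Suc.prems by simp
    have "\<bar>filt g j (\<lambda>r. x (r + i))\<bar> \<le> (1 + G) ^ i * S (j + i)"
      using Suc.IH[of j] Suc.prems by simp
    also have "\<dots> \<le> (1 + G) ^ i * S (j + Suc i)"
      using mono[of "j + i" "j + Suc i"] \<open>0 \<le> G\<close> by (intro mult_left_mono) auto
    finally have 2: "\<bar>g j * filt g j (\<lambda>r. x (r + i))\<bar> \<le> G * ((1 + G) ^ i * S (j + Suc i))"
      using assms(2)[of j] Suc.prems \<open>0 \<le> G\<close> unfolding abs_mult by (intro mult_mono) auto
    have "\<bar>filt g j (\<lambda>r. x (r + Suc i))\<bar>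
        \<le> (1 + G) ^ i * S (j + Suc i) + G * ((1 + G) ^ i * S (j + Suc i))"
      using 1 2 unfolding filt_shift_Suc by linarith
    then show ?case by (simp add: algebra_simps)
  qed
  from this[of 0 k] show ?thesis by (simp add: S_def)
qed

lemma filt_low_gain:
  assumes \<epsilon>: "0 \<le> \<epsilon>" and "0 \<le> K" and g: "\<And>m. m < p \<Longrightarrow> g m = \<epsilon>"
    and K: "\<And>m. m < p \<Longrightarrow> \<bar>filt g m x\<bar> * \<epsilon> ^ (p - 1 - m) \<le> K"
  shows "\<bar>x p - filt g p x\<bar> \<le> 2 ^ p * K * \<epsilon>"
proof -
  have inner: "\<bar>filt g j (\<lambda>r. x (r + k))\<bar> * \<epsilon> ^ (p - 1 - (j + k)) \<le> 2 ^ k * K" if "j + k < p" for j k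
    using that
  proof (induction k arbitrary: j)
    case 0
    then show ?case using K by simp
  next
    case (Suc k)
    define n where "n = p - 1 - (j + Suc k)"
    have n: "p - 1 - (j + k) = Suc n" "p - 1 - (Suc j + k) = n"
      using Suc.prems by (auto simp: n_def)
    have 1: "\<bar>filt g (Suc j) (\<lambda>r. x (r + k))\<bar> * \<epsilon> ^ n \<le> 2 ^ k * K"
      using Suc.IH[of "Suc j"] Suc.prems n by simp
    have 2: "\<bar>filt g j (\<lambda>r. x (r + k))\<bar> * \<epsilon> ^ Suc n \<le> 2 ^ k * K"
      using Suc.IH[of j] Suc.prems n by simp
    have "\<bar>filt g j (\<lambda>r. x (r + Suc k))\<bar>
        \<le> \<bar>filt g (Suc j) (\<lambda>r. x (r + k))\<bar> + \<epsilon> * \<bar>filt g j (\<lambda>r. x (r + k))\<bar>"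
      unfolding filt_shift_Suc using g[of j] Suc.prems \<epsilon> abs_triangle_ineq4
      by (metis abs_mult abs_of_nonneg add_lessD1)
    then have "\<bar>filt g j (\<lambda>r. x (r + Suc k))\<bar> * \<epsilon> ^ n
        \<le> (\<bar>filt g (Suc j) (\<lambda>r. x (r + k))\<bar> + \<epsilon> * \<bar>filt g j (\<lambda>r. x (r + k))\<bar>) * \<epsilon> ^ n"
      using \<epsilon> by (intro mult_right_mono) auto
    also have "\<dots> = \<bar>filt g (Suc j) (\<lambda>r. x (r + k))\<bar> * \<epsilon> ^ n
        + \<bar>filt g j (\<lambda>r. x (r + k))\<bar> * \<epsilon> ^ Suc n"
      by (simp add: algebra_simps del: filt.simps)
    also have "\<dots> \<le> 2 ^ Suc k * K"
      using 1 2 by simp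
    finally show ?case by (simp only: n_def)
  qed
  have "\<bar>filt g j (\<lambda>r. x (r + k)) - filt g p x\<bar> \<le> 2 ^ k * K * \<epsilon>" if "j + k = p" for j k
    using that
  proof (induction k arbitrary: j)
    case 0
    then show ?case using \<open>0 \<le> K\<close> \<epsilon> by simp
  next
    case (Suc k)
    have "j < p" using Suc.prems by simp
    have 1: "\<bar>filt g (Suc j) (\<lambda>r. x (r + k)) - filt g p x\<bar> \<le> 2 ^ k * K * \<epsilon>"
      using Suc.IH[of "Suc j"] Suc.prems by simp
    have "\<bar>filt g j (\<lambda>r. x (r + k))\<bar> \<le> 2 ^ k * K"
      using inner[of j k] Suc.prems by simp
    then have 2: "\<bar>g j * filt g j (\<lambda>r. x (r + k))\<bar> \<le> 2 ^ k * K * \<epsilon>"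
      using g[OF \<open>j < p\<close>] \<epsilon> by (simp add: abs_mult mult.commute[of _ \<epsilon>] mult_left_mono)
    show ?case
      unfolding filt_shift_Suc using 1 2 by (simp del: filt.simps)
  qed
  from this[of 0 p] show ?thesis by simp
qed

section \<open>A dissipation inequality for chains, and a principle of sequential choice\<close>

lemma weighted_young:
  fixes w g x y :: real
  assumes "0 < w" "0 < g"
  shows "2 * w * x * y \<le> w * g * x\<^sup>2 / 4 + 4 * w / g * y\<^sup>2"
proof -
  have "0 \<le> w / g * (g * x / 2 - 2 * y)\<^sup>2"
    using assms by simp
  also have "\<dots> = w * g * x\<^sup>2 / 4 + 4 * w / g * y\<^sup>2 - 2 * w * x * y"
    using assms by (simp add: power2_eq_square field_simps)
  finally show ?thesis by simp
qed

text \<open>The coupling to the successor has coefficient 1, so that it is dominated as soon as the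
  gain of the successor is large; the coupling to \<open>E v\<close> is dominated by the gain of \<open>v\<close>.\<close>

lemma chain_dissipation:
  fixes x y z w g M :: "'v \<Rightarrow> real" and s :: "'v \<Rightarrow> 'v"
  assumes V: "finite V" and s: "inj_on s V"
    and wg: "\<And>v. v \<in> V \<Longrightarrow> 0 < w v" "\<And>v. v \<in> V \<Longrightarrow> 0 < g v"
    and E: "\<And>v. v \<in> V \<Longrightarrow> E v \<subseteq> V"
    and y: "\<And>v. v \<in> V \<Longrightarrow> \<bar>y v\<bar> \<le> (if s v \<in> V then \<bar>x (s v)\<bar> else 0)"
    and upper: "\<And>v. v \<in> V \<Longrightarrow> s v \<in> V \<Longrightarrow> 16 * w v \<le> g v * (w (s v) * g (s v))"
    and z: "\<And>v. v \<in> V \<Longrightarrow> \<bar>z v\<bar> \<le> M v * (\<Sum>u\<in>E v. \<bar>x u\<bar>)"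
    and lower: "\<And>v. v \<in> V \<Longrightarrow> 16 * card V * w v * (M v)\<^sup>2 * (\<Sum>u\<in>E v. 1 / (w u * g u)) \<le> g v"
  shows "(\<Sum>v\<in>V. 2 * w v * x v * (- g v * x v + y v + z v)) \<le> - (\<Sum>v\<in>V. w v * g v * (x v)\<^sup>2)"
proof (cases "V = {}")
  case False
  define c where "c v = w v * g v * (x v)\<^sup>2" for v
  define S where "S = (\<Sum>v\<in>V. c v)"
  define N where "N = real (card V)"
  have N: "N > 0" using False V by (simp add: N_def card_gt_0_iff)
  have c0: "0 \<le> c v" if "v \<in> V" for v using wg[OF that] by (simp add: c_def)
  have S0: "0 \<le> S" unfolding S_def by (rule sum_nonneg) (rule c0)
  \<comment> \<open>The budget: Young's inequality costs \<open>c v / 4\<close> twice, and after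
    summation successors and earlier variables cost \<open>S / 4\<close> each, so that
    \<open>- S\<close> is left of \<open>- 2 * S\<close>.\<close>
  have each: "2 * w v * x v * (- g v * x v + y v + z v)
      \<le> - 2 * c v + c v / 4 + (if s v \<in> V then c (s v) / 4 else 0) + c v / 4 + S / (4 * N)"
    if v: "v \<in> V" for v
  proof -
    have w: "0 < w v" and g: "0 < g v" using wg[OF v] by auto
    have "2 * w v * x v * y v \<le> c v / 4 + 4 * w v / g v * (y v)\<^sup>2"
      unfolding c_def by (rule weighted_young[OF w g])
    moreover have "4 * w v / g v * (y v)\<^sup>2 \<le> (if s v \<in> V then c (s v) / 4 else 0)"
    proof (cases "s v \<in> V")
      case True
      have "(y v)\<^sup>2 \<le> (x (s v))\<^sup>2"
        using y[OF v] True by (intro abs_le_square_iff[THEN iffD1]) simp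
      then have "4 * w v / g v * (y v)\<^sup>2 \<le> 4 * w v / g v * (x (s v))\<^sup>2"
        using w g by (intro mult_left_mono) auto
      also have "\<dots> \<le> (w (s v) * g (s v) / 4) * (x (s v))\<^sup>2"
        using upper[OF v True] g by (intro mult_right_mono) (auto simp: field_simps)
      finally show ?thesis using True by (simp add: c_def)
    next
      case False
      then show ?thesis using y[OF v] by simp
    qed
    moreover have "2 * w v * x v * z v \<le> c v / 4 + 4 * w v / g v * (z v)\<^sup>2"
      unfolding c_def by (rule weighted_young[OF w g])
    moreover have "4 * w v / g v * (z v)\<^sup>2 \<le> S / (4 * N)"
    proof -
      define I where "I = (\<Sum>u\<in>E v. 1 / (w u * g u))"
      have EV: "u \<in> V" if "u \<in> E v" for u using E[OF v] that by blast
      \<comment> \<open>Cauchy-Schwarz, with factors \<open>sqrt (w u * g u)\<close> inserted so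
        that the dissipation terms \<open>c u\<close> appear.\<close>
      have "(\<Sum>u\<in>E v. \<bar>x u\<bar>)\<^sup>2
          = (\<Sum>u\<in>E v. (1 / sqrt (w u * g u)) * (sqrt (w u * g u) * \<bar>x u\<bar>))\<^sup>2"
        using wg EV by (intro arg_cong[where f="\<lambda>t. t\<^sup>2"] sum.cong) fastforce+
      also have "\<dots> \<le> (\<Sum>u\<in>E v. (1 / sqrt (w u * g u))\<^sup>2) * (\<Sum>u\<in>E v. (sqrt (w u * g u) * \<bar>x u\<bar>)\<^sup>2)"
        by (rule Cauchy_Schwarz_ineq_sum)
      also have "(\<Sum>u\<in>E v. (1 / sqrt (w u * g u))\<^sup>2) = I"
        unfolding I_def using wg EV by (intro sum.cong) (auto simp: power_divide less_imp_le)
      also have "(\<Sum>u\<in>E v. (sqrt (w u * g u) * \<bar>x u\<bar>)\<^sup>2) = (\<Sum>u\<in>E v. c u)"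
        using wg EV by (intro sum.cong) (auto simp: c_def power_mult_distrib less_imp_le)
      finally have "(\<Sum>u\<in>E v. \<bar>x u\<bar>)\<^sup>2 \<le> I * (\<Sum>u\<in>E v. c u)" .
      also have "\<dots> \<le> I * S"
      proof (rule mult_left_mono)
        show "(\<Sum>u\<in>E v. c u) \<le> S"
          unfolding S_def using V E[OF v] c0 by (intro sum_mono2) auto
        show "0 \<le> I" unfolding I_def using wg EV by (intro sum_nonneg) (simp add: less_imp_le)
      qed
      finally have CS: "(\<Sum>u\<in>E v. \<bar>x u\<bar>)\<^sup>2 \<le> I * S" .
      have "(z v)\<^sup>2 \<le> (M v * (\<Sum>u\<in>E v. \<bar>x u\<bar>))\<^sup>2"
        using z[OF v] by (metis abs_ge_zero power2_abs power_mono)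
      also have "\<dots> \<le> (M v)\<^sup>2 * (I * S)"
        unfolding power_mult_distrib using CS by (intro mult_left_mono) auto
      finally have "4 * w v / g v * (z v)\<^sup>2 \<le> 4 * w v / g v * ((M v)\<^sup>2 * (I * S))"
        using w g by (intro mult_left_mono) auto
      also have "\<dots> = (16 * N * w v * (M v)\<^sup>2 * I) * (S / (4 * N * g v))"
        using N by (simp add: field_simps)
      also have "\<dots> \<le> g v * (S / (4 * N * g v))"
        using lower[OF v] S0 N g by (intro mult_right_mono) (auto simp: I_def N_def)
      also have "\<dots> = S / (4 * N)" using g by simp
      finally show ?thesis .
    qed
    moreover have "2 * w v * x v * (- g v * x v + y v + z v)
        = - 2 * c v + 2 * w v * x v * y v + 2 * w v * x v * z v"
      by (simp add: c_def power2_eq_square algebra_simps)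
    ultimately show ?thesis by linarith
  qed
  \<comment> \<open>By injectivity of \<open>s\<close>, every \<open>c u\<close> is charged by at
    most one predecessor.\<close>
  have "(\<Sum>v\<in>V. if s v \<in> V then c (s v) / 4 else 0) = (\<Sum>v\<in>{v\<in>V. s v \<in> V}. c (s v)) / 4"
    using V by (simp add: sum.If_cases Int_def flip: sum_divide_distrib)
  also have "(\<Sum>v\<in>{v\<in>V. s v \<in> V}. c (s v)) = (\<Sum>u\<in>s ` {v\<in>V. s v \<in> V}. c u)"
    using inj_on_subset[OF s] by (subst sum.reindex) auto
  also have "\<dots> \<le> S"
    unfolding S_def using V c0 by (intro sum_mono2) auto
  finally have succ: "(\<Sum>v\<in>V. if s v \<in> V then c (s v) / 4 else 0) \<le> S / 4" by simp
  have "(\<Sum>v\<in>V. 2 * w v * x v * (- g v * x v + y v + z v))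
      \<le> (\<Sum>v\<in>V. - 2 * c v + c v / 4 + (if s v \<in> V then c (s v) / 4 else 0) + c v / 4 + S / (4 * N))"
    by (rule sum_mono) (rule each)
  also have "\<dots> = - 2 * S + S / 4 + (\<Sum>v\<in>V. if s v \<in> V then c (s v) / 4 else 0) + S / 4 + N * (S / (4 * N))"
    by (simp only: sum.distrib S_def N_def sum_constant sum_divide_distrib sum_distrib_left)
  also have "\<dots> \<le> - S"
    using succ N by simp
  finally show ?thesis by (simp add: S_def c_def)
qed simp

text \<open>Induction along \<open>pos\<close>, which meets at most one new index per stage. By
  \<open>cong\<close>, the value chosen there does not affect the conditions already
  established.\<close>

lemma sequential_choice:
  fixes pos :: "'v \<Rightarrow> nat" and P :: "'v \<Rightarrow> ('v \<Rightarrow> 'a) \<Rightarrow> bool"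
  assumes V: "finite V" and inj: "inj_on pos V"
    and cong: "\<And>v g g'. v \<in> V \<Longrightarrow> (\<And>u. u \<in> V \<Longrightarrow> pos u \<le> pos v \<Longrightarrow> g u = g' u) \<Longrightarrow> P v g \<Longrightarrow> P v g'"
    and ex: "\<And>v g. v \<in> V \<Longrightarrow> (\<And>u. u \<in> V \<Longrightarrow> pos u < pos v \<Longrightarrow> P u g) \<Longrightarrow> \<exists>x. P v (g(v := x))"
  shows "\<exists>g. \<forall>v\<in>V. P v g"
proof -
  have "\<exists>g. \<forall>v\<in>V. pos v < n \<longrightarrow> P v g" for n
  proof (induction n)
    case (Suc n)
    then obtain g where g: "\<And>v. v \<in> V \<Longrightarrow> pos v < n \<Longrightarrow> P v g" by blast
    show ?case
    proof (cases "\<exists>v\<in>V. pos v = n")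
      case True
      then obtain v where v: "v \<in> V" "pos v = n" by blast
      then obtain x where x: "P v (g(v := x))" using ex[OF v(1)] g by blast
      have "P u (g(v := x))" if "u \<in> V" "pos u < Suc n" for u
      proof (cases "u = v")
        case False
        then have "pos u \<noteq> n" using inj_onD[OF inj, of u v] that v by auto
        then have "pos u < n" using that by simp
        show ?thesis
        proof (rule cong[OF that(1) _ g[OF that(1) \<open>pos u < n\<close>]])
          fix u' assume "pos u' \<le> pos u"
          then have "u' \<noteq> v" using \<open>pos u < n\<close> v(2) by auto
          then show "g u' = (g(v := x)) u'" by simp
        qed
      qed (use x in simp)
      then show ?thesis by blast
    next
      case False
      then have "pos u < n" if "u \<in> V" "pos u < Suc n" for u
        using that by (auto simp: less_Suc_eq)
      then show ?thesis using g by blast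
    qed
  qed simp
  then obtain g where "\<forall>v\<in>V. pos v < Suc (Max (pos ` V)) \<longrightarrow> P v g" by blast
  moreover have "pos v < Suc (Max (pos ` V))" if "v \<in> V" for v
    using V that by (simp add: less_Suc_eq_le)
  ultimately show ?thesis by blast
qed

section \<open>Choice of the gains\<close>

text \<open>The variable \<open>\<xi>\<^sub>i\<^sub>,\<^sub>j\<close> is addressed as \<open>(i, j - 1)\<close> from here on, and \<open>pos\<close> is its place in the
  list \<open>\<kappa>\<close>.\<close>

locale chain_system =
  fixes q ell :: "'m::{finite,linorder} \<Rightarrow> nat"
    and var :: "'m \<times> nat \<Rightarrow> 'k::finite"
    and f0 :: "'e::euclidean_space \<Rightarrow> (real, 'm) vec \<Rightarrow> 'e"
    and \<delta> :: "'m \<Rightarrow> nat \<Rightarrow> 'm \<Rightarrow> 'e \<Rightarrow> real ^ 'k \<Rightarrow> real"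
    and pos :: "'m \<times> nat \<Rightarrow> nat"
  assumes var: "bij_betw var (chain_vars q) UNIV"
    and q_pos: "\<And>i. 0 < q i"
    and ell: "\<And>i. 1 \<le> ell i" "\<And>i. ell i \<le> q i + 1"
    and f0_lipschitz: "lipschitz_on_bounded (\<lambda>(\<eta>, w). f0 \<eta> w)"
    and \<delta>_lipschitz:
      "\<And>i r l. Suc r < q i \<Longrightarrow> l < i \<Longrightarrow> lipschitz_on_bounded (\<lambda>(\<eta>, \<xi>). \<delta> i (Suc r) l \<eta> \<xi>)"
    and low_uncoupled:
      "\<And>i r l \<eta> \<xi>. Suc r < q i \<Longrightarrow> Suc r < ell i \<Longrightarrow> l < i \<Longrightarrow> \<delta> i (Suc r) l \<eta> \<xi> = 0"
    and zero_dynamics: "globally_asymptotically_stable_at (\<lambda>\<eta>. f0 \<eta> 0) 0"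
    and pos_inj: "inj_on pos (SIGMA i:UNIV. {..<q i})"
    and pos_succ: "\<And>i j. Suc j < q i \<Longrightarrow> pos (i, j) < pos (i, Suc j)"
    and pos_input:
      "\<And>i r l m \<eta> \<xi>. Suc r < q i \<Longrightarrow> l < i \<Longrightarrow> \<delta> i (Suc r) l \<eta> \<xi> \<noteq> 0 \<Longrightarrow> m < q l \<Longrightarrow>
         pos (l, m) < pos (i, r)"
    and pos_depends:
      "\<And>i r l. Suc r < q i \<Longrightarrow> l < i \<Longrightarrow> depends_only_on var (\<delta> i (Suc r) l)
         ({(r, 1) |r. True} \<union> {(i', Suc j') |i' j'. j' < q i' \<and> pos (i', j') \<le> pos (i, r)})"
begin

definition V :: "('m \<times> nat) set" where
  "V = (SIGMA i:UNIV. {..<q i})"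

text \<open>The default 0 at index \<open>q i\<close> holds the place of the input;
  \<open>ext_state\<close> overwrites it.\<close>

definition state :: "real ^ 'k \<Rightarrow> 'm \<Rightarrow> nat \<Rightarrow> real" where
  "state \<xi> i r = (if r < q i then \<xi> $ var (i, Suc r) else 0)"

text \<open>With indices from 0, \<open>err \<gamma> \<xi> (i, j)\<close> is the coordinate
  e_{i,j+1}.\<close>

definition err :: "('m \<times> nat \<Rightarrow> real) \<Rightarrow> real ^ 'k \<Rightarrow> 'm \<times> nat \<Rightarrow> real" where
  "err \<gamma> \<xi> v = filt (\<lambda>r. \<gamma> (fst v, r)) (snd v) (state \<xi> (fst v))"

text \<open>This is the input for which the filtered variable of index \<open>q i\<close> of every chain vanishes.\<close>

definition feedback :: "('m \<times> nat \<Rightarrow> real) \<Rightarrow> real ^ 'k \<Rightarrow> (real, 'm) vec" where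
  "feedback \<gamma> \<xi> = (\<chi> i. - filt (\<lambda>r. \<gamma> (i, r)) (q i) (state \<xi> i))"

text \<open>The chain prolonged by its own input: apart from the couplings, the closed loop then
  acts as a shift at every index of the chain, the last one included.\<close>

definition ext_state :: "('m \<times> nat \<Rightarrow> real) \<Rightarrow> real ^ 'k \<Rightarrow> 'm \<Rightarrow> nat \<Rightarrow> real" where
  "ext_state \<gamma> \<xi> i = (state \<xi> i)(q i := feedback \<gamma> \<xi> $ i)"

definition coupling :: "('m \<times> nat \<Rightarrow> real) \<Rightarrow> 'e \<Rightarrow> real ^ 'k \<Rightarrow> 'm \<Rightarrow> nat \<Rightarrow> real" where
  "coupling \<gamma> \<eta> \<xi> i r =
     (if Suc r < q i then \<Sum>l | l < i. \<delta> i (Suc r) l \<eta> \<xi> * feedback \<gamma> \<xi> $ l else 0)"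

definition Q :: nat where "Q = (\<Sum>i\<in>UNIV. q i)"

section \<open>The closed loop in filtered coordinates\<close>

lemma q_le_Q: "q i \<le> Q"
  unfolding Q_def by (rule member_le_sum) auto

lemma mem_V: "v \<in> V \<longleftrightarrow> snd v < q (fst v)"
  by (cases v) (simp add: V_def)

lemma finite_V: "finite V"
  by (simp add: V_def)

lemma V_nonempty: "V \<noteq> {}"
  using q_pos by (auto simp: V_def)

lemma pos_strict_mono: "m < j \<Longrightarrow> j < q i \<Longrightarrow> pos (i, m) < pos (i, j)"
proof (induction j)
  case (Suc j)
  then have "pos (i, m) \<le> pos (i, j)" by (cases "m = j") auto
  then show ?case using pos_succ[of j i] Suc.prems by linarith
qed simp

lemma pos_mono: "m \<le> j \<Longrightarrow> j < q i \<Longrightarrow> pos (i, m) \<le> pos (i, j)"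
  using pos_strict_mono[of m j i] by (cases "m = j") auto

lemma var_cases:
  obtains i r where "r < q i" "k = var (i, Suc r)"
proof -
  obtain p where p: "p \<in> chain_vars q" "k = var p"
    using var unfolding bij_betw_def by blast
  obtain i j where "p = (i, j)" by (cases p)
  then show thesis
    using that[of "j - 1" i] p by (auto simp: chain_vars_def)
qed

lemma state_add: "state (\<xi> + \<xi>') i r = state \<xi> i r + state \<xi>' i r"
  by (simp add: state_def)

lemma state_scale: "state (c *\<^sub>R \<xi>) i r = c * state \<xi> i r"
  by (simp add: state_def)

lemma filt_state_linear: "linear (\<lambda>\<xi>. filt g j (state \<xi> i))"
proof (rule linearI)
  show "filt g j (state (\<xi> + \<xi>') i) = filt g j (state \<xi> i) + filt g j (state \<xi>' i)" for \<xi> \<xi>'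
    unfolding filt_add[symmetric] by (rule filt_cong) (simp_all add: state_add)
  show "filt g j (state (c *\<^sub>R \<xi>) i) = c *\<^sub>R filt g j (state \<xi> i)" for c \<xi>
    unfolding real_scaleR_def filt_scale[symmetric] by (rule filt_cong) (simp_all add: state_scale)
qed

lemma err_linear: "bounded_linear (\<lambda>\<xi>. err \<gamma> \<xi> v)"
  unfolding err_def using filt_state_linear linear_conv_bounded_linear by blast

lemma feedback_linear: "bounded_linear (feedback \<gamma>)"
proof -
  have "linear (feedback \<gamma>)"
    by (intro linearI) (simp_all add: feedback_def vec_eq_iff
      linear_add[OF filt_state_linear] linear_scale[OF filt_state_linear])
  then show ?thesis using linear_conv_bounded_linear by blast
qed

lemma filt_ext_state:
  assumes "j < q i"
  shows "filt g j (ext_state \<gamma> \<xi> i) = filt g j (state \<xi> i)"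
  by (rule filt_cong) (use assms in \<open>auto simp: ext_state_def\<close>)

lemma filt_ext_state_last: "filt (\<lambda>r. \<gamma> (i, r)) (q i) (ext_state \<gamma> \<xi> i) = 0"
proof -
  have "(state \<xi> i)(q i := 0) = state \<xi> i"
    by (auto simp: state_def)
  then show ?thesis
    unfolding ext_state_def by (subst filt_last) (simp add: feedback_def)
qed

lemma state_chain_field:
  assumes "r < q i"
  shows "state (chain_field q var \<delta> \<eta> \<xi> (feedback \<gamma> \<xi>)) i r
    = ext_state \<gamma> \<xi> i (Suc r) + coupling \<gamma> \<eta> \<xi> i r"
proof -
  have "the_inv_into (chain_vars q) var (var (i, Suc r)) = (i, Suc r)"
    using var assms by (intro the_inv_into_f_f) (auto simp: bij_betw_def chain_vars_def)
  then show ?thesis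
    using assms by (simp add: state_def chain_field_def ext_state_def coupling_def)
qed

text \<open>The recursion of \<open>filt\<close> read backwards: filtering the shifted chain gives
  the next order minus the gain times the present one. At the end of a chain the next order vanishes
  by the choice of \<open>feedback\<close>.\<close>

lemma err_chain_field:
  assumes v: "v \<in> V"
  shows "err \<gamma> (chain_field q var \<delta> \<eta> \<xi> (feedback \<gamma> \<xi>)) v = - \<gamma> v * err \<gamma> \<xi> v
    + (if (fst v, Suc (snd v)) \<in> V then err \<gamma> \<xi> (fst v, Suc (snd v)) else 0)
    + filt (\<lambda>r. \<gamma> (fst v, r)) (snd v) (coupling \<gamma> \<eta> \<xi> (fst v))"
proof -
  obtain i j where ij: "v = (i, j)" by (cases v)
  have j: "j < q i" using v ij by (simp add: mem_V)
  let ?g = "\<lambda>r. \<gamma> (i, r)"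
  have "filt ?g j (state (chain_field q var \<delta> \<eta> \<xi> (feedback \<gamma> \<xi>)) i)
      = filt ?g j (\<lambda>r. ext_state \<gamma> \<xi> i (Suc r) + coupling \<gamma> \<eta> \<xi> i r)"
    using j by (intro filt_cong) (simp_all add: state_chain_field)
  also have "\<dots> = filt ?g (Suc j) (ext_state \<gamma> \<xi> i) - \<gamma> (i, j) * filt ?g j (ext_state \<gamma> \<xi> i)
      + filt ?g j (coupling \<gamma> \<eta> \<xi> i)"
    by (simp add: filt_add)
  also have "filt ?g (Suc j) (ext_state \<gamma> \<xi> i)
      = (if (i, Suc j) \<in> V then err \<gamma> \<xi> (i, Suc j) else 0)"
  proof (cases "Suc j < q i")
    case True
    then show ?thesis
      using filt_ext_state[OF True] by (simp add: err_def mem_V del: filt.simps)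
  next
    case False
    then have "q i = Suc j" using j by simp
    then show ?thesis
      using filt_ext_state_last[of \<gamma> i \<xi>] by (simp add: mem_V del: filt.simps)
  qed
  also have "filt ?g j (ext_state \<gamma> \<xi> i) = err \<gamma> \<xi> (i, j)"
    using filt_ext_state[OF j] by (simp add: err_def)
  finally show ?thesis by (simp add: ij err_def)
qed

text \<open>The index \<open>ell i - 1\<close> also covers the convention for
  \<open>ell i = q i + 1\<close>, where it points to the slot of the input.\<close>

lemma zero_dynamics_input_eq:
  "zero_dynamics_input q ell var \<xi> (feedback \<gamma> \<xi>) = (\<chi> i. ext_state \<gamma> \<xi> i (ell i - 1))"
proof -
  have "(if ell i = q i + 1 then feedback \<gamma> \<xi> $ i else \<xi> $ var (i, ell i))
      = ext_state \<gamma> \<xi> i (ell i - 1)" for i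
  proof (cases "ell i = q i + 1")
    case False
    then have "ell i - 1 < q i" "Suc (ell i - 1) = ell i" using ell[of i] by auto
    then show ?thesis using False by (simp add: ext_state_def state_def)
  qed (simp add: ext_state_def)
  then show ?thesis by (simp add: zero_dynamics_input_def vec_eq_iff)
qed

text \<open>The input is entry \<open>q i\<close> of the extended chain, and the filtered value of
  order \<open>q i\<close> is 0. Inverting the filters thus leaves only proper errors of the same
  chain.\<close>

lemma feedback_bound:
  "\<exists>B\<ge>0. \<forall>\<xi>. \<bar>feedback \<gamma> \<xi> $ i\<bar> \<le> B * (\<Sum>m<q i. \<bar>err \<gamma> \<xi> (i, m)\<bar>)"
proof -
  define G where "G = (\<Sum>m<q i. \<bar>\<gamma> (i, m)\<bar>)"
  have G0: "0 \<le> G" by (simp add: G_def sum_nonneg)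
  have "\<bar>feedback \<gamma> \<xi> $ i\<bar> \<le> (1 + G) ^ q i * (\<Sum>m<q i. \<bar>err \<gamma> \<xi> (i, m)\<bar>)" for \<xi>
  proof -
    have "\<bar>ext_state \<gamma> \<xi> i (q i)\<bar>
        \<le> (1 + G) ^ q i * (\<Sum>m\<le>q i. \<bar>filt (\<lambda>r. \<gamma> (i, r)) m (ext_state \<gamma> \<xi> i)\<bar>)"
      by (rule filt_inverse_bound[OF G0]) (auto simp: G_def intro!: member_le_sum)
    also have "(\<Sum>m\<le>q i. \<bar>filt (\<lambda>r. \<gamma> (i, r)) m (ext_state \<gamma> \<xi> i)\<bar>)
        = (\<Sum>m<q i. \<bar>err \<gamma> \<xi> (i, m)\<bar>)"
      unfolding lessThan_Suc_atMost[symmetric] sum.lessThan_Suc filt_ext_state_last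
      by (simp add: filt_ext_state err_def)
    finally show ?thesis by (simp add: ext_state_def)
  qed
  then show ?thesis using G0 by (intro exI[of _ "(1 + G) ^ q i"]) auto
qed

lemma state_bound:
  assumes "r < q i"
  shows "\<bar>state \<xi> i r\<bar> \<le> (1 + (\<Sum>m<q i. \<bar>\<gamma> (i, m)\<bar>)) ^ r * (\<Sum>m\<le>r. \<bar>err \<gamma> \<xi> (i, m)\<bar>)"
  unfolding err_def fst_conv snd_conv
  by (rule filt_inverse_bound) (use assms in \<open>auto intro!: member_le_sum sum_nonneg\<close>)

lemma control_system_lipschitz:
  "lipschitz_on_bounded (\<lambda>x. control_system q ell var f0 \<delta> x (feedback \<gamma> (snd x)))"
proof -
  have comp: "bounded_linear (\<lambda>x::'e \<times> (real ^ 'k). g (snd x) $ i)"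
    if "bounded_linear g" for g :: "real ^ 'k \<Rightarrow> real ^ 'n" and i
    using bounded_linear_compose[OF bounded_linear_vec_nth
        bounded_linear_compose[OF that bounded_linear_snd]] .
  have fb: "lipschitz_on_bounded (\<lambda>x::'e \<times> (real ^ 'k). feedback \<gamma> (snd x) $ i)" for i
    by (rule lipschitz_on_bounded_linear[OF comp[OF feedback_linear]])
  have coord: "lipschitz_on_bounded (\<lambda>x::'e \<times> (real ^ 'k). snd x $ k)" for k
    by (rule lipschitz_on_bounded_linear[OF comp[OF bounded_linear_ident]])
  have "lipschitz_on_bounded
      (\<lambda>x::'e \<times> (real ^ 'k). zero_dynamics_input q ell var (snd x) (feedback \<gamma> (snd x)))"
  proof (rule lipschitz_on_bounded_componentwise)
    show "lipschitz_on_bounded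
        (\<lambda>x::'e \<times> (real ^ 'k). zero_dynamics_input q ell var (snd x) (feedback \<gamma> (snd x)) $ i)" for i
      using fb coord by (cases "ell i = q i + 1") (simp_all add: zero_dynamics_input_def)
  qed
  from lipschitz_on_bounded_compose[OF lipschitz_on_bounded_Pair[OF
      lipschitz_on_bounded_linear[OF bounded_linear_fst] this] f0_lipschitz]
  have 1: "lipschitz_on_bounded
      (\<lambda>x::'e \<times> (real ^ 'k). f0 (fst x) (zero_dynamics_input q ell var (snd x) (feedback \<gamma> (snd x))))"
    by simp
  have 2: "lipschitz_on_bounded
      (\<lambda>x::'e \<times> (real ^ 'k). chain_field q var \<delta> (fst x) (snd x) (feedback \<gamma> (snd x)))"
  proof (rule lipschitz_on_bounded_componentwise)
    fix k
    obtain i r where r: "r < q i" "k = var (i, Suc r)" by (rule var_cases)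
    have inv: "the_inv_into (chain_vars q) var k = (i, Suc r)"
      unfolding r(2) using var r(1) by (intro the_inv_into_f_f) (auto simp: bij_betw_def chain_vars_def)
    show "lipschitz_on_bounded
        (\<lambda>x::'e \<times> (real ^ 'k). chain_field q var \<delta> (fst x) (snd x) (feedback \<gamma> (snd x)) $ k)"
    proof (cases "Suc r < q i")
      case True
      have "lipschitz_on_bounded (\<lambda>x. \<delta> i (Suc r) l (fst x) (snd x))" if "l < i" for l
        using \<delta>_lipschitz[OF True that] by (simp only: case_prod_unfold)
      then have "lipschitz_on_bounded (\<lambda>x::'e \<times> (real ^ 'k). snd x $ var (i, Suc r + 1)
          + (\<Sum>l | l < i. \<delta> i (Suc r) l (fst x) (snd x) * feedback \<gamma> (snd x) $ l))"
        using fb coord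
        by (intro lipschitz_on_bounded_add lipschitz_on_bounded_sum lipschitz_on_bounded_mult) auto
      then show ?thesis using True by (simp add: chain_field_def inv)
    next
      case False
      then show ?thesis using fb by (simp add: chain_field_def inv)
    qed
  qed
  show ?thesis
    using lipschitz_on_bounded_Pair[OF 1 2] by (simp add: control_system_def case_prod_beta)
qed

end

text \<open>The initial states have norm at most \<open>C\<close>, and \<open>\<epsilon>\<close> is the gain of the low variables
  \<open>\<xi>\<^sub>i\<^sub>,\<^sub>j\<close>, \<open>j < \<ell>\<^sub>i\<close>. The gains have to work as long as \<open>\<eta>\<close> is bounded by \<open>R\<close>, the Lyapunov function
  by \<open>b\<close> and every \<open>\<xi>\<^sub>i\<^sub>,\<^sub>1\<close> by \<open>Y\<close>; \<open>\<Lambda>\<close> is prescribed for the decay in mean square of the others.\<close>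

locale chain_design = chain_system q ell var f0 \<delta> pos
  for q ell :: "'m::{finite,linorder} \<Rightarrow> nat"
    and var :: "'m \<times> nat \<Rightarrow> 'k::finite"
    and f0 :: "'e::euclidean_space \<Rightarrow> (real, 'm) vec \<Rightarrow> 'e"
    and \<delta> :: "'m \<Rightarrow> nat \<Rightarrow> 'm \<Rightarrow> 'e \<Rightarrow> real ^ 'k \<Rightarrow> real"
    and pos :: "'m \<times> nat \<Rightarrow> nat" +
  fixes C \<epsilon> R \<Lambda> b Y :: real
  assumes C: "1 \<le> C" and \<epsilon>: "0 < \<epsilon>" "\<epsilon> \<le> 1" and b: "0 \<le> b"
begin

definition low :: "'m \<times> nat \<Rightarrow> bool" where
  "low v \<longleftrightarrow> Suc (snd v) < ell (fst v)"

text \<open>The weights make the initial value of every term of the Lyapunov function at most 1. They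
  involve only gains of preceding variables, and those of the last low variable and of the
  first high variable of a chain are bounded below independently of \<open>\<epsilon>\<close>.\<close>

definition weight :: "('m \<times> nat \<Rightarrow> real) \<Rightarrow> 'm \<times> nat \<Rightarrow> real" where
  "weight \<gamma> v = (if low v then (\<epsilon> / 4) ^ (2 * (ell (fst v) - 1 - 1 - snd v)) / (C * 2 ^ Q)\<^sup>2
     else 1 / (C * (\<Prod>r<snd v. 1 + \<gamma> (fst v, r)))\<^sup>2)"

definition earlier :: "'m \<times> nat \<Rightarrow> ('m \<times> nat) set" where
  "earlier v = {u \<in> V. pos u < pos v}"

text \<open>Only errors up to \<open>v\<close>, and hence gains before \<open>v\<close>, occur:
  bounds on this set are available when the gain of \<open>v\<close> is chosen. The heads of the
  chains are bounded separately, since \<open>\<delta>\<close> may depend on heads that come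
  later.\<close>

definition confined_up_to :: "('m \<times> nat \<Rightarrow> real) \<Rightarrow> 'm \<times> nat \<Rightarrow> 'e \<Rightarrow> real ^ 'k \<Rightarrow> bool" where
  "confined_up_to \<gamma> v \<eta> \<xi> \<longleftrightarrow> norm \<eta> \<le> R \<and> (\<forall>i. \<bar>state \<xi> i 0\<bar> \<le> Y) \<and>
     (\<forall>u\<in>V. pos u \<le> pos v \<longrightarrow> weight \<gamma> u * (err \<gamma> \<xi> u)\<^sup>2 \<le> b)"

definition coupling_bound :: "('m \<times> nat \<Rightarrow> real) \<Rightarrow> 'm \<times> nat \<Rightarrow> real \<Rightarrow> bool" where
  "coupling_bound \<gamma> v M \<longleftrightarrow> (\<forall>\<eta> \<xi>. confined_up_to \<gamma> v \<eta> \<xi> \<longrightarrow>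
     \<bar>filt (\<lambda>r. \<gamma> (fst v, r)) (snd v) (coupling \<gamma> \<eta> \<xi> (fst v))\<bar> \<le> M * (\<Sum>u\<in>earlier v. \<bar>err \<gamma> \<xi> u\<bar>))"

text \<open>For a high variable, all conditions are lower bounds on its gain. The hypothesis
  \<open>upper\<close> of \<open>chain_dissipation\<close> relates a variable to its successor and
  is imposed on the successor; between low variables the weights provide it.\<close>

definition admissible :: "'m \<times> nat \<Rightarrow> ('m \<times> nat \<Rightarrow> real) \<Rightarrow> bool" where
  "admissible v \<gamma> \<longleftrightarrow> (if low v then \<gamma> v = \<epsilon> else
     1 \<le> \<gamma> v \<and> \<Lambda> \<le> weight \<gamma> v * \<gamma> v \<and>
     (\<forall>j. snd v = Suc j \<longrightarrow> 16 * weight \<gamma> (fst v, j) \<le> \<gamma> (fst v, j) * (weight \<gamma> v * \<gamma> v)) \<and>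
     (\<exists>M. coupling_bound \<gamma> v M \<and>
        16 * card V * weight \<gamma> v * M\<^sup>2 * (\<Sum>u\<in>earlier v. 1 / (weight \<gamma> u * \<gamma> u)) \<le> \<gamma> v))"

lemma admissible_pos: "admissible v \<gamma> \<Longrightarrow> 0 < \<gamma> v"
  using \<epsilon> by (auto simp: admissible_def split: if_splits)

lemma weight_pos:
  assumes "\<And>r. r < snd v \<Longrightarrow> 0 \<le> \<gamma> (fst v, r)"
  shows "0 < weight \<gamma> v"
proof -
  define P where "P = (\<Prod>r<snd v. 1 + \<gamma> (fst v, r))"
  have "0 < P"
    unfolding P_def using assms by (intro prod_pos) (auto intro: add_pos_nonneg)
  then show ?thesis using C \<epsilon> by (simp add: weight_def flip: P_def)
qed

lemma earlier_same_chain: "r < snd v \<Longrightarrow> v \<in> V \<Longrightarrow> (fst v, r) \<in> earlier v"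
  using pos_strict_mono[of r "snd v" "fst v"] by (auto simp: earlier_def mem_V)

section \<open>Weights, errors and couplings as functions of the preceding gains\<close>

lemma weight_cong:
  assumes "\<And>u. u \<in> earlier v \<Longrightarrow> \<gamma> u = \<gamma>' u" "v \<in> V"
  shows "weight \<gamma> v = weight \<gamma>' v"
proof -
  have "(\<Prod>r<snd v. 1 + \<gamma> (fst v, r)) = (\<Prod>r<snd v. 1 + \<gamma>' (fst v, r))"
    using assms earlier_same_chain by (intro prod.cong) auto
  then show ?thesis by (simp add: weight_def)
qed

lemma err_cong:
  assumes "\<And>u. u \<in> earlier v \<Longrightarrow> \<gamma> u = \<gamma>' u" "v \<in> V"
  shows "err \<gamma> \<xi> v = err \<gamma>' \<xi> v"
  unfolding err_def using assms earlier_same_chain by (intro filt_cong) auto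

lemma earlier_trans: "u \<in> V \<Longrightarrow> pos u \<le> pos v \<Longrightarrow> earlier u \<subseteq> earlier v"
  by (auto simp: earlier_def)

text \<open>Allows \<open>M\<close> to be fixed before the gain of \<open>v\<close>: an input with
  nonzero coefficient belongs to a chain that lies wholly before \<open>v\<close>.\<close>

lemma coupling_bound_cong:
  assumes agree: "\<And>u. u \<in> earlier v \<Longrightarrow> \<gamma> u = \<gamma>' u" and v: "v \<in> V" and bound: "coupling_bound \<gamma> v M"
  shows "coupling_bound \<gamma>' v M"
  unfolding coupling_bound_def
proof (intro allI impI)
  fix \<eta> \<xi> assume conf: "confined_up_to \<gamma>' v \<eta> \<xi>"
  have err: "err \<gamma> \<xi> u = err \<gamma>' \<xi> u" and weight: "weight \<gamma> u = weight \<gamma>' u"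
    if "u \<in> V" "pos u \<le> pos v" for u
    using earlier_trans[OF that] agree that(1) by (auto intro!: err_cong weight_cong)
  have "confined_up_to \<gamma> v \<eta> \<xi>"
    using conf by (simp add: confined_up_to_def err weight)
  then have 1: "\<bar>filt (\<lambda>r. \<gamma> (fst v, r)) (snd v) (coupling \<gamma> \<eta> \<xi> (fst v))\<bar>
      \<le> M * (\<Sum>u\<in>earlier v. \<bar>err \<gamma> \<xi> u\<bar>)"
    using bound by (simp add: coupling_bound_def)
  have 2: "(\<Sum>u\<in>earlier v. \<bar>err \<gamma> \<xi> u\<bar>) = (\<Sum>u\<in>earlier v. \<bar>err \<gamma>' \<xi> u\<bar>)"
    using err by (intro sum.cong) (auto simp: earlier_def)
  have "coupling \<gamma> \<eta> \<xi> (fst v) r = coupling \<gamma>' \<eta> \<xi> (fst v) r" if r: "r \<le> snd v" for r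
  proof (cases "Suc r < q (fst v)")
    case True
    have "\<delta> (fst v) (Suc r) l \<eta> \<xi> * feedback \<gamma> \<xi> $ l = \<delta> (fst v) (Suc r) l \<eta> \<xi> * feedback \<gamma>' \<xi> $ l"
      if l: "l < fst v" for l
    \<comment> \<open>Where the coefficient vanishes, the two inputs may differ without
      effect.\<close>
    proof (cases "\<delta> (fst v) (Suc r) l \<eta> \<xi> = 0")
      case False
      have "(l, m) \<in> earlier v" if "m < q l" for m
        using pos_input[OF True l False that] pos_mono[of r "snd v" "fst v"] r v that
        by (auto simp: earlier_def mem_V)
      then have "feedback \<gamma> \<xi> $ l = feedback \<gamma>' \<xi> $ l"
        unfolding feedback_def using agree by (simp cong: filt_cong)
      then show ?thesis by simp
    qed simp
    then show ?thesis unfolding coupling_def by (auto intro!: sum.cong)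
  qed (simp add: coupling_def)
  then have "filt (\<lambda>r. \<gamma> (fst v, r)) (snd v) (coupling \<gamma> \<eta> \<xi> (fst v))
      = filt (\<lambda>r. \<gamma>' (fst v, r)) (snd v) (coupling \<gamma>' \<eta> \<xi> (fst v))"
    using agree earlier_same_chain[OF _ v] by (intro filt_cong) auto
  then show "\<bar>filt (\<lambda>r. \<gamma>' (fst v, r)) (snd v) (coupling \<gamma>' \<eta> \<xi> (fst v))\<bar>
      \<le> M * (\<Sum>u\<in>earlier v. \<bar>err \<gamma>' \<xi> u\<bar>)"
    using 1 2 by simp
qed

lemma admissible_cong:
  assumes agree: "\<And>u. u \<in> V \<Longrightarrow> pos u \<le> pos v \<Longrightarrow> \<gamma> u = \<gamma>' u" and v: "v \<in> V" and adm: "admissible v \<gamma>"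
  shows "admissible v \<gamma>'"
proof -
  have eq: "\<gamma> u = \<gamma>' u" if "u \<in> earlier v" for u using agree that by (auto simp: earlier_def)
  have w: "weight \<gamma> u = weight \<gamma>' u" if "u \<in> V" "pos u \<le> pos v" for u
    using earlier_trans[OF that] eq that(1) by (auto intro!: weight_cong)
  have "\<gamma> v = \<gamma>' v" "weight \<gamma> v = weight \<gamma>' v" using agree w v by auto
  moreover have "\<gamma> (fst v, j) = \<gamma>' (fst v, j)" "weight \<gamma> (fst v, j) = weight \<gamma>' (fst v, j)"
    if "snd v = Suc j" for j
    using earlier_same_chain[of j v] that v eq w by (auto simp: earlier_def)
  moreover have "(\<Sum>u\<in>earlier v. 1 / (weight \<gamma> u * \<gamma> u)) = (\<Sum>u\<in>earlier v. 1 / (weight \<gamma>' u * \<gamma>' u))"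
    using w eq by (intro sum.cong) (auto simp: earlier_def)
  moreover have "coupling_bound \<gamma>' v M" if "coupling_bound \<gamma> v M" for M
    using coupling_bound_cong[OF eq v that] .
  ultimately show ?thesis
    using adm unfolding admissible_def by (auto split: if_splits)
qed

text \<open>The weights bound the errors, and inverting the filters bounds the variables. The
  constant involves current values of gains that are chosen later;
  \<open>coupling_bound_cong\<close> shows that this does no harm.\<close>

lemma confined_state_bound:
  assumes v: "v \<in> V" and \<gamma>: "\<And>u. u \<in> earlier v \<Longrightarrow> 0 \<le> \<gamma> u"
  shows "\<exists>X\<ge>0. \<forall>\<eta> \<xi>. confined_up_to \<gamma> v \<eta> \<xi> \<longrightarrow>
    (\<forall>u\<in>V. pos u \<le> pos v \<longrightarrow> \<bar>state \<xi> (fst u) (snd u)\<bar> \<le> X)"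
proof -
  define A where "A u = (1 + (\<Sum>m<q (fst u). \<bar>\<gamma> (fst u, m)\<bar>)) ^ snd u" for u :: "'m \<times> nat"
  have A0: "0 \<le> A u" for u
    unfolding A_def by (intro zero_le_power add_nonneg_nonneg sum_nonneg) auto
  define B where "B u = A u * (\<Sum>m\<le>snd u. \<bar>sqrt (b / weight \<gamma> (fst u, m))\<bar>)" for u
  have B0: "0 \<le> B u" for u
    unfolding B_def using A0 by (intro mult_nonneg_nonneg sum_nonneg) auto
  have "\<bar>state \<xi> (fst u) (snd u)\<bar> \<le> sum B V"
    if conf: "confined_up_to \<gamma> v \<eta> \<xi>" and u: "u \<in> V" "pos u \<le> pos v" for \<eta> \<xi> u
  proof -
    have "\<bar>state \<xi> (fst u) (snd u)\<bar> \<le> A u * (\<Sum>m\<le>snd u. \<bar>err \<gamma> \<xi> (fst u, m)\<bar>)"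
      unfolding A_def using u(1) by (intro state_bound) (simp add: mem_V)
    also have "\<dots> \<le> B u"
      unfolding B_def
    proof (intro mult_left_mono sum_mono A0)
      fix m assume "m \<in> {..snd u}"
      define u' where "u' = (fst u, m)"
      have u': "u' \<in> V" "pos u' \<le> pos v"
        using \<open>m \<in> {..snd u}\<close> u pos_mono[of m "snd u" "fst u"] by (auto simp: mem_V u'_def)
      have "0 \<le> \<gamma> (fst u', r)" if "r < snd u'" for r
        using \<gamma> earlier_same_chain[OF that u'(1)] earlier_trans[OF u'] by blast
      then have w: "0 < weight \<gamma> u'" by (rule weight_pos)
      have "weight \<gamma> u' * (err \<gamma> \<xi> u')\<^sup>2 \<le> b"
        using conf u' by (simp add: confined_up_to_def)
      then have "(err \<gamma> \<xi> u')\<^sup>2 \<le> b / weight \<gamma> u'"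
        using w by (simp add: pos_le_divide_eq mult.commute)
      then have "\<bar>err \<gamma> \<xi> u'\<bar> \<le> sqrt (b / weight \<gamma> u')"
        by (intro real_le_rsqrt) simp
      then show "\<bar>err \<gamma> \<xi> (fst u, m)\<bar> \<le> \<bar>sqrt (b / weight \<gamma> (fst u, m))\<bar>"
        unfolding u'_def by linarith
    qed
    also have "\<dots> \<le> sum B V"
      using u(1) finite_V B0 by (intro member_le_sum) auto
    finally show ?thesis .
  qed
  moreover have "0 \<le> sum B V" using B0 by (rule sum_nonneg)
  ultimately show ?thesis by blast
qed

text \<open>The bound on \<open>\<delta>\<close> is taken at a point where irrelevant coordinates
  are set to 0; the others are heads, bounded by \<open>Y\<close>, or come no later than
  \<open>v\<close>, bounded by \<open>X\<close>. The inputs are bounded by errors of chains that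
  precede \<open>v\<close>.\<close>

lemma coupling_bound_exists:
  assumes v: "v \<in> V" and \<gamma>: "\<And>u. u \<in> earlier v \<Longrightarrow> 0 \<le> \<gamma> u"
  shows "\<exists>M. coupling_bound \<gamma> v M"
proof -
  obtain i j where ij: "v = (i, j)" by (cases v)
  have j: "j < q i" using v ij by (simp add: mem_V)
  have "\<exists>X\<ge>0. \<forall>\<eta> \<xi>. confined_up_to \<gamma> v \<eta> \<xi> \<longrightarrow>
      (\<forall>u\<in>V. pos u \<le> pos v \<longrightarrow> \<bar>state \<xi> (fst u) (snd u)\<bar> \<le> X)"
    using v by (rule confined_state_bound) (rule \<gamma>)
  then obtain X where "X \<ge> 0" and X': "\<forall>\<eta> \<xi>. confined_up_to \<gamma> v \<eta> \<xi> \<longrightarrow>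
      (\<forall>u\<in>V. pos u \<le> pos v \<longrightarrow> \<bar>state \<xi> (fst u) (snd u)\<bar> \<le> X)"
    by (elim exE conjE)
  have X: "\<bar>state \<xi> i' r\<bar> \<le> X"
    if "confined_up_to \<gamma> v \<eta> \<xi>" "r < q i'" "pos (i', r) \<le> pos v" for \<eta> \<xi> i' r
    using X'[rule_format, of \<eta> \<xi> "(i', r)"] that by (simp add: mem_V)
  have "\<exists>D\<ge>0. \<forall>\<eta> \<xi>. confined_up_to \<gamma> v \<eta> \<xi> \<longrightarrow> \<bar>\<delta> i (Suc r) l \<eta> \<xi>\<bar> \<le> D"
    if r: "Suc r < q i" "r \<le> j" and l: "l < i" for r l
  proof -
    define I where "I = {(r, 1::nat) |r::'m. True} \<union>
        {(i', Suc j') |i' j'. j' < q i' \<and> pos (i', j') \<le> pos (i, r)}"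
    obtain D where D: "D \<ge> 0" "\<forall>x\<in>cball 0 (R + CARD('k) * (X + \<bar>Y\<bar>)). norm (case x of (\<eta>, \<xi>) \<Rightarrow> \<delta> i (Suc r) l \<eta> \<xi>) \<le> D"
      using lipschitz_on_bounded_bound[OF \<delta>_lipschitz[OF r(1) l]] by blast
    have "\<bar>\<delta> i (Suc r) l \<eta> \<xi>\<bar> \<le> D" if conf: "confined_up_to \<gamma> v \<eta> \<xi>" for \<eta> \<xi>
    proof -
      define \<xi>' :: "real ^ 'k" where "\<xi>' = (\<chi> k. if k \<in> var ` I then \<xi> $ k else 0)"
      have "\<delta> i (Suc r) l \<eta> \<xi> = \<delta> i (Suc r) l \<eta> \<xi>'"
        using pos_depends[OF r(1) l] unfolding depends_only_on_def I_def[symmetric]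
        by (auto simp: \<xi>'_def)
      moreover have "norm \<xi>' \<le> CARD('k) * (X + \<bar>Y\<bar>)"
      proof -
        have "\<bar>\<xi>' $ k\<bar> \<le> X + \<bar>Y\<bar>" for k
        proof (cases "k \<in> var ` I")
          case True
          then obtain p where p: "p \<in> I" "k = var p" by blast
          show ?thesis
          proof (cases "\<exists>i'. p = (i', 1)")
            case True
            then obtain i' where "p = (i', 1)" by blast
            then have "\<xi>' $ k = state \<xi> i' 0"
              using p \<open>k \<in> var ` I\<close> q_pos[of i'] by (simp add: \<xi>'_def state_def)
            then show ?thesis
              using conf \<open>X \<ge> 0\<close> by (auto simp: confined_up_to_def intro: order_trans)
          next
            case False
            then obtain i' j' where p': "p = (i', Suc j')" "j' < q i'" "pos (i', j') \<le> pos (i, r)"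
              using p(1) by (auto simp: I_def)
            moreover have "pos (i, r) \<le> pos v"
              using pos_mono[OF r(2) j] by (simp add: ij)
            ultimately have "\<bar>state \<xi> i' j'\<bar> \<le> X"
              using X[OF conf] by simp
            then show ?thesis
              using p p' \<open>k \<in> var ` I\<close> by (simp add: \<xi>'_def state_def)
          qed
        next
          case False
          then show ?thesis using \<open>X \<ge> 0\<close> by (simp add: \<xi>'_def)
        qed
        then have "(\<Sum>k\<in>UNIV. \<bar>\<xi>' $ k\<bar>) \<le> CARD('k) * (X + \<bar>Y\<bar>)"
          by (intro sum_bounded_above) auto
        then show ?thesis using norm_le_l1_cart[of \<xi>'] by linarith
      qed
      moreover have "norm \<eta> \<le> R" using conf by (simp add: confined_up_to_def)
      ultimately have "norm (\<eta>, \<xi>') \<le> R + CARD('k) * (X + \<bar>Y\<bar>)"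
        using norm_Pair_le[where x=\<eta> and y=\<xi>'] by linarith
      then have "(\<eta>, \<xi>') \<in> cball 0 (R + CARD('k) * (X + \<bar>Y\<bar>))"
        by simp
      from D(2)[rule_format, OF this] show ?thesis
        using \<open>\<delta> i (Suc r) l \<eta> \<xi> = \<delta> i (Suc r) l \<eta> \<xi>'\<close> by simp
    qed
    then show ?thesis using D(1) by blast
  qed
  then obtain D where D: "\<And>r l. Suc r < q i \<Longrightarrow> r \<le> j \<Longrightarrow> l < i \<Longrightarrow> 0 \<le> D r l"
    "\<And>r l \<eta> \<xi>. Suc r < q i \<Longrightarrow> r \<le> j \<Longrightarrow> l < i \<Longrightarrow> confined_up_to \<gamma> v \<eta> \<xi> \<Longrightarrow> \<bar>\<delta> i (Suc r) l \<eta> \<xi>\<bar> \<le> D r l"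
    by metis
  obtain B where B: "\<And>l. 0 \<le> B l"
    "\<And>l \<xi>. \<bar>feedback \<gamma> \<xi> $ l\<bar> \<le> B l * (\<Sum>m<q l. \<bar>err \<gamma> \<xi> (l, m)\<bar>)"
    using feedback_bound[of \<gamma>] by metis
  define M0 where "M0 = (\<Sum>r\<le>j. \<Sum>l | l < i. \<bar>D r l\<bar> * B l)"
  define P where "P = (\<Prod>r<j. 1 + \<gamma> (i, r))"
  have "coupling_bound \<gamma> v (M0 * P)"
    unfolding coupling_bound_def
  proof (intro allI impI)
    fix \<eta> \<xi> assume conf: "confined_up_to \<gamma> v \<eta> \<xi>"
    define S where "S = (\<Sum>u\<in>earlier v. \<bar>err \<gamma> \<xi> u\<bar>)"
    have S0: "0 \<le> S" by (simp add: S_def sum_nonneg)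
    have "\<bar>coupling \<gamma> \<eta> \<xi> i r\<bar> \<le> M0 * S" if r: "r \<le> j" for r
    proof (cases "Suc r < q i")
      case True
      have "\<bar>\<delta> i (Suc r) l \<eta> \<xi> * feedback \<gamma> \<xi> $ l\<bar> \<le> \<bar>D r l\<bar> * B l * S" if l: "l < i" for l
      proof (cases "\<delta> i (Suc r) l \<eta> \<xi> = 0")
        case False
        have "(l, m) \<in> earlier v" if "m < q l" for m
          using pos_input[OF True l False that] pos_mono[OF r j] that
          by (auto simp: earlier_def mem_V ij)
        then have "(\<Sum>u\<in>Pair l ` {..<q l}. \<bar>err \<gamma> \<xi> u\<bar>) \<le> S"
          unfolding S_def using finite_V by (intro sum_mono2) (auto simp: earlier_def)
        moreover have "(\<Sum>u\<in>Pair l ` {..<q l}. \<bar>err \<gamma> \<xi> u\<bar>) = (\<Sum>m<q l. \<bar>err \<gamma> \<xi> (l, m)\<bar>)"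
          by (subst sum.reindex) (auto simp: inj_on_def)
        ultimately have "B l * (\<Sum>m<q l. \<bar>err \<gamma> \<xi> (l, m)\<bar>) \<le> B l * S"
          using B(1) by (intro mult_left_mono) auto
        then have fb: "\<bar>feedback \<gamma> \<xi> $ l\<bar> \<le> B l * S"
          using B(2)[of \<xi> l] by linarith
        have "\<bar>\<delta> i (Suc r) l \<eta> \<xi>\<bar> \<le> \<bar>D r l\<bar>"
          using D(2)[OF True r l conf] by linarith
        then show ?thesis
          unfolding abs_mult mult.assoc using fb by (rule mult_mono) auto
      qed (use B(1) S0 in simp)
      then have "\<bar>coupling \<gamma> \<eta> \<xi> i r\<bar> \<le> (\<Sum>l | l < i. \<bar>D r l\<bar> * B l * S)"
        using True by (simp add: coupling_def) (intro sum_abs[THEN order_trans] sum_mono, simp)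
      also have "\<dots> = (\<Sum>l | l < i. \<bar>D r l\<bar> * B l) * S"
        by (simp add: sum_distrib_right)
      also have "\<dots> \<le> M0 * S"
        unfolding M0_def using r S0 B(1)
        by (intro mult_right_mono member_le_sum) (auto intro!: sum_nonneg)
      finally show ?thesis .
    next
      case False
      have "0 \<le> M0" unfolding M0_def using B(1) by (intro sum_nonneg) auto
      then show ?thesis using False S0 by (simp add: coupling_def)
    qed
    moreover have "0 \<le> \<gamma> (i, r)" if "r < j" for r
      using \<gamma> earlier_same_chain[of r v] that v by (simp add: ij)
    ultimately have "\<bar>filt (\<lambda>r. \<gamma> (i, r)) j (coupling \<gamma> \<eta> \<xi> i)\<bar> \<le> M0 * S * P"
      unfolding P_def by (intro filt_bound) auto
    then show "\<bar>filt (\<lambda>r. \<gamma> (fst v, r)) (snd v) (coupling \<gamma> \<eta> \<xi> (fst v))\<bar>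
        \<le> M0 * P * (\<Sum>u\<in>earlier v. \<bar>err \<gamma> \<xi> u\<bar>)"
      by (simp add: ij S_def mult_ac)
  qed
  then show ?thesis by blast
qed

text \<open>None of the lower bounds involves the gain of \<open>v\<close> itself: the weight of
  \<open>v\<close>, the coupling bound and the sum over \<open>earlier v\<close> use preceding
  gains.\<close>

lemma admissible_exists: "\<exists>\<gamma>. \<forall>v\<in>V. admissible v \<gamma>"
proof (rule sequential_choice[where pos=pos])
  show "finite V" by (rule finite_V)
  show "inj_on pos V" unfolding V_def by (rule pos_inj)
  show "admissible v g'" if "v \<in> V" "\<And>u. u \<in> V \<Longrightarrow> pos u \<le> pos v \<Longrightarrow> g u = g' u" "admissible v g" for v g g'
    using admissible_cong[OF that(2,1,3)] .
  fix v \<gamma> assume v: "v \<in> V" and adm: "\<And>u. u \<in> V \<Longrightarrow> pos u < pos v \<Longrightarrow> admissible u \<gamma>"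
  have \<gamma>: "0 < \<gamma> u" if "u \<in> earlier v" for u
    using admissible_pos adm that by (auto simp: earlier_def)
  show "\<exists>x. admissible v (\<gamma>(v := x))"
  proof (cases "low v")
    case True
    then show ?thesis by (intro exI[of _ \<epsilon>]) (simp add: admissible_def)
  next
    case False
    obtain M where M: "coupling_bound \<gamma> v M"
      using coupling_bound_exists[OF v] \<gamma> less_imp_le by blast
    have w: "0 < weight \<gamma> v"
      using \<gamma> earlier_same_chain[OF _ v] by (intro weight_pos) (simp add: less_imp_le)
    define x1 where "x1 = \<Lambda> / weight \<gamma> v"
    define x2 where "x2 j = 16 * weight \<gamma> (fst v, j) / (\<gamma> (fst v, j) * weight \<gamma> v)" for j
    define x3 where "x3 = 16 * card V * weight \<gamma> v * M\<^sup>2 * (\<Sum>u\<in>earlier v. 1 / (weight \<gamma> u * \<gamma> u))"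
    \<comment> \<open>Exceeds all lower bounds at once. \<open>snd v - 1\<close> is the predecessor;
      at the head of a chain the subtraction truncates and the term is a harmless default.\<close>
    define x where "x = 1 + \<bar>x1\<bar> + \<bar>x2 (snd v - 1)\<bar> + \<bar>x3\<bar>"
    define \<gamma>' where "\<gamma>' = \<gamma>(v := x)"
    have \<gamma>'v: "\<gamma>' v = x" by (simp add: \<gamma>'_def)
    have eq: "\<gamma> u = \<gamma>' u" if "u \<in> earlier v" for u
      using that by (auto simp: earlier_def \<gamma>'_def)
    have weq: "weight \<gamma>' u = weight \<gamma> u" if "u \<in> V" "pos u \<le> pos v" for u
      using earlier_trans[OF that] eq that(1) by (intro weight_cong[symmetric]) auto
    have "1 \<le> \<gamma>' v" unfolding \<gamma>'v x_def by linarith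
    moreover have "\<Lambda> \<le> weight \<gamma>' v * \<gamma>' v"
    proof -
      have "x1 \<le> x" unfolding x_def by linarith
      then show ?thesis
        using w by (simp add: \<gamma>'v weq v x1_def pos_divide_le_eq mult.commute)
    qed
    moreover have "16 * weight \<gamma>' (fst v, j) \<le> \<gamma>' (fst v, j) * (weight \<gamma>' v * \<gamma>' v)"
      if "snd v = Suc j" for j
    proof -
      have e: "(fst v, j) \<in> earlier v" using earlier_same_chain[of j v] that v by simp
      then have e': "(fst v, j) \<in> V" "pos (fst v, j) \<le> pos v" by (auto simp: earlier_def)
      have "x2 j \<le> x" unfolding x_def using that by simp
      then have "16 * weight \<gamma> (fst v, j) \<le> x * (\<gamma> (fst v, j) * weight \<gamma> v)"
        using w \<gamma>[OF e] unfolding x2_def by (subst (asm) pos_divide_le_eq) auto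
      then show ?thesis
        using weq[OF e'] weq[OF v] eq[OF e] by (simp add: \<gamma>'v mult_ac)
    qed
    moreover have "coupling_bound \<gamma>' v M"
      using coupling_bound_cong[OF eq v M] .
    moreover have "16 * card V * weight \<gamma>' v * M\<^sup>2 * (\<Sum>u\<in>earlier v. 1 / (weight \<gamma>' u * \<gamma>' u)) \<le> \<gamma>' v"
    proof -
      have "(\<Sum>u\<in>earlier v. 1 / (weight \<gamma>' u * \<gamma>' u)) = (\<Sum>u\<in>earlier v. 1 / (weight \<gamma> u * \<gamma> u))"
        using weq eq by (intro sum.cong) (auto simp: earlier_def)
      then have "16 * card V * weight \<gamma>' v * M\<^sup>2 * (\<Sum>u\<in>earlier v. 1 / (weight \<gamma>' u * \<gamma>' u)) = x3"
        using weq[OF v] by (simp add: x3_def)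
      then show ?thesis unfolding \<gamma>'v x_def by linarith
    qed
    ultimately have "admissible v \<gamma>'"
      using False unfolding admissible_def by auto
    then show ?thesis unfolding \<gamma>'_def by blast
  qed
qed

end

section \<open>The Lyapunov function of the chains\<close>

context chain_design
begin

definition W :: "('m \<times> nat \<Rightarrow> real) \<Rightarrow> real ^ 'k \<Rightarrow> real" where
  "W \<gamma> \<xi> = (\<Sum>v\<in>V. weight \<gamma> v * (err \<gamma> \<xi> v)\<^sup>2)"

definition dW :: "('m \<times> nat \<Rightarrow> real) \<Rightarrow> real ^ 'k \<Rightarrow> real ^ 'k \<Rightarrow> real" where
  "dW \<gamma> \<xi> h = (\<Sum>v\<in>V. 2 * weight \<gamma> v * err \<gamma> \<xi> v * err \<gamma> h v)"

text \<open>On the level \<open>b\<close> this bounds the first high errors and the scaled low ones,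
  and it contains neither \<open>\<epsilon>\<close> nor a gain. The factor \<open>4 ^ Q\<close>
  undoes the divisor 4 in the low weights.\<close>

definition K :: real where "K = sqrt b * (C * 2 ^ Q * 4 ^ Q)"

lemma W_has_derivative: "(W \<gamma> has_derivative dW \<gamma> \<xi>) (at \<xi>)"
proof -
  have "((\<lambda>\<xi>. err \<gamma> \<xi> v) has_derivative (\<lambda>h. err \<gamma> h v)) (at \<xi>)" for v
    using err_linear by (rule bounded_linear_imp_has_derivative)
  then show ?thesis
    unfolding W_def[abs_def] dW_def[abs_def]
    by (auto intro!: derivative_eq_intros sum.cong simp: mult_ac)
qed

lemma W_0: "W \<gamma> 0 = 0"
  using linear_simps(3)[OF err_linear] by (simp add: W_def)

lemma K_nonneg: "0 \<le> K"
  using C b by (simp add: K_def)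

lemma square_bound:
  fixes w e :: real
  assumes "0 < w" "(e / w)\<^sup>2 \<le> b"
  shows "\<bar>e\<bar> \<le> sqrt b * w"
proof -
  have "\<bar>e / w\<bar> \<le> sqrt b"
    using assms(2) by (intro real_le_rsqrt) (simp only: power2_abs)
  then show ?thesis using assms(1) by (simp add: pos_divide_le_eq)
qed

context
  fixes \<gamma> :: "'m \<times> nat \<Rightarrow> real"
  assumes adm: "\<And>v. v \<in> V \<Longrightarrow> admissible v \<gamma>"
begin

section \<open>Estimates on a sublevel set of the Lyapunov function\<close>

lemma gain_pos: "v \<in> V \<Longrightarrow> 0 < \<gamma> v"
  using adm admissible_pos by blast

lemma gain_nonneg: "v \<in> V \<Longrightarrow> r \<le> snd v \<Longrightarrow> 0 \<le> \<gamma> (fst v, r)"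
  using gain_pos[of "(fst v, r)"] by (simp add: mem_V)

lemma weight_pos': "v \<in> V \<Longrightarrow> 0 < weight \<gamma> v"
  using gain_nonneg by (intro weight_pos) auto

lemma gain_low: "Suc r < ell i \<Longrightarrow> \<gamma> (i, r) = \<epsilon>"
  using adm[of "(i, r)"] ell(2)[of i] by (simp add: mem_V admissible_def low_def)

lemma prod_low_le: "j \<le> ell i - 1 \<Longrightarrow> (\<Prod>r<j. 1 + \<gamma> (i, r)) \<le> 2 ^ Q"
proof -
  assume j: "j \<le> ell i - 1"
  have "(\<Prod>r<j. 1 + \<gamma> (i, r)) \<le> (\<Prod>r<j. 2)"
    using j gain_low[of _ i] \<epsilon> by (intro prod_mono) auto
  also have "\<dots> \<le> 2 ^ Q"
    using j ell(2)[of i] q_le_Q[of i] by (simp add: power_increasing)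
  finally show ?thesis .
qed

text \<open>The purpose of the weights: the initial level does not depend on the gains, so that the
  region in which they must work is fixed in advance.\<close>

lemma W_initial:
  assumes "norm \<xi> \<le> C"
  shows "W \<gamma> \<xi> \<le> card V"
proof -
  have "weight \<gamma> v * (err \<gamma> \<xi> v)\<^sup>2 \<le> 1" if v: "v \<in> V" for v
  proof -
    define P where "P = (\<Prod>r<snd v. 1 + \<gamma> (fst v, r))"
    have P: "0 < P"
      unfolding P_def using gain_nonneg[OF v] by (intro prod_pos) (auto intro: add_pos_nonneg)
    have "\<bar>state \<xi> (fst v) r\<bar> \<le> C" for r
      using assms C component_le_norm_cart[of \<xi> "var (fst v, Suc r)"] by (simp add: state_def)
    then have e: "\<bar>err \<gamma> \<xi> v\<bar> \<le> C * P"
      unfolding err_def P_def using gain_nonneg[OF v] by (intro filt_bound) auto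
    show ?thesis
    proof (cases "low v")
      case True
      have "P \<le> 2 ^ Q"
        unfolding P_def using True by (intro prod_low_le) (simp add: low_def)
      then have "C * P \<le> C * 2 ^ Q" using C by simp
      with e have "\<bar>err \<gamma> \<xi> v\<bar> \<le> C * 2 ^ Q" by linarith
      then have "(err \<gamma> \<xi> v)\<^sup>2 \<le> (C * 2 ^ Q)\<^sup>2"
        by (metis abs_ge_zero power2_abs power_mono)
      then have "(err \<gamma> \<xi> v)\<^sup>2 / (C * 2 ^ Q)\<^sup>2 \<le> 1"
        using C by simp
      moreover have "(\<epsilon> / 4) ^ (2 * (ell (fst v) - 1 - 1 - snd v)) \<le> 1"
        using \<epsilon> by (intro power_le_one) auto
      ultimately have "(\<epsilon> / 4) ^ (2 * (ell (fst v) - 1 - 1 - snd v)) * ((err \<gamma> \<xi> v)\<^sup>2 / (C * 2 ^ Q)\<^sup>2) \<le> 1 * 1"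
        using \<epsilon> by (intro mult_mono) auto
      then show ?thesis using True by (simp add: weight_def)
    next
      case False
      have "(err \<gamma> \<xi> v)\<^sup>2 \<le> (C * P)\<^sup>2"
        using e by (metis abs_ge_zero power2_abs power_mono)
      then show ?thesis using False C P by (simp add: weight_def flip: P_def)
    qed
  qed
  then have "W \<gamma> \<xi> \<le> (\<Sum>v\<in>V. 1)"
    unfolding W_def by (rule sum_mono)
  then show ?thesis by simp
qed

lemma term_le_W: "v \<in> V \<Longrightarrow> weight \<gamma> v * (err \<gamma> \<xi> v)\<^sup>2 \<le> W \<gamma> \<xi>"
  unfolding W_def using finite_V weight_pos' by (intro member_le_sum) (auto simp: less_imp_le)

text \<open>The growth in 1/\<epsilon> that the low weights permit is exactly the one that
  \<open>filt_low_gain\<close> admits.\<close>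

lemma err_low_bound:
  assumes v: "v \<in> V" and "low v" and W: "W \<gamma> \<xi> \<le> b"
  shows "\<bar>err \<gamma> \<xi> v\<bar> * \<epsilon> ^ (ell (fst v) - 1 - 1 - snd v) \<le> K"
proof -
  define n where "n = ell (fst v) - 1 - 1 - snd v"
  have n: "n \<le> Q" using ell(2)[of "fst v"] q_le_Q[of "fst v"] by (simp add: n_def)
  have "((\<epsilon> / 4) ^ n * err \<gamma> \<xi> v / (C * 2 ^ Q))\<^sup>2 \<le> b"
    using term_le_W[OF v, of \<xi>] W \<open>low v\<close>
    by (simp add: weight_def n_def power_mult_distrib power_divide power_mult[symmetric] mult.commute[of _ 2])
  then have "\<bar>(\<epsilon> / 4) ^ n * err \<gamma> \<xi> v\<bar> \<le> sqrt b * (C * 2 ^ Q)"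
    using C by (intro square_bound) auto
  then have "\<bar>(\<epsilon> / 4) ^ n * err \<gamma> \<xi> v\<bar> * 4 ^ n \<le> sqrt b * (C * 2 ^ Q) * 4 ^ n"
    by (rule mult_right_mono) simp
  also have "\<dots> \<le> sqrt b * (C * 2 ^ Q) * 4 ^ Q"
    using n C b by (intro mult_left_mono power_increasing) auto
  also have "\<bar>(\<epsilon> / 4) ^ n * err \<gamma> \<xi> v\<bar> * 4 ^ n = \<bar>err \<gamma> \<xi> v\<bar> * \<epsilon> ^ n"
    using \<epsilon> by (simp add: abs_mult power_divide)
  finally show ?thesis by (simp add: n_def K_def mult_ac)
qed

lemma err_first_high_bound:
  assumes "ell i - 1 < q i" and W: "W \<gamma> \<xi> \<le> b"
  shows "\<bar>err \<gamma> \<xi> (i, ell i - 1)\<bar> \<le> K"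
proof -
  define P where "P = (\<Prod>r<ell i - 1. 1 + \<gamma> (i, r))"
  have v: "(i, ell i - 1) \<in> V" and "\<not> low (i, ell i - 1)"
    using assms(1) ell(1)[of i] by (auto simp: mem_V low_def)
  have P: "0 < P" "P \<le> 2 ^ Q"
    unfolding P_def using gain_nonneg[OF v] prod_low_le[of "ell i - 1" i]
    by (auto intro!: prod_pos intro: add_pos_nonneg)
  have "(err \<gamma> \<xi> (i, ell i - 1) / (C * P))\<^sup>2 \<le> b"
    using term_le_W[OF v, of \<xi>] W \<open>\<not> low (i, ell i - 1)\<close>
    by (simp add: weight_def power_divide P_def)
  then have "\<bar>err \<gamma> \<xi> (i, ell i - 1)\<bar> \<le> sqrt b * (C * P)"
    using C P by (intro square_bound) auto
  also have "\<dots> \<le> sqrt b * (C * 2 ^ Q * 4 ^ Q)"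
  proof (intro mult_left_mono)
    have "C * P \<le> C * 2 ^ Q" using P C by simp
    also have "\<dots> \<le> C * 2 ^ Q * 4 ^ Q" using C by simp
    finally show "C * P \<le> C * 2 ^ Q * 4 ^ Q" .
  qed (use b in simp)
  finally show ?thesis by (simp add: K_def)
qed

text \<open>Free of the high gains, so that it can serve as \<open>Y\<close> before they are
  chosen.\<close>

lemma head_bound:
  assumes W: "W \<gamma> \<xi> \<le> b"
  shows "\<bar>state \<xi> i 0\<bar> \<le> K / \<epsilon> ^ Q"
proof -
  have v: "(i, 0) \<in> V" using q_pos by (simp add: mem_V)
  have "\<bar>state \<xi> i 0\<bar> * \<epsilon> ^ Q \<le> K"
  proof (cases "low (i, 0)")
    case True
    have "ell i - 1 - 1 - 0 \<le> Q" using ell(2)[of i] q_le_Q[of i] by simp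
    then have "\<epsilon> ^ Q \<le> \<epsilon> ^ (ell i - 1 - 1 - 0)"
      using \<epsilon> by (intro power_decreasing) auto
    then have "\<bar>state \<xi> i 0\<bar> * \<epsilon> ^ Q \<le> \<bar>state \<xi> i 0\<bar> * \<epsilon> ^ (ell i - 1 - 1 - 0)"
      by (rule mult_left_mono) simp
    also have "\<dots> \<le> K"
      using err_low_bound[OF v True W] by (simp add: err_def)
    finally show ?thesis .
  next
    case False
    then have "ell i = 1" using ell(1)[of i] by (simp add: low_def)
    then have "\<bar>state \<xi> i 0\<bar> \<le> K"
      using err_first_high_bound[of i \<xi>] W q_pos[of i] by (simp add: err_def)
    moreover have "\<bar>state \<xi> i 0\<bar> * \<epsilon> ^ Q \<le> \<bar>state \<xi> i 0\<bar>"
      using \<epsilon> by (intro mult_left_le power_le_one) auto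
    ultimately show ?thesis by linarith
  qed
  then show ?thesis using \<epsilon> by (simp add: pos_le_divide_eq)
qed

text \<open>All gains below index \<open>ell i - 1\<close> are \<open>\<epsilon>\<close>, so
  \<open>filt_low_gain\<close> compares this entry with its filtered value, which is the first high
  error or, for \<open>ell i = q i + 1\<close>, is 0 by the choice of the feedback.\<close>

lemma zero_dynamics_input_bound:
  assumes W: "W \<gamma> \<xi> \<le> b"
  shows "\<bar>ext_state \<gamma> \<xi> i (ell i - 1)\<bar>
    \<le> (if ell i - 1 < q i then \<bar>err \<gamma> \<xi> (i, ell i - 1)\<bar> else 0) + 2 ^ Q * K * \<epsilon>"
proof -
  let ?p = "ell i - 1" and ?g = "\<lambda>r. \<gamma> (i, r)"
  have p: "?p \<le> q i" "?p \<le> Q" using ell(2)[of i] q_le_Q[of i] by auto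
  have "\<bar>ext_state \<gamma> \<xi> i ?p - filt ?g ?p (ext_state \<gamma> \<xi> i)\<bar> \<le> 2 ^ ?p * K * \<epsilon>"
  proof (rule filt_low_gain)
    fix m assume m: "m < ?p"
    then have v: "(i, m) \<in> V" "low (i, m)" using p by (auto simp: mem_V low_def)
    show "\<gamma> (i, m) = \<epsilon>" using m by (intro gain_low) simp
    show "\<bar>filt ?g m (ext_state \<gamma> \<xi> i)\<bar> * \<epsilon> ^ (?p - 1 - m) \<le> K"
      using err_low_bound[OF v W] m p by (simp add: err_def filt_ext_state)
  qed (use \<epsilon> K_nonneg in auto)
  also have "\<dots> \<le> 2 ^ Q * K * \<epsilon>"
    using p K_nonneg \<epsilon> by (intro mult_right_mono power_increasing) auto
  finally have "\<bar>ext_state \<gamma> \<xi> i ?p - filt ?g ?p (ext_state \<gamma> \<xi> i)\<bar> \<le> 2 ^ Q * K * \<epsilon>" .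
  moreover have "\<bar>filt ?g ?p (ext_state \<gamma> \<xi> i)\<bar> = (if ?p < q i then \<bar>err \<gamma> \<xi> (i, ?p)\<bar> else 0)"
    using p filt_ext_state_last[of \<gamma> i \<xi>] by (auto simp: err_def filt_ext_state)
  ultimately show ?thesis by linarith
qed

lemma dissipation:
  assumes Y: "K / \<epsilon> ^ Q \<le> Y" and \<eta>: "norm \<eta> \<le> R" and W: "W \<gamma> \<xi> \<le> b"
  shows "dW \<gamma> \<xi> (chain_field q var \<delta> \<eta> \<xi> (feedback \<gamma> \<xi>))
    \<le> - (\<Sum>v\<in>V. weight \<gamma> v * \<gamma> v * (err \<gamma> \<xi> v)\<^sup>2)"
proof -
  define s where "s v = (fst v, Suc (snd v))" for v :: "'m \<times> nat"
  define y where "y v = (if s v \<in> V then err \<gamma> \<xi> (s v) else 0)" for v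
  define z where "z v = filt (\<lambda>r. \<gamma> (fst v, r)) (snd v) (coupling \<gamma> \<eta> \<xi> (fst v))" for v
  have conf: "confined_up_to \<gamma> v \<eta> \<xi>" for v
    unfolding confined_up_to_def
    using \<eta> order_trans[OF head_bound[OF W] Y] order_trans[OF term_le_W W] by blast
  define dominated where "dominated v M \<longleftrightarrow> \<bar>z v\<bar> \<le> M * (\<Sum>u\<in>earlier v. \<bar>err \<gamma> \<xi> u\<bar>) \<and>
      16 * card V * weight \<gamma> v * M\<^sup>2 * (\<Sum>u\<in>earlier v. 1 / (weight \<gamma> u * \<gamma> u)) \<le> \<gamma> v" for v M
  have "\<exists>M. dominated v M"
    if v: "v \<in> V" for v
  proof (cases "low v")
    case True
    \<comment> \<open>No input acts on a low variable or on those before it in its chain.\<close>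
    have "coupling \<gamma> \<eta> \<xi> (fst v) r = 0" if "r \<le> snd v" for r
      using low_uncoupled[of r "fst v"] that True by (simp add: coupling_def low_def)
    then have "z v = filt (\<lambda>r. \<gamma> (fst v, r)) (snd v) (\<lambda>r. 0 * 0)"
      unfolding z_def by (intro filt_cong) auto
    then have "z v = 0" unfolding filt_scale by simp
    then show ?thesis
      using gain_pos[OF v] by (intro exI[of _ 0]) (simp add: dominated_def)
  next
    case False
    then obtain M where "coupling_bound \<gamma> v M"
      "16 * card V * weight \<gamma> v * M\<^sup>2 * (\<Sum>u\<in>earlier v. 1 / (weight \<gamma> u * \<gamma> u)) \<le> \<gamma> v"
      using adm[OF v] by (auto simp: admissible_def)
    then show ?thesis
      using conf unfolding coupling_bound_def z_def dominated_def by blast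
  qed
  then obtain M where M: "\<And>v. v \<in> V \<Longrightarrow> dominated v (M v)"
    by metis
  have upper: "16 * weight \<gamma> v \<le> \<gamma> v * (weight \<gamma> (s v) * \<gamma> (s v))"
    if v: "v \<in> V" "s v \<in> V" for v
  proof (cases "low (s v)")
    case True
    then have "low v" by (simp add: low_def s_def)
    define n where "n = ell (fst v) - Suc (Suc (Suc (snd v)))"
    have n: "ell (fst v) - Suc (Suc (snd v)) = Suc n"
      using True by (simp add: n_def low_def s_def)
    \<comment> \<open>With this ratio the required inequality is an equality, as
      \<open>(\<epsilon> / 4)\<^sup>2\<close> is \<open>\<epsilon>\<^sup>2 / 16\<close>. This is the
      origin of the 4 in \<open>weight\<close>.\<close>
    have "weight \<gamma> v = (\<epsilon> / 4)\<^sup>2 * weight \<gamma> (s v)"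
      using \<open>low v\<close> True n by (simp add: weight_def n_def[symmetric] s_def power2_eq_square)
    moreover have "\<gamma> v = \<epsilon>" "\<gamma> (s v) = \<epsilon>"
      using gain_low[of "snd v" "fst v"] gain_low[of "snd (s v)" "fst v"] \<open>low v\<close> True
      by (auto simp: low_def s_def)
    ultimately show ?thesis by (simp add: power2_eq_square mult_ac)
  next
    case False
    then show ?thesis
      using adm[OF v(2)] by (simp add: admissible_def s_def)
  qed
  have "dW \<gamma> \<xi> (chain_field q var \<delta> \<eta> \<xi> (feedback \<gamma> \<xi>))
      = (\<Sum>v\<in>V. 2 * weight \<gamma> v * err \<gamma> \<xi> v * (- \<gamma> v * err \<gamma> \<xi> v + y v + z v))"
    unfolding dW_def by (intro sum.cong refl) (simp add: err_chain_field y_def z_def s_def)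
  also have "\<dots> \<le> - (\<Sum>v\<in>V. weight \<gamma> v * \<gamma> v * (err \<gamma> \<xi> v)\<^sup>2)"
  proof (rule chain_dissipation[OF finite_V, where s=s and E=earlier and M=M])
    show "inj_on s V" by (auto simp: inj_on_def s_def prod_eq_iff)
    show "\<bar>y v\<bar> \<le> (if s v \<in> V then \<bar>err \<gamma> \<xi> (s v)\<bar> else 0)" for v by (simp add: y_def)
    show "earlier v \<subseteq> V" for v by (auto simp: earlier_def)
  qed (use weight_pos' gain_pos upper M in \<open>simp_all add: dominated_def\<close>)
  finally show ?thesis .
qed

text \<open>By \<open>state_bound\<close> the errors determine the state, so the quadratic form is
  definite.\<close>

lemma W_coercive: "\<exists>a>0. \<forall>\<xi>. a * (norm \<xi>)\<^sup>2 \<le> W \<gamma> \<xi>"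
proof -
  define A where "A = (\<Sum>u\<in>V. (1 + (\<Sum>m<q (fst u). \<bar>\<gamma> (fst u, m)\<bar>)) ^ snd u)"
  have term0: "0 \<le> (1 + (\<Sum>m<q (fst u). \<bar>\<gamma> (fst u, m)\<bar>)) ^ snd u" for u
    by (intro zero_le_power add_nonneg_nonneg sum_nonneg) auto
  have A0: "0 \<le> A" unfolding A_def using term0 by (rule sum_nonneg)
  define w where "w = Min (weight \<gamma> ` V)"
  have w: "0 < w" "\<And>v. v \<in> V \<Longrightarrow> w \<le> weight \<gamma> v"
    unfolding w_def using finite_V V_nonempty weight_pos' by auto
  define H where "H = (CARD('k) * A)\<^sup>2 * card V + 1"
  have H: "0 < H" unfolding H_def by (intro add_nonneg_pos) auto
  have "w / H * (norm \<xi>)\<^sup>2 \<le> W \<gamma> \<xi>" for \<xi>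
  proof -
    define S where "S = (\<Sum>v\<in>V. \<bar>err \<gamma> \<xi> v\<bar>)"
    define E where "E = (\<Sum>v\<in>V. (err \<gamma> \<xi> v)\<^sup>2)"
    have S0: "0 \<le> S" and E0: "0 \<le> E" by (simp_all add: S_def E_def sum_nonneg)
    have "\<bar>\<xi> $ k\<bar> \<le> A * S" for k
    proof -
      obtain i r where r: "r < q i" "k = var (i, Suc r)" by (rule var_cases)
      have "\<bar>state \<xi> i r\<bar> \<le> (1 + (\<Sum>m<q i. \<bar>\<gamma> (i, m)\<bar>)) ^ r * (\<Sum>m\<le>r. \<bar>err \<gamma> \<xi> (i, m)\<bar>)"
        using r(1) by (rule state_bound)
      also have "\<dots> \<le> A * S"
      proof (intro mult_mono)
        show "(1 + (\<Sum>m<q i. \<bar>\<gamma> (i, m)\<bar>)) ^ r \<le> A"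
          unfolding A_def
          using member_le_sum[of "(i, r)" V "\<lambda>u. (1 + (\<Sum>m<q (fst u). \<bar>\<gamma> (fst u, m)\<bar>)) ^ snd u"]
            r(1) term0 finite_V by (simp add: mem_V)
        have "(\<Sum>m\<le>r. \<bar>err \<gamma> \<xi> (i, m)\<bar>) = (\<Sum>u\<in>Pair i ` {..r}. \<bar>err \<gamma> \<xi> u\<bar>)"
          by (subst sum.reindex) (auto simp: inj_on_def)
        also have "\<dots> \<le> S"
          unfolding S_def using finite_V r(1) by (intro sum_mono2) (auto simp: mem_V)
        finally show "(\<Sum>m\<le>r. \<bar>err \<gamma> \<xi> (i, m)\<bar>) \<le> S" .
      qed (use A0 in \<open>auto intro: sum_nonneg\<close>)
      finally show ?thesis using r by (simp add: state_def)
    qed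
    then have "(\<Sum>k\<in>UNIV. \<bar>\<xi> $ k\<bar>) \<le> CARD('k) * (A * S)"
      by (intro sum_bounded_above) auto
    then have "norm \<xi> \<le> CARD('k) * A * S"
      using norm_le_l1_cart[of \<xi>] by simp
    then have "(norm \<xi>)\<^sup>2 \<le> (CARD('k) * A * S)\<^sup>2"
      by (rule power_mono) simp
    also have "\<dots> = (CARD('k) * A)\<^sup>2 * S\<^sup>2"
      by (simp add: power_mult_distrib)
    also have "\<dots> \<le> (CARD('k) * A)\<^sup>2 * (card V * E)"
    proof (rule mult_left_mono)
      show "S\<^sup>2 \<le> card V * E"
        using Cauchy_Schwarz_ineq_sum[of "\<lambda>_. 1" "\<lambda>v. \<bar>err \<gamma> \<xi> v\<bar>" V] by (simp add: S_def E_def)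
    qed simp
    also have "\<dots> \<le> H * E"
      using E0 by (simp add: H_def algebra_simps)
    finally have "w / H * (norm \<xi>)\<^sup>2 \<le> w / H * (H * E)"
      using w H by (intro mult_left_mono) auto
    also have "\<dots> = (\<Sum>v\<in>V. w * (err \<gamma> \<xi> v)\<^sup>2)"
      using H by (simp add: E_def sum_distrib_left)
    also have "\<dots> \<le> W \<gamma> \<xi>"
      unfolding W_def using w by (intro sum_mono mult_right_mono) auto
    finally show ?thesis .
  qed
  then show ?thesis using w H by (intro exI[of _ "w / H"]) auto
qed

text \<open>Young's inequality splits a first high error into \<open>\<beta> / 2\<close> and its
  square over \<open>2 * \<beta>\<close>. The square is at most a dissipation term over
  \<open>\<Lambda>\<close>, hence paid for by the decrease of \<open>W\<close>.\<close>

lemma zero_dynamics_input_small: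
  assumes W: "W \<gamma> \<xi> \<le> b" and "0 < \<beta>" "0 < \<Lambda>"
  shows "norm (zero_dynamics_input q ell var \<xi> (feedback \<gamma> \<xi>))
    \<le> CARD('m) * (2 ^ Q * K * \<epsilon> + \<beta> / 2) + (\<Sum>v\<in>V. weight \<gamma> v * \<gamma> v * (err \<gamma> \<xi> v)\<^sup>2) / (2 * \<beta> * \<Lambda>)"
proof -
  define c where "c v = weight \<gamma> v * \<gamma> v * (err \<gamma> \<xi> v)\<^sup>2" for v
  have c0: "0 \<le> c v" if "v \<in> V" for v
    using weight_pos'[OF that] gain_pos[OF that] by (simp add: c_def)
  let ?p = "\<lambda>i. (i, ell i - 1)"
  have each: "\<bar>ext_state \<gamma> \<xi> i (ell i - 1)\<bar>
      \<le> (2 ^ Q * K * \<epsilon> + \<beta> / 2) + (if ?p i \<in> V then c (?p i) else 0) / (2 * \<beta> * \<Lambda>)" for i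
  proof (cases "?p i \<in> V")
    case True
    have "\<not> low (?p i)" using ell(1)[of i] by (simp add: low_def)
    then have "\<Lambda> \<le> weight \<gamma> (?p i) * \<gamma> (?p i)"
      using adm[OF True] by (simp add: admissible_def)
    then have "\<Lambda> * (err \<gamma> \<xi> (?p i))\<^sup>2 \<le> c (?p i)"
      unfolding c_def by (rule mult_right_mono) simp
    moreover have "2 * \<beta> * \<bar>err \<gamma> \<xi> (?p i)\<bar> \<le> \<beta>\<^sup>2 + (err \<gamma> \<xi> (?p i))\<^sup>2"
      using zero_le_power2[of "\<beta> - \<bar>err \<gamma> \<xi> (?p i)\<bar>"] by (simp add: power2_diff)
    then have "\<Lambda> * (2 * \<beta> * \<bar>err \<gamma> \<xi> (?p i)\<bar>) \<le> \<Lambda> * (\<beta>\<^sup>2 + (err \<gamma> \<xi> (?p i))\<^sup>2)"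
      using \<open>0 < \<Lambda>\<close> by simp
    ultimately have "2 * \<beta> * \<Lambda> * \<bar>err \<gamma> \<xi> (?p i)\<bar> \<le> \<Lambda> * \<beta>\<^sup>2 + c (?p i)"
      by (simp add: algebra_simps)
    then have "\<bar>err \<gamma> \<xi> (?p i)\<bar> \<le> (\<Lambda> * \<beta>\<^sup>2 + c (?p i)) / (2 * \<beta> * \<Lambda>)"
      using \<open>0 < \<beta>\<close> \<open>0 < \<Lambda>\<close> by (simp add: pos_le_divide_eq mult_ac)
    also have "\<dots> = \<beta> / 2 + c (?p i) / (2 * \<beta> * \<Lambda>)"
      using \<open>0 < \<beta>\<close> \<open>0 < \<Lambda>\<close> by (simp add: add_divide_distrib power2_eq_square)
    finally show ?thesis
      using zero_dynamics_input_bound[OF W, of i] True by (simp add: mem_V)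
  next
    case False
    then show ?thesis
      using zero_dynamics_input_bound[OF W, of i] \<open>0 < \<beta>\<close> by (simp add: mem_V)
  qed
  have "norm (zero_dynamics_input q ell var \<xi> (feedback \<gamma> \<xi>)) \<le> (\<Sum>i\<in>UNIV. \<bar>ext_state \<gamma> \<xi> i (ell i - 1)\<bar>)"
    using norm_le_l1_cart[of "zero_dynamics_input q ell var \<xi> (feedback \<gamma> \<xi>)"]
    by (simp add: zero_dynamics_input_eq)
  also have "\<dots> \<le> (\<Sum>i\<in>UNIV. (2 ^ Q * K * \<epsilon> + \<beta> / 2) + (if ?p i \<in> V then c (?p i) else 0) / (2 * \<beta> * \<Lambda>))"
    by (rule sum_mono) (rule each)
  also have "\<dots> = CARD('m) * (2 ^ Q * K * \<epsilon> + \<beta> / 2)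
      + (\<Sum>i\<in>UNIV. if ?p i \<in> V then c (?p i) else 0) / (2 * \<beta> * \<Lambda>)"
    by (simp add: sum.distrib sum_divide_distrib)
  also have "(\<Sum>i\<in>UNIV. if ?p i \<in> V then c (?p i) else 0) \<le> (\<Sum>v\<in>V. c v)"
  proof -
    have "(\<Sum>i\<in>UNIV. if ?p i \<in> V then c (?p i) else 0) = (\<Sum>i\<in>{i. ?p i \<in> V}. c (?p i))"
      by (simp add: sum.If_cases)
    also have "\<dots> = (\<Sum>v\<in>?p ` {i. ?p i \<in> V}. c v)"
      by (subst sum.reindex) (auto simp: inj_on_def)
    also have "\<dots> \<le> (\<Sum>v\<in>V. c v)"
      using finite_V c0 by (intro sum_mono2) auto
    finally show ?thesis .
  qed
  finally show ?thesis
    using \<open>0 < \<beta>\<close> \<open>0 < \<Lambda>\<close> by (simp add: c_def divide_right_mono)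
qed

text \<open>A cruder bound without gains and \<open>\<epsilon>\<close>: it fixes the ball for the
  Lipschitz constant of \<open>f0\<close>, on which the choice of \<open>\<epsilon>\<close>
  depends.\<close>

lemma zero_dynamics_input_bounded:
  assumes W: "W \<gamma> \<xi> \<le> b"
  shows "norm (zero_dynamics_input q ell var \<xi> (feedback \<gamma> \<xi>)) \<le> CARD('m) * (K + 2 ^ Q * K)"
proof -
  have "\<bar>ext_state \<gamma> \<xi> i (ell i - 1)\<bar> \<le> K + 2 ^ Q * K" for i
  proof -
    have "2 ^ Q * K * \<epsilon> \<le> 2 ^ Q * K" using \<epsilon> K_nonneg by (intro mult_left_le) auto
    moreover have "(if ell i - 1 < q i then \<bar>err \<gamma> \<xi> (i, ell i - 1)\<bar> else 0) \<le> K"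
      using err_first_high_bound[OF _ W, of i] K_nonneg by simp
    ultimately show ?thesis
      using zero_dynamics_input_bound[OF W, of i] by linarith
  qed
  then have "(\<Sum>i\<in>UNIV. \<bar>ext_state \<gamma> \<xi> i (ell i - 1)\<bar>) \<le> CARD('m) * (K + 2 ^ Q * K)"
    by (intro sum_bounded_above) auto
  then show ?thesis
    using norm_le_l1_cart[of "zero_dynamics_input q ell var \<xi> (feedback \<gamma> \<xi>)"]
    by (simp add: zero_dynamics_input_eq)
qed

end

end

section \<open>Semi-global stabilization\<close>

context chain_system
begin

lemma closed_loop_0: "control_system q ell var f0 \<delta> 0 (feedback \<gamma> 0) = 0"
proof -
  have v: "feedback \<gamma> 0 = 0"
    using feedback_linear by (rule linear_simps(3))
  have "f0 0 0 = 0"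
    using zero_dynamics by (simp add: globally_asymptotically_stable_at_def)
  moreover have "zero_dynamics_input q ell var 0 0 = 0"
    by (simp add: zero_dynamics_input_def vec_eq_iff)
  moreover have "chain_field q var \<delta> 0 0 0 = 0"
    by (simp add: chain_field_def vec_eq_iff case_prod_beta)
  ultimately show ?thesis
    by (simp add: control_system_def zero_prod_def v)
qed

lemma zero_dynamics_input_linear:
  "bounded_linear (\<lambda>\<xi>. zero_dynamics_input q ell var \<xi> (feedback \<gamma> \<xi>))"
proof -
  interpret fb: bounded_linear "feedback \<gamma>" by (rule feedback_linear)
  have "linear (\<lambda>\<xi>. zero_dynamics_input q ell var \<xi> (feedback \<gamma> \<xi>))"
    by (intro linearI) (simp_all add: zero_dynamics_input_def vec_eq_iff fb.add fb.scaleR)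
  then show ?thesis using linear_conv_bounded_linear by blast
qed

lemma zero_dynamics_lipschitz: "lipschitz_on_bounded (\<lambda>\<eta>. f0 \<eta> 0)"
proof -
  have "lipschitz_on_bounded (\<lambda>\<eta>::'e. (\<eta>, 0::(real, 'm) vec))"
    by (intro lipschitz_on_bounded_Pair lipschitz_on_bounded_linear[OF bounded_linear_ident]
        lipschitz_on_bounded_const)
  from lipschitz_on_bounded_compose[OF this f0_lipschitz] show ?thesis by simp
qed

text \<open>The order of choices excludes circularity: \<open>C\<close> from the initial states;
  \<open>T\<close>, \<open>\<sigma>\<close>, \<open>R\<close> from the zero dynamics;
  \<open>L\<close> from \<open>R\<close> and \<open>B\<close>; then \<open>\<beta>\<close>,
  \<open>\<epsilon>\<close>, \<open>\<Lambda>\<close>; and the gains last.\<close>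

theorem semiglobal_stabilization: "semiglobally_stabilizable (control_system q ell var f0 \<delta>)"
  unfolding semiglobally_stabilizable_def
proof (intro allI impI)
  fix X0 :: "('e \<times> (real ^ 'k)) set" assume "compact X0"
  then obtain B0 where B0: "\<And>x. x \<in> X0 \<Longrightarrow> norm x \<le> B0"
    using compact_imp_bounded bounded_iff by metis
  define C where "C = max 1 B0"
  have C_bounds: "1 \<le> C" "\<And>x. x \<in> X0 \<Longrightarrow> norm x \<le> C"
    using B0 by (auto simp: C_def le_max_iff_disj)
  define f where "f = (\<lambda>\<eta>. f0 \<eta> 0)"
  have f: "lipschitz_on_bounded f" "globally_asymptotically_stable_at f 0"
    unfolding f_def by (rule zero_dynamics_lipschitz, rule zero_dynamics)
  obtain B1 where B1: "\<And>x \<phi> t. norm x \<le> C \<Longrightarrow> forward_solution f x \<phi> \<Longrightarrow> t \<ge> 0 \<Longrightarrow> norm (\<phi> t) \<le> B1"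
    using globally_asymptotically_stable_uniform[OF f zero_less_one, of C] by blast
  \<comment> \<open>The maximum guarantees \<open>C < R\<close> below.\<close>
  have "norm (\<phi> t) \<le> max B1 C" if "norm x \<le> C" "forward_solution f x \<phi>" "t \<ge> 0" for x \<phi> t
    using B1[OF that] by (rule max.coboundedI1)
  moreover have "0 < C" using C_bounds(1) by simp
  ultimately obtain T \<sigma> where T: "0 < T" and \<sigma>: "0 < \<sigma>"
    and confined: "robustly_confined f C (max B1 C + C / 2) T \<sigma>"
    using robustly_confined_exists[OF f, of C "max B1 C"] by meson
  define R where "R = max B1 C + C / 2"
  have "C < R" using C_bounds(1) by (simp add: R_def less_add_same_cancel1 max_def)
  define N where "N = real (card V)"
  have N: "0 < N" using finite_V V_nonempty by (simp add: N_def card_gt_0_iff)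
  define m where "m = real CARD('m)"
  have m: "0 < m" by (simp add: m_def)
  \<comment> \<open>This is \<open>K\<close> for the level \<open>2 * N\<close>, spelled out since
    \<epsilon>, a parameter of the locale, is chosen only afterwards.\<close>
  define k0 where "k0 = sqrt (2 * N) * (C * 2 ^ Q * 4 ^ Q)"
  have k0: "0 < k0" using N C_bounds by (simp add: k0_def)
  define B where "B = m * (k0 + 2 ^ Q * k0)"
  obtain L0 where L0: "L0-lipschitz_on (cball 0 (R + B)) (\<lambda>(\<eta>, w). f0 \<eta> w)"
    using f0_lipschitz unfolding lipschitz_on_bounded_def by blast
  define L where "L = L0 + 1"
  have L: "0 < L" "L0 \<le> L" using lipschitz_on_nonneg[OF L0] by (auto simp: L_def)
  have f0_diff: "norm (f0 \<eta> w - f \<eta>) \<le> L * norm w" if "norm \<eta> \<le> R" "norm w \<le> B" for \<eta> w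
  proof -
    have "norm (\<eta>, w) \<le> R + B" "norm (\<eta>, 0::(real, 'm) vec) \<le> R + B"
      using that norm_Pair_le[where x=\<eta> and y=w] norm_ge_zero[of w] by (auto simp del: norm_ge_zero)
    then have "norm (f0 \<eta> w - f0 \<eta> 0) \<le> L0 * norm ((\<eta>, w) - (\<eta>, 0))"
      using lipschitz_on_normD[OF L0, of "(\<eta>, w)" "(\<eta>, 0)"] by simp
    also have "\<dots> \<le> L * norm w"
      using L(2) by (simp add: mult_right_mono)
    finally show ?thesis by (simp add: f_def)
  qed
  \<comment> \<open>Of the budget \<open>\<sigma>\<close>, the low-gain error gets a quarter through
    \<open>\<epsilon>\<close>, the constant part of Young's inequality a quarter through
    \<open>\<beta>\<close>, and the decrease of \<open>W\<close> a half through
    \<open>\<Lambda>\<close>.\<close>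
  define \<beta> where "\<beta> = \<sigma> / (2 * L * m * T)"
  define \<epsilon> where "\<epsilon> = min 1 (\<sigma> / (4 * L * m * 2 ^ Q * k0 * T))"
  define \<Lambda> where "\<Lambda> = L * N / (\<beta> * \<sigma>)"
  have \<beta>: "0 < \<beta>" using \<sigma> L(1) m T by (simp add: \<beta>_def)
  have \<epsilon>: "0 < \<epsilon>" "\<epsilon> \<le> 1" using \<sigma> L(1) m T k0 by (auto simp: \<epsilon>_def)
  have \<Lambda>: "0 < \<Lambda>" using \<sigma> L(1) N \<beta> by (simp add: \<Lambda>_def)
  define \<rho> where "\<rho> = L * (m * (2 ^ Q * k0 * \<epsilon> + \<beta> / 2))"
  define \<mu> where "\<mu> = L / (2 * \<beta> * \<Lambda>)"
  have "0 \<le> \<rho>" "0 \<le> \<mu>" using L(1) m k0 \<epsilon>(1) \<beta> \<Lambda> by (simp_all add: \<rho>_def \<mu>_def)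
  have small: "\<rho> * T + \<mu> * N \<le> \<sigma>"
  proof -
    have "\<epsilon> \<le> \<sigma> / (4 * L * m * 2 ^ Q * k0 * T)" by (simp add: \<epsilon>_def)
    moreover have "0 < 4 * L * m * 2 ^ Q * k0 * T" using L(1) m k0 T by simp
    ultimately have "\<epsilon> * (4 * L * m * 2 ^ Q * k0 * T) \<le> \<sigma>" by (simp add: pos_le_divide_eq)
    moreover have "\<beta> * (2 * L * m * T) = \<sigma>" using L(1) m T by (simp add: \<beta>_def)
    moreover have "\<mu> * N = \<sigma> / 2"
      using L(1) \<beta> \<sigma> N by (simp add: \<mu>_def \<Lambda>_def)
    ultimately show ?thesis by (simp add: \<rho>_def algebra_simps)
  qed
  \<comment> \<open>The level is twice the initial bound, which leaves room for
    \<open>bootstrap\<close>; \<open>Y\<close> is the value supplied by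
    \<open>head_bound\<close>.\<close>
  interpret chain_design q ell var f0 \<delta> pos C \<epsilon> R \<Lambda> "2 * N" "k0 / \<epsilon> ^ Q"
    by unfold_locales (use C_bounds(1) \<epsilon> N in auto)
  have K_eq: "K = k0" by (simp add: k0_def K_def)
  obtain \<gamma> where adm: "\<And>v. v \<in> V \<Longrightarrow> admissible v \<gamma>"
    using admissible_exists by blast
  define F where "F x = control_system q ell var f0 \<delta> x (feedback \<gamma> (snd x))" for x
  have F: "fst (F (\<eta>, \<xi>)) = f0 \<eta> (zero_dynamics_input q ell var \<xi> (feedback \<gamma> \<xi>))"
    "snd (F (\<eta>, \<xi>)) = chain_field q var \<delta> \<eta> \<xi> (feedback \<gamma> \<xi>)" for \<eta> \<xi>
    by (simp_all add: F_def control_system_def)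
  define S where "S \<xi> = (\<Sum>v\<in>V. weight \<gamma> v * \<gamma> v * (err \<gamma> \<xi> v)\<^sup>2)" for \<xi>
  have dissip: "dW \<gamma> \<xi> (snd (F (\<eta>, \<xi>))) \<le> - S \<xi>" if "norm \<eta> \<le> R" "W \<gamma> \<xi> \<le> 2 * N" for \<eta> \<xi>
    unfolding F S_def using that by (intro dissipation adm) (simp_all add: K_eq)
  have input: "norm (zero_dynamics_input q ell var \<xi> (feedback \<gamma> \<xi>)) \<le> B" if "W \<gamma> \<xi> \<le> 2 * N" for \<xi>
    using zero_dynamics_input_bounded[OF adm that] by (simp add: B_def K_eq m_def)
  obtain a where a: "0 < a" "\<And>\<xi>. a * (norm \<xi>)\<^sup>2 \<le> W \<gamma> \<xi>"
    using W_coercive[OF adm] by blast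
  obtain H where H: "\<And>\<xi>. norm (zero_dynamics_input q ell var \<xi> (feedback \<gamma> \<xi>)) \<le> norm \<xi> * H" "0 \<le> H"
    using bounded_linear.nonneg_bounded[OF zero_dynamics_input_linear] by blast
  \<comment> \<open>Term by term, the dissipation is the gain times the summand of \<open>W\<close>,
    so the smallest gain is a rate of decay.\<close>
  define c where "c = Min (\<gamma> ` V)"
  have c: "0 < c" "\<And>v. v \<in> V \<Longrightarrow> c \<le> \<gamma> v"
    unfolding c_def using finite_V V_nonempty gain_pos[OF adm] by auto
  have stab: "locally_asymptotically_stable_at F 0"
    and attracted: "{(\<eta>, \<xi>). norm \<eta> \<le> C \<and> W \<gamma> \<xi> \<le> N} \<subseteq> domain_of_attraction F 0"
  proof -
    have F_lip: "lipschitz_on_bounded F"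
      unfolding F_def[abs_def] by (rule control_system_lipschitz)
    have F_0: "F 0 = 0" by (simp add: F_def closed_loop_0)
    have decay: "dW \<gamma> \<xi> (snd (F (\<eta>, \<xi>))) \<le> - c * W \<gamma> \<xi>"
      if "norm \<eta> \<le> R" "W \<gamma> \<xi> \<le> 2 * N" for \<eta> \<xi>
    proof -
      have "c * W \<gamma> \<xi> = (\<Sum>v\<in>V. c * (weight \<gamma> v * (err \<gamma> \<xi> v)\<^sup>2))"
        by (simp add: W_def sum_distrib_left)
      also have "\<dots> \<le> (\<Sum>v\<in>V. \<gamma> v * (weight \<gamma> v * (err \<gamma> \<xi> v)\<^sup>2))"
        using c(2) weight_pos'[OF adm] by (intro sum_mono mult_right_mono) (auto simp: less_imp_le)
      also have "\<dots> = S \<xi>" by (simp add: S_def mult_ac)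
      finally show ?thesis using dissip[OF that] by simp
    qed
    have perturbation: "norm (fst (F (\<eta>, \<xi>)) - f \<eta>) \<le> \<rho> - \<mu> * dW \<gamma> \<xi> (snd (F (\<eta>, \<xi>)))"
      if "norm \<eta> \<le> R" "W \<gamma> \<xi> \<le> 2 * N" for \<eta> \<xi>
    proof -
      have "norm (fst (F (\<eta>, \<xi>)) - f \<eta>) \<le> L * norm (zero_dynamics_input q ell var \<xi> (feedback \<gamma> \<xi>))"
        unfolding F using that input by (intro f0_diff) auto
      also have "\<dots> \<le> L * (m * (2 ^ Q * k0 * \<epsilon> + \<beta> / 2) + S \<xi> / (2 * \<beta> * \<Lambda>))"
        using zero_dynamics_input_small[OF adm that(2) \<beta> \<Lambda>] L(1)
        by (intro mult_left_mono) (simp_all add: S_def m_def K_eq)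
      also have "\<dots> = \<rho> + \<mu> * S \<xi>"
        by (simp add: \<rho>_def \<mu>_def distrib_left)
      also have "\<mu> * S \<xi> \<le> \<mu> * - dW \<gamma> \<xi> (snd (F (\<eta>, \<xi>)))"
        using dissip[OF that] \<open>0 \<le> \<mu>\<close> by (intro mult_left_mono) auto
      finally show ?thesis by simp
    qed
    have linear: "norm (fst (F (\<eta>, \<xi>)) - f \<eta>) \<le> L * H * norm \<xi>"
      if "norm \<eta> \<le> R" "W \<gamma> \<xi> \<le> 2 * N" for \<eta> \<xi>
    proof -
      have "norm (fst (F (\<eta>, \<xi>)) - f \<eta>) \<le> L * norm (zero_dynamics_input q ell var \<xi> (feedback \<gamma> \<xi>))"
        unfolding F using that input by (intro f0_diff) auto
      also have "\<dots> \<le> L * (norm \<xi> * H)"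
        using H(1) L(1) by (intro mult_left_mono) auto
      finally show ?thesis by (simp add: mult_ac)
    qed
    have "0 \<le> L * H" using L(1) H(2) by simp
    note * = F_lip F_0 f W_has_derivative W_0 a confined[folded R_def] \<open>0 < C\<close> \<open>C < R\<close> N decay c(1)
      perturbation \<open>0 \<le> \<rho>\<close> \<open>0 \<le> \<mu>\<close> small linear \<open>0 \<le> L * H\<close>
    show "locally_asymptotically_stable_at F 0"
      by (rule cascade_stability(1)[OF *])
    show "{(\<eta>, \<xi>). norm \<eta> \<le> C \<and> W \<gamma> \<xi> \<le> N} \<subseteq> domain_of_attraction F 0"
      by (rule cascade_stability(2)[OF *])
  qed
  have "X0 \<subseteq> domain_of_attraction F 0"
  proof
    fix x assume "x \<in> X0"
    then have "norm (fst x) \<le> C" "norm (snd x) \<le> C"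
      using C_bounds(2)[of x] norm_fst_le[of "fst x" "snd x"] norm_snd_le[of "snd x" "fst x"] by auto
    then have "norm (fst x) \<le> C \<and> W \<gamma> (snd x) \<le> N"
      using W_initial[OF adm] by (simp add: N_def)
    then show "x \<in> domain_of_attraction F 0"
      using attracted by (auto simp: case_prod_beta)
  qed
  moreover have "smooth (\<lambda>x::'e \<times> (real ^ 'k). feedback \<gamma> (snd x))"
    using bounded_linear_compose[OF feedback_linear bounded_linear_snd]
    by (rule bounded_linear_imp_smooth)
  ultimately show "\<exists>\<alpha>. smooth \<alpha> \<and>
      locally_asymptotically_stable_at (\<lambda>x. control_system q ell var f0 \<delta> x (\<alpha> x)) 0 \<and>
      X0 \<subseteq> domain_of_attraction (\<lambda>x. control_system q ell var f0 \<delta> x (\<alpha> x)) 0"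
    using stab unfolding F_def[abs_def] by blast
qed

end

lemma depends_only_on_mono: "depends_only_on var g S \<Longrightarrow> S \<subseteq> S' \<Longrightarrow> depends_only_on var g S'"
  unfolding depends_only_on_def by blast

theorem theorem5p2p2:
  fixes q ell :: "'m::{finite,linorder} \<Rightarrow> nat"
    and var :: "'m \<times> nat \<Rightarrow> 'k::finite"
    and f0 :: "'e::euclidean_space \<Rightarrow> (real, 'm) vec \<Rightarrow> 'e"
    and \<delta> :: "'m \<Rightarrow> nat \<Rightarrow> 'm \<Rightarrow> 'e \<Rightarrow> real ^ 'k \<Rightarrow> real"
    and \<kappa> :: "('m \<times> nat) list"
  assumes var: "bij_betw var (chain_vars q) UNIV"
    and q_pos: "\<And>i. 1 \<le> q i"
    and q_mono: "mono q"
    and l_first: "1 \<le> ell first_chain" "ell first_chain \<le> q first_chain + 1"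
    and l_other: "\<And>i. i \<noteq> first_chain \<Longrightarrow> 1 \<le> ell i \<and> ell i \<le> q first_chain"
    and f0_smooth: "smooth (\<lambda>(\<eta>, w). f0 \<eta> w)"
    and delta_smooth:
      "\<And>i j l. 1 \<le> j \<Longrightarrow> j < q i \<Longrightarrow> l < i \<Longrightarrow> smooth (\<lambda>(\<eta>, \<xi>). \<delta> i j l \<eta> \<xi>)"
    and delta_zero:
      "\<And>i j l \<eta> \<xi>. 1 \<le> j \<Longrightarrow> j < q i \<Longrightarrow> l < i \<Longrightarrow> j < q l \<Longrightarrow> \<delta> i j l \<eta> \<xi> = 0"
    and zero_dynamics: "globally_asymptotically_stable_at (\<lambda>\<eta>. f0 \<eta> 0) 0"
    and kappa_all: "distinct \<kappa>" "set \<kappa> = chain_vars q"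
    and kappa_first:
      "set (take (\<Sum>s\<in>UNIV. ell s - 1) \<kappa>) = {(s, p). 1 \<le> p \<and> p \<le> ell s - 1}"
    and kappa_a: "\<And>i j. 1 \<le> j \<Longrightarrow> j < q i \<Longrightarrow> earlier_in \<kappa> (i, j) (i, j + 1)"
    and kappa_b:
      "\<And>i j l p. 1 \<le> j \<Longrightarrow> j < q i \<Longrightarrow> l < i \<Longrightarrow> \<exists>\<eta> \<xi>. \<delta> i j l \<eta> \<xi> \<noteq> 0 \<Longrightarrow>
         1 \<le> p \<Longrightarrow> p \<le> q l \<Longrightarrow> earlier_in \<kappa> (l, p) (i, j)"
    and kappa_c:
      "\<And>i j l. 1 \<le> j \<Longrightarrow> j < q i \<Longrightarrow> l < i \<Longrightarrow>
         depends_only_on var (\<delta> i j l)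
           ({(r, 1) |r. True} \<union> {p. p = (i, j) \<or> earlier_in \<kappa> p (i, j)})"
  shows "semiglobally_stabilizable (control_system q ell var f0 \<delta>)"
proof -
  define idx where "idx = the_inv_into {..<length \<kappa>} ((!) \<kappa>)"
  have bij: "bij_betw ((!) \<kappa>) {..<length \<kappa>} (set \<kappa>)"
    using kappa_all(1) by (rule bij_betw_nth) auto
  have idx_nth: "idx (\<kappa> ! r) = r" if "r < length \<kappa>" for r
    unfolding idx_def using bij that by (intro the_inv_into_f_f) (auto simp: bij_betw_def)
  have earlier: "idx a < idx b" if "earlier_in \<kappa> a b" for a b
    using that idx_nth by (auto simp: earlier_in_def)
  have earlier_mem: "a \<in> chain_vars q" if "earlier_in \<kappa> a b" for a b
    using that unfolding kappa_all(2)[symmetric] by (auto simp: earlier_in_def)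
  have idx_inj: "inj_on idx (chain_vars q)"
    using bij_betw_the_inv_into[OF bij] by (simp add: idx_def kappa_all(2) bij_betw_def)
  have first_le: "first_chain \<le> i" for i :: 'm
    by (simp add: first_chain_def)
  \<comment> \<open>Names count from 1, indices of the locale from 0.\<close>
  define pos where "pos v = idx (fst v, Suc (snd v))" for v :: "'m \<times> nat"
  interpret chain_system q ell var f0 \<delta> pos
  proof
    show "bij_betw var (chain_vars q) UNIV" by (rule var)
    show "0 < q i" for i using q_pos[of i] by simp
    show "1 \<le> ell i" for i using l_first l_other by (cases "i = first_chain") auto
    show "ell i \<le> q i + 1" for i
      using l_first l_other[of i] monoD[OF q_mono first_le[of i]] by (cases "i = first_chain") auto
    show "lipschitz_on_bounded (\<lambda>(\<eta>, w). f0 \<eta> w)"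
      using f0_smooth by (rule smooth_imp_lipschitz_on_bounded)
    show "lipschitz_on_bounded (\<lambda>(\<eta>, \<xi>). \<delta> i (Suc r) l \<eta> \<xi>)" if "Suc r < q i" "l < i" for i r l
      using that by (intro smooth_imp_lipschitz_on_bounded delta_smooth) auto
    \<comment> \<open>As \<open>l < i\<close>, chain \<open>i\<close> is not the first, so
      \<open>ell i\<close> is at most the shortest length:
      \<open>Suc r < ell i \<le> q first_chain \<le> q l\<close>.\<close>
    show "\<delta> i (Suc r) l \<eta> \<xi> = 0" if "Suc r < q i" "Suc r < ell i" "l < i" for i r l \<eta> \<xi>
    proof (rule delta_zero)
      have "i \<noteq> first_chain" using first_le[of l] that(3) by auto
      then show "Suc r < q l"
        using l_other[of i] that(2) monoD[OF q_mono first_le[of l]] by simp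
    qed (use that in auto)
    show "globally_asymptotically_stable_at (\<lambda>\<eta>. f0 \<eta> 0) 0" by (rule zero_dynamics)
    show "inj_on pos (SIGMA i:UNIV. {..<q i})"
    proof (rule inj_onI)
      fix u v assume uv: "u \<in> (SIGMA i:UNIV. {..<q i})" "v \<in> (SIGMA i:UNIV. {..<q i})" "pos u = pos v"
      then have "(fst u, Suc (snd u)) = (fst v, Suc (snd v))"
        by (intro inj_onD[OF idx_inj]) (auto simp: pos_def chain_vars_def)
      then show "u = v" by (simp add: prod_eq_iff)
    qed
    show "pos (i, j) < pos (i, Suc j)" if "Suc j < q i" for i j
      using earlier[OF kappa_a[of "Suc j" i]] that by (simp add: pos_def)
    show "pos (l, m) < pos (i, r)" if "Suc r < q i" "l < i" "\<delta> i (Suc r) l \<eta> \<xi> \<noteq> 0" "m < q l"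
      for i r l m \<eta> \<xi>
      using earlier[OF kappa_b[of "Suc r" i l "Suc m"]] that by (auto simp: pos_def)
    show "depends_only_on var (\<delta> i (Suc r) l)
        ({(r, 1) |r. True} \<union> {(i', Suc j') |i' j'. j' < q i' \<and> pos (i', j') \<le> pos (i, r)})"
      if "Suc r < q i" "l < i" for i r l
    proof (rule depends_only_on_mono[OF kappa_c])
      \<comment> \<open>The heads occur unchanged in both sets; only the order in the list has to be
        translated into positions.\<close>
      have "p \<in> {(i', Suc j') |i' j'. j' < q i' \<and> pos (i', j') \<le> pos (i, r)}"
        if p: "p = (i, Suc r) \<or> earlier_in \<kappa> p (i, Suc r)" for p
      proof -
        have "p \<in> chain_vars q" "idx p \<le> idx (i, Suc r)"
          using p earlier[of p "(i, Suc r)"] earlier_mem[of p "(i, Suc r)"] \<open>Suc r < q i\<close>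
          by (auto simp: chain_vars_def)
        moreover obtain i' j where "p = (i', j)" by (cases p)
        moreover have "j = Suc (j - 1)" using calculation by (auto simp: chain_vars_def)
        ultimately show ?thesis
          by (intro CollectI exI[of _ i'] exI[of _ "j - 1"]) (auto simp: chain_vars_def pos_def)
      qed
      then show "{(r, 1) |r. True} \<union> {p. p = (i, Suc r) \<or> earlier_in \<kappa> p (i, Suc r)}
          \<subseteq> {(r, 1) |r. True} \<union> {(i', Suc j') |i' j'. j' < q i' \<and> pos (i', j') \<le> pos (i, r)}"
        by blast
    qed (use that in auto)
  qed
  show ?thesis by (rule semiglobal_stabilization)
qed

end
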